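(* Let $K>0$ be a real number and let $m$ be an odd integer with $m\geq 3$ and $m\geq\lfloor K\rfloor$. Let $a=a_N>0$ be real numbers with $a=o\left(\frac{1}{N^{m+2}}\right)$ as $N\to\infty$, and put $\alpha=a/N$. Then, as $N\to\infty$, $$\left(\frac{-a}{N}\right)^K\int_{SO(2N+1)}\left(\frac{\Lambda_X'}{\Lambda_X}(e^{-\alpha})\right)^K\,\mathrm{d}_{\mathrm{Haar}}(X)=1-Ka+\frac{Ka}{2N}+\frac{K(K+1)}{2}a^2-\frac{K(K+1)a^2}{2N}+\frac{a^2}{N^2}\,K\,\frac{3K-1}{24}+\mathcal{O}(N^m a^3).$$
   Context: $SO(2N+1)$ is the group of real $(2N+1)\times(2N+1)$ matrices $X$ with $XX^T=X^TX=I$ and $\det X=1$, and $\mathrm{d}_{\mathrm{Haar}}(X)$ is its Haar probability measure. The characteristic polynomial is $\Lambda_X(s)=\det(I-sX^* )$, where $X^*$ is the conjugate transpose, and $\Lambda_X'/\Lambda_X$ is its logarithmic derivative in $s$. For non-integer $K$ the powers are read with the same branch of $(-1)^K$ for both factors, i.e. the left-hand side means $\int_{SO(2N+1)}\left(\frac{-a}{N}\cdot\frac{\Lambda_X'}{\Lambda_X}(e^{-\alpha})\right)^K\mathrm{d}_{\mathrm{Haar}}(X)$; for $N$ large the base of this power is a positive real number. Implied constants may depend on $K$ and $m$ but not on $N$. *)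

theory Defs
  imports
    "HOL-Probability.Probability"
    "Jordan_Normal_Form.Schur_Decomposition"
begin

definition SO_mats :: "nat \<Rightarrow> real mat set" where
  "SO_mats n = {X \<in> carrier_mat n n.
     X * transpose_mat X = 1\<^sub>m n \<and> transpose_mat X * X = 1\<^sub>m n \<and> Determinant.det X = 1}"

text \<open>The type of matrices carries no topology. The Borel sets of the special orthogonal group,
  as a subspace of the Euclidean space of all \<open>n \<times> n\<close> matrices, are those induced from the
  product of the Borel sigma-algebras of the finitely many entries.\<close>

definition SO_borel :: "nat \<Rightarrow> real mat measure" where
  "SO_borel n = vimage_algebra (SO_mats n)
     (\<lambda>X. \<lambda>(i, j) \<in> {..<n} \<times> {..<n}. X $$ (i, j))
     (\<Pi>\<^sub>M p \<in> {..<n} \<times> {..<n}. (borel :: real measure))"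

lemma space_SO_borel [simp]: "space (SO_borel n) = SO_mats n"
  by (simp add: SO_borel_def)

lemma SO_mats_mult:
  assumes "X \<in> SO_mats n" "Y \<in> SO_mats n"
  shows "X * Y \<in> SO_mats n"
proof -
  have X: "X \<in> carrier_mat n n" "X * transpose_mat X = 1\<^sub>m n" "transpose_mat X * X = 1\<^sub>m n"
      "Determinant.det X = 1"
    and Y: "Y \<in> carrier_mat n n" "Y * transpose_mat Y = 1\<^sub>m n" "transpose_mat Y * Y = 1\<^sub>m n"
      "Determinant.det Y = 1"
    using assms by (auto simp: SO_mats_def)
  have T: "transpose_mat X \<in> carrier_mat n n" "transpose_mat Y \<in> carrier_mat n n"
    using X(1) Y(1) by auto
  have tr: "transpose_mat (X * Y) = transpose_mat Y * transpose_mat X"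
    by (rule transpose_mult[OF X(1) Y(1)])
  have "(X * Y) * transpose_mat (X * Y) = X * (Y * (transpose_mat Y * transpose_mat X))"
    unfolding tr using X(1) Y(1) T by (simp add: assoc_mult_mat[of _ n n _ n _ n])
  also have "Y * (transpose_mat Y * transpose_mat X) = transpose_mat X"
    using assoc_mult_mat[OF Y(1) T(2) T(1)] Y(2) T(1) by simp
  finally have 1: "(X * Y) * transpose_mat (X * Y) = 1\<^sub>m n"
    using X(2) by simp
  have "transpose_mat (X * Y) * (X * Y) = transpose_mat Y * (transpose_mat X * (X * Y))"
    unfolding tr using X(1) Y(1) T by (simp add: assoc_mult_mat[of _ n n _ n _ n])
  also have "transpose_mat X * (X * Y) = Y"
    using assoc_mult_mat[OF T(1) X(1) Y(1)] X(3) Y(1) by simp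
  finally have 2: "transpose_mat (X * Y) * (X * Y) = 1\<^sub>m n"
    using Y(3) by simp
  have "Determinant.det (X * Y) = 1"
    using det_mult[OF X(1) Y(1)] X(4) Y(4) by simp
  with 1 2 X(1) Y(1) show ?thesis
    by (auto simp: SO_mats_def)
qed

lemma measurable_SO_entry:
  assumes "i < n" "j < n"
  shows "(\<lambda>X. X $$ (i, j)) \<in> borel_measurable (SO_borel n)"
proof -
  let ?P = "\<Pi>\<^sub>M p \<in> {..<n} \<times> {..<n}. (borel :: real measure)"
  let ?f = "\<lambda>X :: real mat. \<lambda>(i, j) \<in> {..<n} \<times> {..<n}. X $$ (i, j)"
  have "?f \<in> measurable (SO_borel n) ?P"
    unfolding SO_borel_def by (rule measurable_vimage_algebra1) (auto simp: space_PiM)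
  moreover have "(\<lambda>w. w (i, j)) \<in> measurable ?P borel"
    by (rule measurable_component_singleton) (use assms in auto)
  ultimately have "(\<lambda>X. ?f X (i, j)) \<in> borel_measurable (SO_borel n)"
    by (rule measurable_compose)
  then show ?thesis
    using assms by simp
qed

lemma measurable_SO_translation:
  assumes "Y \<in> SO_mats n"
  shows "(\<lambda>X. Y * X) \<in> measurable (SO_borel n) (SO_borel n)"
proof -
  let ?f = "\<lambda>X :: real mat. \<lambda>(i, j) \<in> {..<n} \<times> {..<n}. X $$ (i, j)"
  have "(\<lambda>X. ?f (Y * X)) \<in> measurable (SO_borel n) (\<Pi>\<^sub>M p \<in> {..<n} \<times> {..<n}. (borel :: real measure))"
  proof (rule measurable_PiM_single')
    fix p assume "p \<in> {..<n} \<times> {..<n}"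
    then obtain i j where p: "p = (i, j)" and ij: "i < n" "j < n" by auto
    have "(\<lambda>X. \<Sum>k<n. Y $$ (i, k) * X $$ (k, j)) \<in> borel_measurable (SO_borel n)"
      using ij by (intro borel_measurable_sum borel_measurable_times measurable_SO_entry) auto
    also have "?this \<longleftrightarrow> (\<lambda>X. ?f (Y * X) p) \<in> borel_measurable (SO_borel n)"
    proof (rule measurable_cong)
      fix X assume "X \<in> space (SO_borel n)"
      then have "X \<in> carrier_mat n n" "Y \<in> carrier_mat n n"
        using assms by (auto simp: SO_mats_def)
      then show "(\<Sum>k<n. Y $$ (i, k) * X $$ (k, j)) = ?f (Y * X) p"
        using ij by (auto simp: p scalar_prod_def lessThan_atLeast0 intro!: sum.cong)
    qed
    finally show "(\<lambda>X. ?f (Y * X) p) \<in> borel_measurable (SO_borel n)" .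
  qed (auto simp: PiE_def extensional_def)
  then show ?thesis
    unfolding SO_borel_def
    by (intro measurable_vimage_algebra2) (use assms SO_mats_mult in \<open>auto simp: SO_borel_def\<close>)
qed

text \<open>By compactness a left-invariant Borel probability measure on the group exists, is unique and
  is also right-invariant, so left invariance suffices to pin it down.\<close>

definition is_Haar_prob_SO :: "nat \<Rightarrow> real mat measure \<Rightarrow> bool" where
  "is_Haar_prob_SO n \<mu> \<longleftrightarrow>
     prob_space \<mu> \<and> sets \<mu> = sets (SO_borel n) \<and>
     (\<forall>Y \<in> SO_mats n. distr \<mu> (SO_borel n) (\<lambda>X. Y * X) = \<mu>)"

definition Lambda_char :: "real mat \<Rightarrow> complex \<Rightarrow> complex" where
  "Lambda_char X s =
     Determinant.det (1\<^sub>m (dim_row X) - s \<cdot>\<^sub>m mat_adjoint (map_mat complex_of_real X))"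

definition Lambda_logderiv :: "real mat \<Rightarrow> complex \<Rightarrow> complex" where
  "Lambda_logderiv X s = deriv (Lambda_char X) s / Lambda_char X s"

end

theory Submission
  imports Defs
begin

text \<open>
  Write \<open>P\<^sub>k = tr X\<^sup>k\<close>, \<open>n = 2 N + 1\<close> and \<open>s = exp (- \<alpha>)\<close>. The eigenvalues of \<open>X\<close> are
  \<open>1\<close> and \<open>2 N\<close> further points of the unit circle, so the base of the power is \<open>f\<^sub>0 + Y\<close>, where
  \<open>f\<^sub>0\<close> is deterministic and \<open>Y \<ge> 0\<close> is a multiple of the sum of the Poisson kernels \<open>p\<close> at the
  nontrivial eigenvalues. Both \<open>\<Sum> p\<close> and \<open>\<Sum> p\<^sup>2\<close> are power series in \<open>s\<close> whose coefficients are
  linear in the \<open>P\<^sub>k\<close>, and Cauchy-Schwarz gives \<open>(\<Sum> p)\<^sup>2 \<le> 2 N \<Sum> p\<^sup>2\<close>. Hence the values of \<open>E P\<^sub>k\<close>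
  suffice for \<open>E Y = a\<^sup>2 + O(a\<^sup>3)\<close> and \<open>E Y\<^sup>2 = O(N a\<^sup>3)\<close>; a Taylor expansion of the power in \<open>Y\<close>,
  together with \<open>Y \<le> 6 N\<close> and \<open>K < m + 1\<close>, finishes the proof.

  The moments \<open>E P\<^sub>k\<close> come from integration by parts on the group. Let \<open>h\<^sub>l\<close> and \<open>e\<^sub>r\<close> be the
  coefficients of \<open>1 / det (1 - z X)\<close> and \<open>det (1 - z X)\<close>. If \<open>D\<close> runs over the
  derivatives along the plane rotations, then \<open>E (\<Sum> D (e\<^sub>r D h\<^sub>l)) = 0\<close>, and the orthogonality of
  \<open>X\<close> turns this into a linear recursion for \<open>E (e\<^sub>r h\<^sub>l)\<close> alone. It determines these numbers for
  \<open>r \<le> n - 2\<close>; the remaining ones follow from \<open>e\<^bsub>n - r\<^esub> = - e\<^sub>r\<close>, and \<open>P\<^sub>k = - \<Sum> r e\<^sub>r h\<^bsub>k - r\<^esub>\<close>.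
\<close>

section \<open>Symmetric functions via Newton's identities\<close>

text \<open>With \<open>s\<close> this close to 1, traces \<open>P\<^sub>k\<close> with
  \<open>k\<close> far beyond \<open>n\<close> carry full weight, so their means are needed for
  every \<open>k\<close>, not only in the range where traces behave like independent Gaussians.
  \<open>P\<^sub>k\<close> is not linear in the \<open>h\<^sub>l\<close> alone, but it is in the
  products \<open>e\<^sub>r h\<^sub>l\<close>, and this family is closed: with
  \<open>D P\<^sub>k = k T\<^sub>k\<close>, the derivatives of \<open>h\<close> and \<open>e\<close>
  are convolutions with \<open>T\<close>, orthogonality sums \<open>T\<^sub>p T\<^sub>q\<close> over
  all planes to differences of \<open>P\<close> at \<open>|p - q|\<close> and \<open>p + q\<close>,
  and convolving \<open>P\<close> with \<open>h\<close> or \<open>e\<close> gives back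
  \<open>h\<close> or \<open>e\<close>. The unknown at \<open>l = 1\<close> has the coefficient
  \<open>r + 1 - n\<close>, which vanishes at \<open>r = n - 1\<close>; the reflection trades
  \<open>r = n - 1, n\<close> for \<open>r = 1, 0\<close>. The result is
  \<open>E P\<^sub>k = 1\<close> for \<open>k > 0\<close>, except 0 at odd \<open>k < n\<close>.
  These missing odd traces cancel the constant \<open>2 N\<close> in the mean of
  \<open>\<Sum> p\<close> to leading order, which is why \<open>E Y\<close> is as small as
  \<open>a\<^sup>2\<close>. \<open>Y\<close> is small on average but can reach the order of
  \<open>N\<close>, so the second-order remainder carries a weight up to \<open>N^(m-1)\<close>;
  with \<open>E Y\<^sup>2 = O(N a\<^sup>3)\<close> this makes \<open>N^m\<close>.\<close>

text \<open>Complete homogeneous symmetric functions from the power sums \<open>p 1, p 2, \<dots>\<close>; the value \<open>p 0\<close> plays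
  no role. Applied to \<open>- p\<close> the recursion gives the elementary ones with the sign \<open>(-1)\<^sup>r\<close>.\<close>

fun newton :: "(nat \<Rightarrow> 'a::field_char_0) \<Rightarrow> nat \<Rightarrow> 'a" where
  "newton p 0 = 1"
| "newton p (Suc l) = (\<Sum>k\<le>l. p (Suc k) * newton p (l - k)) / of_nat (Suc l)"

text \<open>Newton's identity with the term \<open>k = 0\<close> kept: it adds
  \<open>p 0 * newton p l\<close> to both sides and makes the sum a full Cauchy product, the form in
  which the power series arguments use it.\<close>

lemma newton_sum: "(\<Sum>k\<le>l. p k * newton p (l - k)) = (p 0 + of_nat l) * newton p l"
proof (cases l)
  case (Suc m)
  have "(\<Sum>k\<le>l. p k * newton p (l - k)) = p 0 * newton p l + (\<Sum>k\<le>m. p (Suc k) * newton p (m - k))"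
    unfolding Suc by (subst sum.atMost_Suc_shift) simp
  also have "(\<Sum>k\<le>m. p (Suc k) * newton p (m - k)) = of_nat l * newton p l"
    using Suc by (simp del: of_nat_Suc)
  finally show ?thesis by (simp add: algebra_simps)
qed simp

lemma newton_sum_uminus:
  "(\<Sum>k\<le>l. p k * newton (\<lambda>k. - p k) (l - k)) = (p 0 - of_nat l) * newton (\<lambda>k. - p k) l"
  using newton_sum[of "\<lambda>k. - p k" l] by (simp add: sum_negf algebra_simps)

text \<open>Division by \<open>l\<close> lets the recursion determine \<open>f\<close> from
  \<open>f 0\<close>. This identifies the coefficients of a product of linear factors with
  \<open>newton\<close> of the negated power sums of its roots.\<close>

lemma newton_unique:
  assumes "f 0 = 1" "\<And>l. (\<Sum>k\<le>l. p k * f (l - k)) = (p 0 + of_nat l) * f l"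
  shows "f l = newton p l"
proof (induction l rule: less_induct)
  case (less l)
  show ?case
  proof (cases l)
    case (Suc m)
    have "(\<Sum>k\<le>l. p k * f (l - k)) = p 0 * f l + (\<Sum>k\<le>m. p (Suc k) * f (m - k))"
      unfolding Suc by (subst sum.atMost_Suc_shift) simp
    also have "(\<Sum>k\<le>m. p (Suc k) * f (m - k)) = (\<Sum>k\<le>m. p (Suc k) * newton p (m - k))"
      using less Suc by (intro sum.cong) auto
    finally have "of_nat l * f l = (\<Sum>k\<le>m. p (Suc k) * newton p (m - k))"
      using assms(2)[of l] by (simp add: algebra_simps)
    then show ?thesis using Suc by (simp add: field_simps del: of_nat_Suc)
  qed (use assms in simp)
qed

text \<open>Equivalent to \<open>H = exp (\<Sum> p k z^k / k)\<close> with the sum over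
  \<open>k > 0\<close>: apart from \<open>p 0\<close>, the series of \<open>p\<close> is the
  logarithmic derivative \<open>z H' / H\<close>.\<close>

lemma newton_fps:
  fixes p :: "nat \<Rightarrow> 'a::field_char_0"
  defines "H \<equiv> Abs_fps (newton p)"
  shows "Abs_fps p * H = fps_const (p 0) * H + fps_X * fps_deriv H"
proof (rule fps_ext)
  fix l
  have "fps_nth (Abs_fps p * H) l = (\<Sum>k\<le>l. p k * newton p (l - k))"
    by (simp add: fps_mult_nth H_def atLeast0AtMost)
  then show "fps_nth (Abs_fps p * H) l = fps_nth (fps_const (p 0) * H + fps_X * fps_deriv H) l"
    by (cases l) (simp_all add: newton_sum H_def algebra_simps del: newton.simps(2))
qed

text \<open>With \<open>F\<close> the series of \<open>p\<close>, \<open>z H' = (F - p 0) H\<close>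
  and \<open>z G' = - (F - p 0) G\<close>. Hence the derivative of \<open>G H\<close> vanishes and
  the constant term decides.\<close>

lemma newton_koszul_fps:
  fixes p :: "nat \<Rightarrow> 'a::field_char_0"
  defines "H \<equiv> Abs_fps (newton p)" and "G \<equiv> Abs_fps (newton (\<lambda>k. - p k))"
  shows "G * H = 1"
proof -
  have a: "Abs_fps p * H = fps_const (p 0) * H + fps_X * fps_deriv H"
    unfolding H_def by (rule newton_fps)
  have m: "Abs_fps (\<lambda>k. - p k) = - Abs_fps p" by (rule fps_ext) simp
  have b: "- (Abs_fps p * G) = - (fps_const (p 0) * G) + fps_X * fps_deriv G"
    using newton_fps[of "\<lambda>k. - p k"] unfolding G_def m by (simp flip: fps_const_neg)
  have "fps_X * fps_deriv (G * H) = (fps_X * fps_deriv G) * H + G * (fps_X * fps_deriv H)"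
    by (simp add: algebra_simps)
  also have "\<dots> = (fps_const (p 0) * G - Abs_fps p * G) * H + G * (Abs_fps p * H - fps_const (p 0) * H)"
    using a b by (simp add: algebra_simps)
  also have "\<dots> = 0" by (simp add: algebra_simps)
  finally have "fps_deriv (G * H) = 0" by simp
  then have "G * H = fps_const (fps_nth (G * H) 0)" by (subst (asm) fps_deriv_eq_0_iff)
  also have "fps_nth (G * H) 0 = 1" by (simp add: G_def H_def)
  finally show ?thesis by simp
qed

lemma newton_koszul:
  "(\<Sum>j\<le>k. newton (\<lambda>k. - p k) j * newton p (k - j)) = (if k = 0 then 1 else 0)"
  using arg_cong[OF newton_koszul_fps[of p], of "\<lambda>f. fps_nth f k"]
  by (simp add: fps_mult_nth atLeast0AtMost)

text \<open>From \<open>z G' = (p 0 - F) G\<close> and \<open>G H = 1\<close> one gets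
  \<open>F = p 0 - z G' H\<close>. The gain is linearity in the products
  \<open>e\<^sub>r h\<^sub>l\<close>, whose means are accessible.\<close>

lemma power_sum_newton:
  assumes "k > 0"
  shows "p k = - (\<Sum>r\<le>k. of_nat r * newton (\<lambda>k. - p k) r * newton p (k - r))"
proof -
  define H where "H = Abs_fps (newton p)"
  define G where "G = Abs_fps (newton (\<lambda>k. - p k))"
  have m: "Abs_fps (\<lambda>k. - p k) = - Abs_fps p" by (rule fps_ext) simp
  have GH: "G * H = 1" unfolding G_def H_def by (rule newton_koszul_fps)
  have "- (Abs_fps p * G) = - (fps_const (p 0) * G) + fps_X * fps_deriv G"
    using newton_fps[of "\<lambda>k. - p k"] unfolding G_def m by (simp flip: fps_const_neg)
  then have "- (Abs_fps p * (G * H)) = - (fps_const (p 0) * (G * H)) + fps_X * fps_deriv G * H"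
    by (metis (no_types, lifting) distrib_right minus_mult_left mult.assoc)
  then have "- Abs_fps p = - fps_const (p 0) + fps_X * fps_deriv G * H" by (simp add: GH)
  from arg_cong[OF this, of "\<lambda>f. fps_nth f k"] assms have "- p k = fps_nth (fps_X * fps_deriv G * H) k"
    by simp
  also have "\<dots> = (\<Sum>r\<le>k. fps_nth (fps_X * fps_deriv G) r * fps_nth H (k - r))"
    by (simp add: fps_mult_nth atLeast0AtMost)
  also have "\<dots> = (\<Sum>r\<le>k. of_nat r * newton (\<lambda>k. - p k) r * newton p (k - r))"
  proof (intro sum.cong refl)
    fix r show "fps_nth (fps_X * fps_deriv G) r * fps_nth H (k - r) = of_nat r * newton (\<lambda>k. - p k) r * newton p (k - r)"
      by (cases r) (simp_all add: G_def H_def del: newton.simps(2))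
  qed
  finally show ?thesis by (metis minus_minus)
qed

section \<open>Convolutions of the traces with both families of symmetric functions\<close>

abbreviation natdist :: "nat \<Rightarrow> nat \<Rightarrow> nat" where
  "natdist p q \<equiv> (p - q) + (q - p)"

text \<open>This and \<open>conv_sum\<close> are what \<open>\<Sum> D e\<^sub>r D h\<^sub>l\<close>
  over all planes reduces to. The index \<open>|p - q|\<close>, written \<open>natdist\<close> (one
  of its truncated differences is always 0), arises because the transpose of \<open>X^p\<close> is
  its inverse.\<close>

definition conv_dist :: "(nat \<Rightarrow> real) \<Rightarrow> nat \<Rightarrow> nat \<Rightarrow> real" where
  "conv_dist P r l = (\<Sum>p\<le>r. \<Sum>q\<le>l. P (natdist p q) * newton (\<lambda>k. - P k) (r - p) * newton P (l - q))"

definition conv_sum :: "(nat \<Rightarrow> real) \<Rightarrow> nat \<Rightarrow> nat \<Rightarrow> real" where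
  "conv_sum P r l = (\<Sum>p\<le>r. \<Sum>q\<le>l. P (p + q) * newton (\<lambda>k. - P k) (r - p) * newton P (l - q))"

lemma conv_dist_0_left: "conv_dist P 0 l = (P 0 + l) * newton P l"
  using newton_sum[of P l] by (simp add: conv_dist_def)

lemma conv_dist_0_right: "conv_dist P r 0 = (P 0 - r) * newton (\<lambda>k. - P k) r"
  using newton_sum_uminus[of P r] by (simp add: conv_dist_def)

text \<open>Shifting both indices by one fixes \<open>|p - q|\<close>, so the block
  \<open>p, q \<ge> 1\<close> is \<open>conv_dist P r l\<close>. The row \<open>p = 0\<close> and
  the rest of the column \<open>q = 0\<close> are Newton sums with the factors
  \<open>P 0 + l + 1\<close> and \<open>- (r + 1)\<close>.\<close>

lemma conv_dist_Suc_Suc: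
  "conv_dist P (Suc r) (Suc l) =
     conv_dist P r l + (P 0 + l - r) * newton (\<lambda>k. - P k) (Suc r) * newton P (Suc l)"
proof -
  define e h where "e = newton (\<lambda>k. - P k)" and "h = newton P"
  note he = e_def[symmetric] h_def[symmetric]
  have h: "(\<Sum>q\<le>l. P (Suc q) * h (l - q)) = (Suc l) * h (Suc l)"
    using newton_sum[of P "Suc l"] unfolding he
    by (subst (asm) sum.atMost_Suc_shift) (simp add: algebra_simps)
  have e: "(\<Sum>q\<le>r. P (Suc q) * e (r - q)) = - (Suc r) * e (Suc r)"
    using newton_sum_uminus[of P "Suc r"] unfolding he
    by (subst (asm) sum.atMost_Suc_shift) (simp add: algebra_simps)
  have "conv_dist P (Suc r) (Suc l) =
     (\<Sum>q\<le>Suc l. P q * e (Suc r) * h (Suc l - q)) +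
     (\<Sum>p\<le>r. \<Sum>q\<le>Suc l. P (natdist (Suc p) q) * e (r - p) * h (Suc l - q))"
    unfolding conv_dist_def he by (subst sum.atMost_Suc_shift) simp
  also have "(\<Sum>q\<le>Suc l. P q * e (Suc r) * h (Suc l - q)) = e (Suc r) * (\<Sum>q\<le>Suc l. P q * h (Suc l - q))"
    by (simp add: sum_distrib_left algebra_simps)
  also have "\<dots> = e (Suc r) * ((P 0 + Suc l) * h (Suc l))"
    using newton_sum[of P "Suc l"] unfolding he by simp
  also have "(\<Sum>p\<le>r. \<Sum>q\<le>Suc l. P (natdist (Suc p) q) * e (r - p) * h (Suc l - q)) =
      (\<Sum>p\<le>r. P (Suc p) * e (r - p) * h (Suc l) + (\<Sum>q\<le>l. P (natdist p q) * e (r - p) * h (l - q)))"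
    by (subst sum.atMost_Suc_shift) simp
  also have "\<dots> = (\<Sum>p\<le>r. P (Suc p) * e (r - p)) * h (Suc l) + conv_dist P r l"
    by (simp add: conv_dist_def he sum.distrib sum_distrib_right)
  also have "(\<Sum>p\<le>r. P (Suc p) * e (r - p)) = - (Suc r) * e (Suc r)" by (rule e)
  finally show ?thesis by (simp add: he algebra_simps)
qed

lemma conv_sum_0_left: "conv_sum P 0 l = (P 0 + l) * newton P l"
  using newton_sum[of P l] by (simp add: conv_sum_def)

text \<open>Moving one unit from \<open>p\<close> to \<open>q\<close> fixes \<open>p + q\<close>, so
  the rows \<open>p \<ge> 1\<close> form \<open>conv_sum P r (Suc l)\<close> without its column
  \<open>q = 0\<close>. That column and the row \<open>p = 0\<close> are Newton sums.\<close>

lemma conv_sum_Suc_left: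
  "conv_sum P (Suc r) l = conv_sum P r (Suc l) + (P 0 + l) * newton (\<lambda>k. - P k) (Suc r) * newton P l
     - (P 0 - r) * newton (\<lambda>k. - P k) r * newton P (Suc l)"
proof -
  define e h where "e = newton (\<lambda>k. - P k)" and "h = newton P"
  note he = e_def[symmetric] h_def[symmetric]
  have "conv_sum P (Suc r) l =
     (\<Sum>q\<le>l. P q * e (Suc r) * h (l - q)) +
     (\<Sum>p\<le>r. \<Sum>q\<le>l. P (Suc p + q) * e (r - p) * h (l - q))"
    unfolding conv_sum_def he by (subst sum.atMost_Suc_shift) simp
  also have "(\<Sum>q\<le>l. P q * e (Suc r) * h (l - q)) = e (Suc r) * (\<Sum>q\<le>l. P q * h (l - q))"
    by (simp add: sum_distrib_left algebra_simps)
  also have "\<dots> = e (Suc r) * ((P 0 + l) * h l)"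
    using newton_sum[of P l] unfolding he by simp
  also have "(\<Sum>p\<le>r. \<Sum>q\<le>l. P (Suc p + q) * e (r - p) * h (l - q)) =
     conv_sum P r (Suc l) - (\<Sum>p\<le>r. P p * e (r - p)) * h (Suc l)"
    unfolding conv_sum_def he
    by (subst sum.atMost_Suc_shift) (simp add: sum.distrib sum_distrib_right)
  also have "(\<Sum>p\<le>r. P p * e (r - p)) = (P 0 - r) * e r"
    unfolding he using newton_sum_uminus[of P r] by (simp add: e_def)
  finally show ?thesis by (simp add: he algebra_simps)
qed

definition dist_fps :: "(nat \<Rightarrow> real) \<Rightarrow> real fps" where
  "dist_fps P = Abs_fps (\<lambda>k. \<Sum>c\<le>k. P (natdist c (k - c)))"

text \<open>The sum of \<open>P (natdist p q) * newton P (l - p - q)\<close> over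
  \<open>p + q \<le> l\<close>. It stems from the second derivatives of \<open>h\<^sub>l\<close>,
  which leave a single symmetric function, whereas \<open>conv_dist\<close> has one of each
  kind.\<close>

definition conv_gap :: "(nat \<Rightarrow> real) \<Rightarrow> nat \<Rightarrow> real" where
  "conv_gap P l = fps_nth (dist_fps P * Abs_fps (newton P)) l"

text \<open>Dropping the end terms \<open>c = 0\<close> and \<open>c = k\<close>, both equal to
  \<open>P k\<close>, and shifting \<open>c\<close> leaves the coefficient at \<open>k - 2\<close>.
  At \<open>k = 0\<close> the two ends coincide, hence the correction by \<open>P 0\<close>.\<close>

lemma dist_fps_eq: "dist_fps P = fps_X\<^sup>2 * dist_fps P + (fps_const 2 * Abs_fps P - fps_const (P 0))"
proof (rule fps_ext)
  fix k
  consider "k = 0" | "k = 1" | j where "k = Suc (Suc j)"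
    by (metis One_nat_def not0_implies_Suc)
  then show "fps_nth (dist_fps P) k = fps_nth (fps_X\<^sup>2 * dist_fps P + (fps_const 2 * Abs_fps P - fps_const (P 0))) k"
  proof cases
    case 3
    have "(\<Sum>c\<le>Suc (Suc j). P (natdist c (Suc (Suc j) - c))) =
      P (Suc (Suc j)) + ((\<Sum>c\<le>j. P (natdist (Suc c) (Suc j - c))) + P (Suc (Suc j)))"
      by (subst sum.atMost_Suc_shift) simp
    also have "(\<Sum>c\<le>j. P (natdist (Suc c) (Suc j - c))) = (\<Sum>c\<le>j. P (natdist c (j - c)))"
      by (intro sum.cong refl) (simp add: Suc_diff_le)
    finally show ?thesis unfolding 3
      by (simp add: dist_fps_def fps_X_power_mult_nth)
  qed (simp_all add: dist_fps_def fps_X_power_mult_nth)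
qed

text \<open>This is \<open>dist_fps_eq\<close> times \<open>H\<close>, with \<open>F H\<close>
  replaced by Newton's identity. The step of length 2 is the origin of the parity distinctions in
  the moments.\<close>

lemma conv_gap_rec:
  "conv_gap P 0 = P 0"
  "conv_gap P (Suc 0) = (P 0 + 2) * newton P (Suc 0)"
  "conv_gap P (Suc (Suc l)) = conv_gap P l + (P 0 + 2 * Suc (Suc l)) * newton P (Suc (Suc l))"
proof -
  define H where "H = Abs_fps (newton P)"
  have a: "Abs_fps P * H = fps_const (P 0) * H + fps_X * fps_deriv H"
    unfolding H_def by (rule newton_fps)
  have c2: "fps_const (2::real) = 2" by (simp add: numeral_fps_const)
  have "dist_fps P * H = fps_X\<^sup>2 * (dist_fps P * H) + (2 * (Abs_fps P * H) - fps_const (P 0) * H)"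
    by (subst dist_fps_eq) (simp add: algebra_simps c2)
  also have "2 * (Abs_fps P * H) - fps_const (P 0) * H = fps_const (P 0) * H + fps_const 2 * (fps_X * fps_deriv H)"
    unfolding a c2 by (simp add: algebra_simps)
  finally have "dist_fps P * H = fps_X\<^sup>2 * (dist_fps P * H) + (fps_const (P 0) * H + fps_const 2 * (fps_X * fps_deriv H))" .
  note D = this
  have *: "conv_gap P m = (if m < 2 then 0 else conv_gap P (m - 2)) + (P 0 + 2 * m) * newton P m" for m
  proof -
    have "conv_gap P m = fps_nth (fps_X\<^sup>2 * (dist_fps P * H) + (fps_const (P 0) * H + fps_const 2 * (fps_X * fps_deriv H))) m"
      unfolding conv_gap_def H_def[symmetric] by (rule arg_cong[OF D])
    also have "\<dots> = (if m < 2 then 0 else conv_gap P (m - 2)) + (P 0 * newton P m + 2 * fps_nth (fps_X * fps_deriv H) m)"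
      by (simp add: fps_X_power_mult_nth conv_gap_def H_def)
    also have "fps_nth (fps_X * fps_deriv H) m = m * newton P m"
      by (cases m) (simp_all add: H_def del: newton.simps(2))
    finally show ?thesis by (simp add: algebra_simps)
  qed
  show "conv_gap P 0 = P 0" "conv_gap P (Suc 0) = (P 0 + 2) * newton P (Suc 0)"
     "conv_gap P (Suc (Suc l)) = conv_gap P l + (P 0 + 2 * Suc (Suc l)) * newton P (Suc (Suc l))"
    using *[of 0] *[of 1] *[of "Suc (Suc l)"] by (simp_all del: newton.simps(2))
qed

text \<open>Up to a factor 2 the left side is the Laplacian of \<open>h\<^sub>l\<close>:
  \<open>PP\<close> comes from second derivatives of the traces, the double sum from products of
  first ones. The terms quadratic in \<open>P\<close> disappear because \<open>F z H'\<close> enters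
  \<open>F F H\<close> and \<open>z F' H\<close> with opposite signs.\<close>

lemma newton_laplace:
  fixes P :: "nat \<Rightarrow> real"
  defines "PP \<equiv> \<lambda>k. \<Sum>c<k. P (natdist c (k - c)) - P c * P (k - c)"
  shows "(\<Sum>k\<le>l. PP k * newton P (l - k)) +
    (\<Sum>k\<le>l. \<Sum>q\<le>l - k. (P (natdist k q) - P (k + q)) * newton P (l - k - q)) =
    2 * conv_gap P l - (2 * P 0 + (P 0 + 2) * l + l\<^sup>2) * newton P l"
proof -
  define H where "H = Abs_fps (newton P)"
  define F where "F = Abs_fps P"
  have a: "F * H = fps_const (P 0) * H + fps_X * fps_deriv H"
    unfolding H_def F_def by (rule newton_fps)
  have FF: "fps_nth (F * F) k = (\<Sum>c\<le>k. P c * P (k - c))" for k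
    by (simp add: F_def fps_mult_nth atLeast0AtMost)
  \<comment> \<open>\<open>PP\<close> stops at \<open>c = k - 1\<close>, the Cauchy product at
    \<open>c = k\<close>. The missing term \<open>P k - P k * P 0\<close> accounts for
    \<open>- F\<close> and \<open>fps_const (P 0) * F\<close>.\<close>
  have PP: "Abs_fps PP = dist_fps P - F - F * F + fps_const (P 0) * F"
  proof (rule fps_ext)
    fix k
    have "PP k = (\<Sum>c\<le>k. P (natdist c (k - c)) - P c * P (k - c)) - (P k - P k * P 0)"
      unfolding PP_def by (simp add: lessThan_Suc_atMost[symmetric])
    then show "fps_nth (Abs_fps PP) k = fps_nth (dist_fps P - F - F * F + fps_const (P 0) * F) k"
      using FF[of k] by (simp add: sum_subtractf dist_fps_def F_def)
  qed
  have FD: "Abs_fps (\<lambda>k. \<Sum>c\<le>k. P (c + (k - c))) = fps_X * fps_deriv F + F"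
  proof (rule fps_ext)
    fix k show "fps_nth (Abs_fps (\<lambda>k. \<Sum>c\<le>k. P (c + (k - c)))) k = fps_nth (fps_X * fps_deriv F + F) k"
      by (cases k) (simp_all add: F_def algebra_simps)
  qed
  have tri: "(\<Sum>k\<le>l. \<Sum>q\<le>l - k. f k q * newton P (l - k - q)) =
      fps_nth (Abs_fps (\<lambda>m. \<Sum>c\<le>m. f c (m - c)) * H) l" for f :: "nat \<Rightarrow> nat \<Rightarrow> real"
  proof -
    have "fps_nth (Abs_fps (\<lambda>m. \<Sum>c\<le>m. f c (m - c)) * H) l = (\<Sum>m\<le>l. \<Sum>c\<le>m. f c (m - c) * newton P (l - m))"
      by (simp add: fps_mult_nth atLeast0AtMost H_def sum_distrib_right)
    also have "\<dots> = (\<Sum>(k, q) \<in> {(i, j). i + j \<le> l}. f k q * newton P (l - (k + q)))"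
      by (subst sum.triangle_reindex_eq) (auto intro!: sum.cong)
    also have "{(i, j). i + j \<le> l} = Sigma {..l} (\<lambda>k. {..l - k})" by auto
    also have "(\<Sum>(k, q) \<in> Sigma {..l} (\<lambda>k. {..l - k}). f k q * newton P (l - (k + q))) =
       (\<Sum>k\<le>l. \<Sum>q\<le>l - k. f k q * newton P (l - k - q))"
      by (subst sum.Sigma[symmetric]) auto
    finally show ?thesis ..
  qed
  have "(\<Sum>k\<le>l. PP k * newton P (l - k)) = fps_nth (Abs_fps PP * H) l"
    by (simp add: fps_mult_nth atLeast0AtMost H_def)
  moreover have "(\<Sum>k\<le>l. \<Sum>q\<le>l - k. (P (natdist k q) - P (k + q)) * newton P (l - k - q)) =
     fps_nth (dist_fps P * H) l - fps_nth ((fps_X * fps_deriv F + F) * H) l"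
    unfolding left_diff_distrib sum_subtractf tri
    by (simp add: dist_fps_def FD[simplified])
  ultimately have "(\<Sum>k\<le>l. PP k * newton P (l - k)) +
    (\<Sum>k\<le>l. \<Sum>q\<le>l - k. (P (natdist k q) - P (k + q)) * newton P (l - k - q)) =
    fps_nth (Abs_fps PP * H + dist_fps P * H - (fps_X * fps_deriv F + F) * H) l"
    by simp
  also have "Abs_fps PP * H + dist_fps P * H - (fps_X * fps_deriv F + F) * H =
     fps_const 2 * (dist_fps P * H) - (fps_const (2 * P 0) * H + fps_const (P 0 + 2) * (fps_X * fps_deriv H) +
        fps_X * fps_deriv (fps_X * fps_deriv H))"
  proof -
    have b: "fps_X * fps_deriv F * H = fps_const (P 0) * (fps_X * fps_deriv H) + fps_X * fps_deriv (fps_X * fps_deriv H)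
       - F * (fps_X * fps_deriv H)"
    proof -
      have "fps_X * fps_deriv (F * H) = fps_X * fps_deriv F * H + F * (fps_X * fps_deriv H)"
        by (simp add: algebra_simps)
      then show ?thesis unfolding a by (simp add: algebra_simps)
    qed
    have c: "F * F * H = fps_const (P 0) * (F * H) + F * (fps_X * fps_deriv H)"
    proof -
      have "F * F * H = F * (F * H)" by (simp add: algebra_simps)
      also have "\<dots> = F * (fps_const (P 0) * H + fps_X * fps_deriv H)" by (simp only: a)
      finally show ?thesis by (simp add: algebra_simps)
    qed
    have "Abs_fps PP * H + dist_fps P * H - (fps_X * fps_deriv F + F) * H =
      2 * (dist_fps P * H) - 2 * (F * H) - F * F * H + fps_const (P 0) * (F * H) - fps_X * fps_deriv F * H"
      unfolding PP by (simp add: algebra_simps)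
    also have "\<dots> = 2 * (dist_fps P * H) - 2 * (F * H) - (fps_const (P 0) * (fps_X * fps_deriv H) + fps_X * fps_deriv (fps_X * fps_deriv H))"
      unfolding b c by (simp add: algebra_simps)
    also have "\<dots> = fps_const 2 * (dist_fps P * H) - (fps_const (2 * P 0) * H + fps_const (P 0 + 2) * (fps_X * fps_deriv H) +
        fps_X * fps_deriv (fps_X * fps_deriv H))"
      unfolding a by (simp add: algebra_simps numeral_fps_const flip: fps_const_add fps_const_mult)
    finally show ?thesis .
  qed
  also have "fps_nth (\<dots>) l = 2 * conv_gap P l - (2 * P 0 + (P 0 + 2) * l + l\<^sup>2) * newton P l"
  proof -
    have d: "fps_nth (fps_X * fps_deriv f) l = l * fps_nth f l" for f :: "real fps"
      by (cases l) simp_all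
    show ?thesis
      by (simp only: fps_sub_nth fps_add_nth fps_mult_left_const_nth d)
        (simp add: conv_gap_def H_def power2_eq_square algebra_simps)
  qed
  finally show ?thesis .
qed

section \<open>Differentiation along plane rotations\<close>

text \<open>If \<open>D P\<^sub>k = k T\<^sub>k\<close>, then \<open>log H\<close>, the sum of
  \<open>P\<^sub>k z^k / k\<close>, has the derivative \<open>\<Sum> T\<^sub>k z^k\<close>, so
  \<open>D H\<close> is this series times \<open>H\<close>. Here is the induction step for that: the
  left side is the product rule applied to Newton's recursion.\<close>

lemma newton_deriv_identity:
  fixes P T :: "nat \<Rightarrow> 'a::field_char_0"
  assumes "T 0 = 0"
  shows "(\<Sum>k\<le>l. of_nat (Suc k) * T (Suc k) * newton P (l - k) +
            P (Suc k) * (\<Sum>q\<le>l - k. T q * newton P (l - k - q))) =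
         of_nat (Suc l) * (\<Sum>q\<le>Suc l. T q * newton P (Suc l - q))"
proof -
  define H where "H = Abs_fps (newton P)"
  define F where "F = Abs_fps P"
  define G where "G = Abs_fps T"
  have a: "F * H = fps_const (P 0) * H + fps_X * fps_deriv H"
    unfolding H_def F_def by (rule newton_fps)
  have GH: "fps_nth (G * H) m = (\<Sum>q\<le>m. T q * newton P (m - q))" for m
    by (simp add: G_def H_def fps_mult_nth atLeast0AtMost)
  have s: "fps_nth f (Suc l) = (\<Sum>k\<le>l. u (Suc k) * v (l - k))"
    if "f = U * V" "u = fps_nth U" "v = fps_nth V" "u 0 = 0" for f U V :: "'a fps" and u v
    unfolding that(1) fps_mult_nth atLeast0AtMost
    by (subst sum.atMost_Suc_shift) (use that in simp)
  have "(\<Sum>k\<le>l. of_nat (Suc k) * T (Suc k) * newton P (l - k)) = fps_nth (fps_X * fps_deriv G * H) (Suc l)"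
    by (subst s[OF refl refl refl]) (simp_all add: G_def H_def)
  moreover have "(\<Sum>k\<le>l. P (Suc k) * (\<Sum>q\<le>l - k. T q * newton P (l - k - q))) =
      fps_nth ((F - fps_const (P 0)) * (G * H)) (Suc l)"
    by (subst s[OF refl refl refl]) (simp_all add: F_def GH del: fps_mult_left_const_nth)
  moreover have "(F - fps_const (P 0)) * (G * H) = G * (F * H - fps_const (P 0) * H)"
    by (simp add: algebra_simps)
  then have "(F - fps_const (P 0)) * (G * H) = G * (fps_X * fps_deriv H)"
    unfolding a by simp
  ultimately have "(\<Sum>k\<le>l. of_nat (Suc k) * T (Suc k) * newton P (l - k) +
            P (Suc k) * (\<Sum>q\<le>l - k. T q * newton P (l - k - q))) =
      fps_nth (fps_X * fps_deriv G * H + G * (fps_X * fps_deriv H)) (Suc l)"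
    by (simp add: sum.distrib)
  also have "fps_X * fps_deriv G * H + G * (fps_X * fps_deriv H) = fps_X * fps_deriv (G * H)"
    by (simp add: algebra_simps)
  also have "fps_nth (fps_X * fps_deriv (G * H)) (Suc l) = of_nat (Suc l) * (\<Sum>q\<le>Suc l. T q * newton P (Suc l - q))"
    by (simp add: GH del: sum.atMost_Suc of_nat_Suc fps_deriv_mult)
  finally show ?thesis .
qed

section \<open>Powers and traces of special orthogonal matrices\<close>

lemma mat_mult_entry:
  assumes "A \<in> carrier_mat n n" "B \<in> carrier_mat n n" "i < n" "j < n"
  shows "(A * B) $$ (i, j) = (\<Sum>k<n. A $$ (i, k) * B $$ (k, j))"
  using assms by (auto simp: scalar_prod_def lessThan_atLeast0 intro!: sum.cong)

lemma pow_mat_Suc_entry: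
  assumes "A \<in> carrier_mat n n" "i < n" "j < n"
  shows "(A ^\<^sub>m Suc k) $$ (i, j) = (\<Sum>r<n. (A ^\<^sub>m k) $$ (i, r) * A $$ (r, j))"
  using assms by (simp add: mat_mult_entry[of _ n] del: index_mult_mat)

lemma pow_mat_add:
  assumes "A \<in> carrier_mat n n"
  shows "A ^\<^sub>m (a + b) = A ^\<^sub>m a * A ^\<^sub>m b"
proof (induction b)
  case (Suc b)
  then show ?case
    using assms by (simp add: assoc_mult_mat[of _ n n _ n _ n])
qed (use assms in auto)

lemma pow_mat_add_entry:
  assumes "A \<in> carrier_mat n n" "i < n" "j < n"
  shows "(A ^\<^sub>m (a + b)) $$ (i, j) = (\<Sum>r<n. (A ^\<^sub>m a) $$ (i, r) * (A ^\<^sub>m b) $$ (r, j))"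
  unfolding pow_mat_add[OF assms(1)] using assms by (simp add: mat_mult_entry[of _ n] del: index_mult_mat)

lemma SO_matsD:
  assumes "X \<in> SO_mats n"
  shows "X \<in> carrier_mat n n" "X * transpose_mat X = 1\<^sub>m n" "transpose_mat X * X = 1\<^sub>m n"
    "Determinant.det X = 1"
  using assms by (auto simp: SO_mats_def)

lemma one_SO_mats: "1\<^sub>m n \<in> SO_mats n"
  by (simp add: SO_mats_def)

lemma SO_mats_pow: "X \<in> SO_mats n \<Longrightarrow> X ^\<^sub>m k \<in> SO_mats n"
proof (induction k)
  case 0
  then have "dim_row X = n" by (auto simp: SO_mats_def)
  then show ?case by (simp add: one_SO_mats)
qed (simp add: SO_mats_mult)

lemma SO_mats_entry_bound:
  assumes X: "X \<in> SO_mats n" and ij: "i < n" "j < n"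
  shows "\<bar>X $$ (i, j)\<bar> \<le> 1"
proof -
  note [simp] = carrier_matD[OF SO_matsD(1)[OF X]]
  have "(\<Sum>k<n. X $$ (i, k) * X $$ (i, k)) = (X * transpose_mat X) $$ (i, i)"
    using ij by (auto simp: scalar_prod_def lessThan_atLeast0 intro!: sum.cong)
  also have "\<dots> = 1" using SO_matsD[OF X] ij by simp
  finally have "(\<Sum>k<n. (X $$ (i, k))\<^sup>2) = 1" by (simp add: power2_eq_square)
  moreover have "(X $$ (i, j))\<^sup>2 \<le> (\<Sum>k<n. (X $$ (i, k))\<^sup>2)"
    by (rule member_le_sum) (use ij in auto)
  ultimately show ?thesis by (simp add: abs_square_le_1)
qed

definition pow_trace :: "nat \<Rightarrow> real mat \<Rightarrow> nat \<Rightarrow> real" where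
  "pow_trace n X k = (\<Sum>i<n. (X ^\<^sub>m k) $$ (i, i))"

lemma pow_trace_0: "X \<in> SO_mats n \<Longrightarrow> pow_trace n X 0 = n"
  using SO_matsD(1)[of X n] by (simp add: pow_trace_def)

lemma sum_pow_entries_swap:
  assumes X: "X \<in> SO_mats n"
  shows "(\<Sum>i<n. \<Sum>j<n. (X ^\<^sub>m p) $$ (i, j) * (X ^\<^sub>m q) $$ (j, i)) = pow_trace n X (p + q)"
  unfolding pow_trace_def
  by (intro sum.cong refl) (simp add: pow_mat_add_entry[OF SO_matsD(1)[OF X]])

text \<open>The sum is the trace of the transpose of \<open>X^p\<close> times \<open>X^q\<close>.
  For \<open>p \<le> q\<close> orthogonality reduces this product to \<open>X^(q-p)\<close>, and
  symmetry covers the other case.\<close>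

lemma sum_pow_entries:
  assumes X: "X \<in> SO_mats n"
  shows "(\<Sum>i<n. \<Sum>j<n. (X ^\<^sub>m p) $$ (i, j) * (X ^\<^sub>m q) $$ (i, j)) = pow_trace n X (natdist p q)"
proof -
  have *: "(\<Sum>i<n. \<Sum>j<n. (X ^\<^sub>m p) $$ (i, j) * (X ^\<^sub>m (p + d)) $$ (i, j)) = pow_trace n X d" for p d
  proof -
    note C = SO_matsD(1)[OF X]
    define Y where "Y = X ^\<^sub>m p"
    have Y: "Y \<in> SO_mats n" unfolding Y_def by (rule SO_mats_pow[OF X])
    note CY = SO_matsD(1)[OF Y]
    have "transpose_mat Y * X ^\<^sub>m (p + d) = transpose_mat Y * (Y * X ^\<^sub>m d)"
      unfolding pow_mat_add[OF C] Y_def ..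
    also have "\<dots> = transpose_mat Y * Y * X ^\<^sub>m d"
      using C CY by (simp add: assoc_mult_mat[of _ n n _ n _ n])
    also have "\<dots> = X ^\<^sub>m d" using SO_matsD(3)[OF Y] C by simp
    finally have e: "transpose_mat Y * X ^\<^sub>m (p + d) = X ^\<^sub>m d" .
    have "(\<Sum>i<n. \<Sum>j<n. Y $$ (i, j) * (X ^\<^sub>m (p + d)) $$ (i, j)) =
      (\<Sum>j<n. \<Sum>i<n. transpose_mat Y $$ (j, i) * (X ^\<^sub>m (p + d)) $$ (i, j))"
      by (subst sum.swap) (use CY in \<open>auto intro!: sum.cong\<close>)
    also have "\<dots> = (\<Sum>j<n. (transpose_mat Y * X ^\<^sub>m (p + d)) $$ (j, j))"
      by (intro sum.cong refl mat_mult_entry[symmetric]) (use C CY in auto)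
    finally show ?thesis unfolding e by (simp add: Y_def pow_trace_def)
  qed
  show ?thesis
  proof (cases "p \<le> q")
    case True
    then show ?thesis using *[of p "q - p"] by simp
  next
    case False
    then show ?thesis using *[of q "p - q"] by (simp add: mult.commute)
  qed
qed

section \<open>Rotations and a derivative calculus with quadratic remainders\<close>

definition givens :: "nat \<Rightarrow> nat \<Rightarrow> nat \<Rightarrow> real \<Rightarrow> real mat" where
  "givens n i j u = mat n n (\<lambda>(p, q).
     if p = i then (if q = i then cos u else if q = j then - sin u else 0)
     else if p = j then (if q = i then sin u else if q = j then cos u else 0)
     else if p = q then 1 else 0)"

lemma givens_carrier [simp]: "givens n i j u \<in> carrier_mat n n"
  by (simp add: givens_def)

lemma givens_mult_entry:
  assumes "A \<in> carrier_mat n n" "i < n" "j < n" "i \<noteq> j" "p < n" "q < n"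
  shows "(givens n i j u * A) $$ (p, q) =
    (if p = i then cos u * A $$ (i, q) - sin u * A $$ (j, q)
     else if p = j then sin u * A $$ (i, q) + cos u * A $$ (j, q) else A $$ (p, q))"
proof -
  have "(givens n i j u * A) $$ (p, q) = (\<Sum>k<n. givens n i j u $$ (p, k) * A $$ (k, q))"
    using assms by (intro mat_mult_entry) auto
  \<comment> \<open>One Kronecker delta for each column that can be nonzero, so that the sum
    evaluates by the delta rule.\<close>
  also have "\<dots> = (\<Sum>k<n.
     (if k = i then (if p = i then cos u else if p = j then sin u else 0) * A $$ (k, q) else 0) +
     (if k = j then (if p = i then - sin u else if p = j then cos u else 0) * A $$ (k, q) else 0) +
     (if k = p then (if p = i \<or> p = j then 0 else A $$ (k, q)) else 0))"
    by (intro sum.cong refl) (use assms in \<open>auto simp: givens_def\<close>)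
  also have "\<dots> = (if p = i then cos u * A $$ (i, q) - sin u * A $$ (j, q)
     else if p = j then sin u * A $$ (i, q) + cos u * A $$ (j, q) else A $$ (p, q))"
    using assms by (simp add: sum.distrib)
  finally show ?thesis .
qed

lemma givens_add:
  assumes "i < n" "j < n" "i \<noteq> j"
  shows "givens n i j u * givens n i j v = givens n i j (u + v)"
proof (rule eq_matI)
  fix p q assume "p < dim_row (givens n i j (u + v))" "q < dim_col (givens n i j (u + v))"
  then have pq: "p < n" "q < n" by (auto simp: givens_def)
  have "(givens n i j u * givens n i j v) $$ (p, q) = 
    (if p = i then cos u * givens n i j v $$ (i, q) - sin u * givens n i j v $$ (j, q)
     else if p = j then sin u * givens n i j v $$ (i, q) + cos u * givens n i j v $$ (j, q) else givens n i j v $$ (p, q))"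
    by (rule givens_mult_entry) (use assms pq in auto)
  also have "\<dots> = givens n i j (u + v) $$ (p, q)"
    using assms pq by (simp add: givens_def cos_add sin_add)
  finally show "(givens n i j u * givens n i j v) $$ (p, q) = givens n i j (u + v) $$ (p, q)" .
qed (auto simp: givens_def)

lemma givens_SO:
  assumes "i < n" "j < n" "i \<noteq> j"
  shows "givens n i j u \<in> SO_mats n"
proof -
  have t: "transpose_mat (givens n i j u) = givens n i j (- u)" for u
    by (rule eq_matI) (use assms in \<open>auto simp: givens_def\<close>)
  have 0: "givens n i j 0 = 1\<^sub>m n"
    by (rule eq_matI) (use assms in \<open>auto simp: givens_def\<close>)
  have orth: "givens n i j u * transpose_mat (givens n i j u) = 1\<^sub>m n"
    "transpose_mat (givens n i j u) * givens n i j u = 1\<^sub>m n" for u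
    using givens_add[OF assms, of u "- u"] givens_add[OF assms, of "- u" u] by (simp_all add: t 0)
  \<comment> \<open>The determinant is \<open>1\<close> and not \<open>- 1\<close> because the rotation is the square of another one.\<close>
  have "Determinant.det (givens n i j (u / 2)) * Determinant.det (transpose_mat (givens n i j (u / 2))) = 1"
    by (subst det_mult[of _ n, symmetric]) (auto simp: orth)
  then have "(Determinant.det (givens n i j (u / 2)))\<^sup>2 = 1"
    by (simp add: det_transpose[of _ n] power2_eq_square)
  moreover have "Determinant.det (givens n i j u) = (Determinant.det (givens n i j (u / 2)))\<^sup>2"
    using givens_add[OF assms, of "u / 2" "u / 2"] det_mult[of "givens n i j (u / 2)" n "givens n i j (u / 2)"]
    by (simp add: power2_eq_square)
  ultimately show ?thesis using orth by (simp add: SO_mats_def)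
qed

text \<open>Takes the place of continuity on the compact group: it is closed under sums and products
  and gives integrability against every Haar probability measure.\<close>

definition bounded_meas :: "nat \<Rightarrow> (real mat \<Rightarrow> real) \<Rightarrow> bool" where
  "bounded_meas n F \<longleftrightarrow> F \<in> borel_measurable (SO_borel n) \<and> (\<exists>C\<ge>0. \<forall>X\<in>SO_mats n. \<bar>F X\<bar> \<le> C)"

lemma bounded_meas_cong:
  "bounded_meas n F \<Longrightarrow> (\<And>X. X \<in> SO_mats n \<Longrightarrow> G X = F X) \<Longrightarrow> bounded_meas n G"
  unfolding bounded_meas_def using measurable_cong[of "SO_borel n" G F borel] by auto

lemma bounded_meas_const [intro]: "bounded_meas n (\<lambda>X. c)"
  by (auto simp: bounded_meas_def intro!: exI[of _ "\<bar>c\<bar>"])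

lemma bounded_meas_add [intro]:
  assumes "bounded_meas n F" "bounded_meas n G" shows "bounded_meas n (\<lambda>X. F X + G X)"
proof -
  obtain A B where "\<forall>X\<in>SO_mats n. \<bar>F X\<bar> \<le> A" "\<forall>X\<in>SO_mats n. \<bar>G X\<bar> \<le> B" "A \<ge> 0" "B \<ge> 0"
    using assms by (auto simp: bounded_meas_def)
  then show ?thesis using assms unfolding bounded_meas_def
    by (auto intro!: exI[of _ "A + B"] borel_measurable_add order_trans[OF abs_triangle_ineq] add_mono)
qed

lemma bounded_meas_mult [intro]:
  assumes "bounded_meas n F" "bounded_meas n G" shows "bounded_meas n (\<lambda>X. F X * G X)"
proof -
  obtain A B where "\<forall>X\<in>SO_mats n. \<bar>F X\<bar> \<le> A" "\<forall>X\<in>SO_mats n. \<bar>G X\<bar> \<le> B" "A \<ge> 0" "B \<ge> 0"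
    using assms by (auto simp: bounded_meas_def)
  then show ?thesis using assms unfolding bounded_meas_def
    by (auto intro!: exI[of _ "A * B"] borel_measurable_times simp: abs_mult mult_mono)
qed

lemma bounded_meas_diff [intro]:
  assumes "bounded_meas n F" "bounded_meas n G" shows "bounded_meas n (\<lambda>X. F X - G X)"
  using bounded_meas_add[OF assms(1) bounded_meas_mult[OF bounded_meas_const[of n "-1"] assms(2)]] by simp

lemma bounded_meas_sum [intro]:
  "(\<And>i. i \<in> I \<Longrightarrow> bounded_meas n (F i)) \<Longrightarrow> bounded_meas n (\<lambda>X. \<Sum>i\<in>I. F i X)"
  by (induction I rule: infinite_finite_induct) auto

text \<open>The bound is uniform in \<open>X\<close>, so that no interchange of derivative and integral is needed to
  conclude \<open>E F' = 0\<close>.\<close>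

definition has_rot_deriv :: "nat \<Rightarrow> nat \<Rightarrow> nat \<Rightarrow> (real mat \<Rightarrow> real) \<Rightarrow> (real mat \<Rightarrow> real) \<Rightarrow> bool" where
  "has_rot_deriv n i j F F' \<longleftrightarrow> bounded_meas n F \<and> bounded_meas n F' \<and>
     (\<exists>C\<ge>0. \<forall>X\<in>SO_mats n. \<forall>u. \<bar>u\<bar> \<le> 1 \<longrightarrow> \<bar>F (givens n i j u * X) - F X - u * F' X\<bar> \<le> C * u\<^sup>2)"

lemma has_rot_deriv_cong:
  assumes "has_rot_deriv n i j F F'" "i < n" "j < n" "i \<noteq> j"
    "\<And>X. X \<in> SO_mats n \<Longrightarrow> G X = F X" "\<And>X. X \<in> SO_mats n \<Longrightarrow> G' X = F' X"
  shows "has_rot_deriv n i j G G'"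
proof -
  have "G (givens n i j u * X) - G X - u * G' X = F (givens n i j u * X) - F X - u * F' X"
    if "X \<in> SO_mats n" for X u
    using assms(5,6) that SO_mats_mult[OF givens_SO[OF assms(2-4)] that] by simp
  then show ?thesis using assms bounded_meas_cong[of n F G] bounded_meas_cong[of n F' G']
    unfolding has_rot_deriv_def by simp
qed

lemma has_rot_deriv_const: "has_rot_deriv n i j (\<lambda>X. c) (\<lambda>X. 0)"
  unfolding has_rot_deriv_def by (auto intro: exI[of _ 0])

lemma has_rot_deriv_add:
  assumes "has_rot_deriv n i j F F'" "has_rot_deriv n i j G G'"
  shows "has_rot_deriv n i j (\<lambda>X. F X + G X) (\<lambda>X. F' X + G' X)"
proof -
  from assms obtain A B where A: "A \<ge> 0" "B \<ge> 0"
    "\<And>X u. X\<in>SO_mats n \<Longrightarrow> \<bar>u\<bar> \<le> 1 \<Longrightarrow> \<bar>F (givens n i j u * X) - F X - u * F' X\<bar> \<le> A * u\<^sup>2"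
    "\<And>X u. X\<in>SO_mats n \<Longrightarrow> \<bar>u\<bar> \<le> 1 \<Longrightarrow> \<bar>G (givens n i j u * X) - G X - u * G' X\<bar> \<le> B * u\<^sup>2"
    unfolding has_rot_deriv_def by metis
  have "\<bar>F (givens n i j u * X) + G (givens n i j u * X) - (F X + G X) - u * (F' X + G' X)\<bar> \<le> (A + B) * u\<^sup>2"
    if "X \<in> SO_mats n" "\<bar>u\<bar> \<le> 1" for X u
    using A(3,4)[OF that] by (simp add: algebra_simps abs_le_iff) 
  then show ?thesis using assms A(1,2) unfolding has_rot_deriv_def
    by (intro conjI bounded_meas_add exI[of _ "A + B"]) auto
qed

lemma has_rot_deriv_mult:
  assumes "has_rot_deriv n i j F F'" "has_rot_deriv n i j G G'" and ij: "i < n" "j < n" "i \<noteq> j"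
  shows "has_rot_deriv n i j (\<lambda>X. F X * G X) (\<lambda>X. F' X * G X + F X * G' X)"
proof -
  from assms obtain A B where A: "A \<ge> 0" "B \<ge> 0"
    "\<And>X u. X\<in>SO_mats n \<Longrightarrow> \<bar>u\<bar> \<le> 1 \<Longrightarrow> \<bar>F (givens n i j u * X) - F X - u * F' X\<bar> \<le> A * u\<^sup>2"
    "\<And>X u. X\<in>SO_mats n \<Longrightarrow> \<bar>u\<bar> \<le> 1 \<Longrightarrow> \<bar>G (givens n i j u * X) - G X - u * G' X\<bar> \<le> B * u\<^sup>2"
    unfolding has_rot_deriv_def by metis
  from assms obtain a a' b b' where a: "a \<ge> 0" "a' \<ge> 0" "b \<ge> 0" "b' \<ge> 0"
    "\<And>X. X\<in>SO_mats n \<Longrightarrow> \<bar>F X\<bar> \<le> a" "\<And>X. X\<in>SO_mats n \<Longrightarrow> \<bar>F' X\<bar> \<le> a'"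
    "\<And>X. X\<in>SO_mats n \<Longrightarrow> \<bar>G X\<bar> \<le> b" "\<And>X. X\<in>SO_mats n \<Longrightarrow> \<bar>G' X\<bar> \<le> b'"
    unfolding has_rot_deriv_def bounded_meas_def by metis
  \<comment> \<open>The four products bound the four remainder terms below in order; in the third,
    \<open>\<bar>u\<bar> \<le> 1\<close> absorbs one factor \<open>u\<close>. The first needs the
    bound on \<open>F\<close> at the rotated point, which is again in the group.\<close>
  define C where "C = a * B + A * b + A * b' + a' * b'"
  have "\<bar>F (givens n i j u * X) * G (givens n i j u * X) - F X * G X - u * (F' X * G X + F X * G' X)\<bar> \<le> C * u\<^sup>2"
    if X: "X \<in> SO_mats n" and u: "\<bar>u\<bar> \<le> 1" for X u
  proof -
    define Y where "Y = givens n i j u * X"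
    have Y: "Y \<in> SO_mats n" unfolding Y_def by (rule SO_mats_mult[OF givens_SO[OF ij] X])
    define r s where "r = F Y - F X - u * F' X" and "s = G Y - G X - u * G' X"
    have rs: "\<bar>r\<bar> \<le> A * u\<^sup>2" "\<bar>s\<bar> \<le> B * u\<^sup>2"
      using A(3,4)[OF X u] by (simp_all add: r_def s_def Y_def)
    have "F Y * G Y - F X * G X - u * (F' X * G X + F X * G' X) =
       F Y * s + r * G X + u * r * G' X + u\<^sup>2 * (F' X * G' X)"
      by (simp add: r_def s_def algebra_simps power2_eq_square)
    also have "\<bar>\<dots>\<bar> \<le> \<bar>F Y * s\<bar> + \<bar>r * G X\<bar> + \<bar>u * r * G' X\<bar> + \<bar>u\<^sup>2 * (F' X * G' X)\<bar>" by linarith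
    also have "\<bar>F Y * s\<bar> \<le> a * (B * u\<^sup>2)" unfolding abs_mult by (intro mult_mono a Y rs) (use a in auto)
    also have "\<bar>r * G X\<bar> \<le> (A * u\<^sup>2) * b" unfolding abs_mult by (intro mult_mono a X rs) (use A in auto)
    also have "\<bar>u * r * G' X\<bar> \<le> (1 * (A * u\<^sup>2)) * b'" unfolding abs_mult by (intro mult_mono a X rs u) (use A in auto)
    also have "\<bar>u\<^sup>2 * (F' X * G' X)\<bar> \<le> u\<^sup>2 * (a' * b')" unfolding abs_mult by (intro mult_mono a X) (use a in auto)
    finally show ?thesis by (simp add: Y_def C_def algebra_simps)
  qed
  moreover have "C \<ge> 0" using a A by (simp add: C_def)
  ultimately show ?thesis using assms unfolding has_rot_deriv_def
    by (intro conjI bounded_meas_add bounded_meas_mult exI[of _ C]) auto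
qed

lemma has_rot_deriv_cmult:
  assumes "has_rot_deriv n i j F F'" "i < n" "j < n" "i \<noteq> j"
  shows "has_rot_deriv n i j (\<lambda>X. c * F X) (\<lambda>X. c * F' X)"
  using has_rot_deriv_mult[OF has_rot_deriv_const[of n i j c] assms] by simp

lemma has_rot_deriv_diff:
  assumes "has_rot_deriv n i j F F'" "has_rot_deriv n i j G G'" "i < n" "j < n" "i \<noteq> j"
  shows "has_rot_deriv n i j (\<lambda>X. F X - G X) (\<lambda>X. F' X - G' X)"
  using has_rot_deriv_add[OF assms(1) has_rot_deriv_cmult[OF assms(2-5), of "-1"]] by simp

lemma has_rot_deriv_sum:
  assumes "\<And>k. k \<in> I \<Longrightarrow> has_rot_deriv n i j (F k) (F' k)"
  shows "has_rot_deriv n i j (\<lambda>X. \<Sum>k\<in>I. F k X) (\<lambda>X. \<Sum>k\<in>I. F' k X)"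
  using assms
  by (induction I rule: infinite_finite_induct) (auto intro: has_rot_deriv_const has_rot_deriv_add)

text \<open>To first order the rotation adds \<open>u\<close> times row \<open>i\<close> to row
  \<open>j\<close> and subtracts \<open>u\<close> times row \<open>j\<close> from row
  \<open>i\<close>. The errors of \<open>cos\<close> and \<open>sin\<close> are at most
  \<open>u\<^sup>2\<close> each, on entries bounded by 1.\<close>

lemma has_rot_deriv_entry:
  assumes ij: "i < n" "j < n" "i \<noteq> j" and pq: "p < n" "q < n"
  shows "has_rot_deriv n i j (\<lambda>X. X $$ (p, q))
    (\<lambda>X. (if p = j then X $$ (i, q) else 0) - (if p = i then X $$ (j, q) else 0))"
proof -
  have bm: "bounded_meas n (\<lambda>X. X $$ (p, q))" if "p < n" for p
    unfolding bounded_meas_def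
    by (auto intro!: measurable_SO_entry exI[of _ 1] SO_mats_entry_bound that pq)
  have c: "\<bar>cos u - 1\<bar> \<le> u\<^sup>2" for u :: real
  proof -
    have "\<bar>sin (u / 2)\<bar>\<^sup>2 \<le> \<bar>u / 2\<bar>\<^sup>2" by (intro power_mono abs_sin_x_le_abs_x) auto
    moreover have "cos u = 1 - 2 * (sin (u / 2))\<^sup>2" using cos_double_sin[of "u / 2"] by simp
    ultimately show ?thesis
      by (simp add: power_divide) (use zero_le_power2[of "sin (u / 2)"] in linarith)
  qed
  have s: "\<bar>sin u - u\<bar> \<le> u\<^sup>2" for u :: real
  proof -
    have "\<bar>sin u - u\<bar> * 2 \<le> u\<^sup>2"
      using Maclaurin_sin_bound[of u 2] by (simp add: numeral_2_eq_2 sin_coeff_def)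
    then have "\<bar>sin u - u\<bar> \<le> u\<^sup>2 / 2" by simp
    also have "\<dots> \<le> u\<^sup>2" by simp
    finally show ?thesis .
  qed
  have "\<bar>(givens n i j u * X) $$ (p, q) - X $$ (p, q) -
      u * ((if p = j then X $$ (i, q) else 0) - (if p = i then X $$ (j, q) else 0))\<bar> \<le> 2 * u\<^sup>2"
    if X: "X \<in> SO_mats n" for X u
  proof -
    have "\<bar>(cos u - 1) * X $$ (k, q)\<bar> \<le> u\<^sup>2 * 1" "\<bar>(sin u - u) * X $$ (k, q)\<bar> \<le> u\<^sup>2 * 1" if "k < n" for k
      unfolding abs_mult
      by (intro mult_mono c s SO_mats_entry_bound[OF X] that pq; simp)+
    note b = this[OF ij(1)] this[OF ij(2)]
    have e: "(givens n i j u * X) $$ (p, q) - X $$ (p, q) -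
      u * ((if p = j then X $$ (i, q) else 0) - (if p = i then X $$ (j, q) else 0)) =
      (if p = i then (cos u - 1) * X $$ (i, q) - (sin u - u) * X $$ (j, q)
       else if p = j then (sin u - u) * X $$ (i, q) + (cos u - 1) * X $$ (j, q) else 0)"
      using givens_mult_entry[OF SO_matsD(1)[OF X] ij pq, of u] ij by (auto simp: algebra_simps)
    show ?thesis unfolding e using b by auto
  qed
  then have "\<exists>C\<ge>0. \<forall>X\<in>SO_mats n. \<forall>u. \<bar>u\<bar> \<le> 1 \<longrightarrow> \<bar>(givens n i j u * X) $$ (p, q) - X $$ (p, q) -
      u * ((if p = j then X $$ (i, q) else 0) - (if p = i then X $$ (j, q) else 0))\<bar> \<le> C * u\<^sup>2"
    by (intro exI[of _ 2]) auto
  moreover have "bounded_meas n (\<lambda>X. (if p = j then X $$ (i, q) else 0) - (if p = i then X $$ (j, q) else 0))"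
    using bm ij by (intro bounded_meas_diff) (cases "p = j"; cases "p = i"; auto)+
  ultimately show ?thesis using bm[OF pq(1)] unfolding has_rot_deriv_def by blast
qed

text \<open>Leibniz rule: the generator \<open>A = E_ji - E_ij\<close> is inserted in front of each
  of the \<open>k\<close> factors, which gives \<open>\<Sum> X^c A X^(k-c)\<close> over
  \<open>c < k\<close>.\<close>

lemma has_rot_deriv_pow_entry:
  assumes ij: "i < n" "j < n" "i \<noteq> j" and pq: "p < n" "q < n"
  shows "has_rot_deriv n i j (\<lambda>X. (X ^\<^sub>m k) $$ (p, q))
    (\<lambda>X. \<Sum>c<k. (X ^\<^sub>m c) $$ (p, j) * (X ^\<^sub>m (k - c)) $$ (i, q) - (X ^\<^sub>m c) $$ (p, i) * (X ^\<^sub>m (k - c)) $$ (j, q))"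
  using pq
proof (induction k arbitrary: q)
  case 0
  show ?case
    by (rule has_rot_deriv_cong[OF has_rot_deriv_const[where c = "if p = q then 1 else 0"] ij])
      (use 0 in \<open>auto dest!: SO_matsD(1)\<close>)
next
  case (Suc k)
  let ?W = "\<lambda>k p q X. \<Sum>c<k. (X ^\<^sub>m c) $$ (p, j) * (X ^\<^sub>m (k - c)) $$ (i, q) - (X ^\<^sub>m c) $$ (p, i) * (X ^\<^sub>m (k - c)) $$ (j, q)"
  have "has_rot_deriv n i j (\<lambda>X. \<Sum>r<n. (X ^\<^sub>m k) $$ (p, r) * X $$ (r, q))
    (\<lambda>X. \<Sum>r<n. ?W k p r X * X $$ (r, q) + (X ^\<^sub>m k) $$ (p, r) * 
       ((if r = j then X $$ (i, q) else 0) - (if r = i then X $$ (j, q) else 0)))"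
    by (intro has_rot_deriv_sum has_rot_deriv_mult Suc.IH has_rot_deriv_entry ij) (use Suc.prems in auto)
  then show ?case
  proof (rule has_rot_deriv_cong[OF _ ij])
    fix X assume X: "X \<in> SO_mats n"
    note C = SO_matsD(1)[OF X]
    show "(X ^\<^sub>m Suc k) $$ (p, q) = (\<Sum>r<n. (X ^\<^sub>m k) $$ (p, r) * X $$ (r, q))"
      by (rule pow_mat_Suc_entry[OF C Suc.prems])
    have "(\<Sum>r<n. ?W k p r X * X $$ (r, q)) = (\<Sum>c<k. (X ^\<^sub>m c) $$ (p, j) * (\<Sum>r<n. (X ^\<^sub>m (k - c)) $$ (i, r) * X $$ (r, q))
       - (X ^\<^sub>m c) $$ (p, i) * (\<Sum>r<n. (X ^\<^sub>m (k - c)) $$ (j, r) * X $$ (r, q)))"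
      unfolding sum_distrib_left sum_distrib_right sum_subtractf[symmetric]
      by (subst sum.swap) (simp add: algebra_simps)
    also have "\<dots> = (\<Sum>c<k. (X ^\<^sub>m c) $$ (p, j) * (X ^\<^sub>m (Suc k - c)) $$ (i, q) - (X ^\<^sub>m c) $$ (p, i) * (X ^\<^sub>m (Suc k - c)) $$ (j, q))"
      using pow_mat_Suc_entry[OF C] ij Suc.prems by (intro sum.cong refl) (simp add: Suc_diff_le del: pow_mat.simps)
    moreover have "(\<Sum>r<n. (X ^\<^sub>m k) $$ (p, r) * ((if r = j then X $$ (i, q) else 0) - (if r = i then X $$ (j, q) else 0))) =
      (X ^\<^sub>m k) $$ (p, j) * X $$ (i, q) - (X ^\<^sub>m k) $$ (p, i) * X $$ (j, q)"
      using ij by (simp add: right_diff_distrib sum_subtractf if_distrib[of "\<lambda>x. _ * x"] cong: if_cong)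
    moreover have "X ^\<^sub>m (Suc k - k) = X" using C by simp
    ultimately show "?W (Suc k) p q X = (\<Sum>r<n. ?W k p r X * X $$ (r, q) + (X ^\<^sub>m k) $$ (p, r) * 
       ((if r = j then X $$ (i, q) else 0) - (if r = i then X $$ (j, q) else 0)))"
      by (simp add: sum.distrib del: pow_mat.simps)
  qed
qed

text \<open>The trace of \<open>A X^k\<close> with the generator \<open>A = E_ji - E_ij\<close>,
  that is \<open>D P\<^sub>k / k\<close>. With the factor \<open>k\<close> split off, the
  derivatives of \<open>h\<close> and \<open>e\<close> become plain convolutions with
  \<open>T\<close>.\<close>

definition rot_T :: "nat \<Rightarrow> nat \<Rightarrow> real mat \<Rightarrow> nat \<Rightarrow> real" where
  "rot_T i j X k = (X ^\<^sub>m k) $$ (i, j) - (X ^\<^sub>m k) $$ (j, i)"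

definition rot_DT :: "nat \<Rightarrow> nat \<Rightarrow> real mat \<Rightarrow> nat \<Rightarrow> real" where
  "rot_DT i j X k = (\<Sum>c<k.
     (X ^\<^sub>m c) $$ (i, j) * (X ^\<^sub>m (k - c)) $$ (i, j) - (X ^\<^sub>m c) $$ (i, i) * (X ^\<^sub>m (k - c)) $$ (j, j)
     - ((X ^\<^sub>m c) $$ (j, j) * (X ^\<^sub>m (k - c)) $$ (i, i) - (X ^\<^sub>m c) $$ (j, i) * (X ^\<^sub>m (k - c)) $$ (j, i)))"

lemma rot_T_0: "X \<in> SO_mats n \<Longrightarrow> i < n \<Longrightarrow> j < n \<Longrightarrow> rot_T i j X 0 = 0"
  by (auto simp: rot_T_def dest!: SO_matsD(1))

lemma rot_diag: "rot_T i i X k = 0" "rot_DT i i X k = 0"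
  by (simp_all add: rot_T_def rot_DT_def)

lemma has_rot_deriv_rot_T:
  assumes ij: "i < n" "j < n" "i \<noteq> j"
  shows "has_rot_deriv n i j (\<lambda>X. rot_T i j X k) (\<lambda>X. rot_DT i j X k)"
  unfolding rot_T_def rot_DT_def sum_subtractf[of _ "\<lambda>c. _ c - _ c"]
  by (intro has_rot_deriv_diff has_rot_deriv_pow_entry ij)

text \<open>By cyclicity of the trace, all \<open>k\<close> places where the generator can be
  inserted contribute equally.\<close>

lemma has_rot_deriv_pow_trace:
  assumes ij: "i < n" "j < n" "i \<noteq> j"
  shows "has_rot_deriv n i j (\<lambda>X. pow_trace n X k) (\<lambda>X. of_nat k * rot_T i j X k)"
proof -
  have "has_rot_deriv n i j (\<lambda>X. \<Sum>p<n. (X ^\<^sub>m k) $$ (p, p)) (\<lambda>X. \<Sum>p<n. \<Sum>c<k.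
      (X ^\<^sub>m c) $$ (p, j) * (X ^\<^sub>m (k - c)) $$ (i, p) - (X ^\<^sub>m c) $$ (p, i) * (X ^\<^sub>m (k - c)) $$ (j, p))"
    by (intro has_rot_deriv_sum has_rot_deriv_pow_entry ij) auto
  then show ?thesis
  proof (rule has_rot_deriv_cong[OF _ ij])
    fix X assume X: "X \<in> SO_mats n"
    have "(\<Sum>p<n. \<Sum>c<k. (X ^\<^sub>m c) $$ (p, j) * (X ^\<^sub>m (k - c)) $$ (i, p) - (X ^\<^sub>m c) $$ (p, i) * (X ^\<^sub>m (k - c)) $$ (j, p)) =
      (\<Sum>c<k. (\<Sum>p<n. (X ^\<^sub>m (k - c)) $$ (i, p) * (X ^\<^sub>m c) $$ (p, j)) - (\<Sum>p<n. (X ^\<^sub>m (k - c)) $$ (j, p) * (X ^\<^sub>m c) $$ (p, i)))"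
      by (subst sum.swap) (simp add: sum_subtractf mult.commute)
    also have "\<dots> = (\<Sum>c<k. rot_T i j X k)"
    proof (intro sum.cong refl)
      fix c assume "c \<in> {..<k}"
      then have "k - c + c = k" by simp
      then show "(\<Sum>p<n. (X ^\<^sub>m (k - c)) $$ (i, p) * (X ^\<^sub>m c) $$ (p, j)) -
          (\<Sum>p<n. (X ^\<^sub>m (k - c)) $$ (j, p) * (X ^\<^sub>m c) $$ (p, i)) = rot_T i j X k"
        using pow_mat_add_entry[OF SO_matsD(1)[OF X], of _ _ "k - c" c] ij by (simp add: rot_T_def)
    qed
    finally show "of_nat k * rot_T i j X k = (\<Sum>p<n. \<Sum>c<k.
      (X ^\<^sub>m c) $$ (p, j) * (X ^\<^sub>m (k - c)) $$ (i, p) - (X ^\<^sub>m c) $$ (p, i) * (X ^\<^sub>m (k - c)) $$ (j, p))"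
      by simp
  qed (simp add: pow_trace_def)
qed

text \<open>Arbitrary \<open>P\<close> and \<open>T\<close> let the same rule serve \<open>h\<close>
  and, with both families negated, \<open>e\<close>.\<close>

lemma has_rot_deriv_newton:
  assumes ij: "i < n" "j < n" "i \<noteq> j"
    and P: "\<And>k. has_rot_deriv n i j (\<lambda>X. P X k) (\<lambda>X. of_nat k * T X k)"
    and T: "\<And>X. X \<in> SO_mats n \<Longrightarrow> T X 0 = 0"
  shows "has_rot_deriv n i j (\<lambda>X. newton (P X) l) (\<lambda>X. \<Sum>q\<le>l. T X q * newton (P X) (l - q))"
proof (induction l rule: less_induct)
  case (less l)
  show ?case
  proof (cases l)
    case 0
    then show ?thesis
      by (intro has_rot_deriv_cong[OF has_rot_deriv_const[where c = 1] ij]) (auto simp: T)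
  next
    case (Suc m)
    have "has_rot_deriv n i j (\<lambda>X. inverse (Suc m) * (\<Sum>k\<le>m. P X (Suc k) * newton (P X) (m - k)))
      (\<lambda>X. inverse (Suc m) * (\<Sum>k\<le>m. of_nat (Suc k) * T X (Suc k) * newton (P X) (m - k) +
          P X (Suc k) * (\<Sum>q\<le>m - k. T X q * newton (P X) (m - k - q))))"
      by (intro has_rot_deriv_cmult has_rot_deriv_sum has_rot_deriv_mult P less ij) (use Suc in auto)
    then show ?thesis
      unfolding Suc
    proof (rule has_rot_deriv_cong[OF _ ij])
      fix X assume X: "X \<in> SO_mats n"
      show "(\<Sum>q\<le>Suc m. T X q * newton (P X) (Suc m - q)) =
        inverse (Suc m) * (\<Sum>k\<le>m. of_nat (Suc k) * T X (Suc k) * newton (P X) (m - k) +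
          P X (Suc k) * (\<Sum>q\<le>m - k. T X q * newton (P X) (m - k - q)))"
        unfolding newton_deriv_identity[where T = "T X" and P = "P X", OF T[OF X]] by simp
    qed (simp add: field_simps)
  qed
qed

text \<open>With the sign \<open>(-1)\<^sup>r\<close> included: the coefficient of \<open>z\<^sup>r\<close> in \<open>det (1 - z X)\<close>.\<close>

definition elem_sym :: "nat \<Rightarrow> real mat \<Rightarrow> nat \<Rightarrow> real" where
  "elem_sym n X = newton (\<lambda>k. - pow_trace n X k)"

definition comp_sym :: "nat \<Rightarrow> real mat \<Rightarrow> nat \<Rightarrow> real" where
  "comp_sym n X = newton (pow_trace n X)"

text \<open>For \<open>n \<ge> 2\<close> this is contained in differentiability along the plane of
  coordinates 0 and 1. Smaller \<open>n\<close> admit no plane, but there the group is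
  trivial.\<close>

lemma bounded_meas_pow_trace: "bounded_meas n (\<lambda>X. pow_trace n X k)"
proof (cases "n < 2")
  case True
  then consider "n = 0" | "n = 1" by linarith
  then show ?thesis
  proof cases
    case 2
    have "X ^\<^sub>m k = 1\<^sub>m 1" if "X \<in> SO_mats 1" for X
    proof -
      note C = SO_matsD[OF that]
      have "X $$ (0,0) = 1" using C det_single[of X] C(1) by auto
      then have "X = 1\<^sub>m 1" by (intro eq_matI) (use C(1) in auto)
      moreover have "1\<^sub>m 1 ^\<^sub>m k = (1\<^sub>m 1 :: real mat)" by (induction k) auto
      ultimately show ?thesis by simp
    qed
    then show ?thesis using 2 by (intro bounded_meas_cong[OF bounded_meas_const[of n 1]]) (auto simp: pow_trace_def)
  qed (auto simp: pow_trace_def intro: bounded_meas_const)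
next
  case False
  then have "has_rot_deriv n 0 1 (\<lambda>X. pow_trace n X k) (\<lambda>X. of_nat k * rot_T 0 1 X k)"
    by (intro has_rot_deriv_pow_trace) auto
  then show ?thesis by (simp add: has_rot_deriv_def)
qed

lemma bounded_meas_newton:
  assumes "\<And>k. bounded_meas n (\<lambda>X. P X k)"
  shows "bounded_meas n (\<lambda>X. newton (P X) l)"
proof (induction l rule: less_induct)
  case (less l)
  show ?case
  proof (cases l)
    case (Suc m)
    have "bounded_meas n (\<lambda>X. inverse (Suc m) * (\<Sum>k\<le>m. P X (Suc k) * newton (P X) (m - k)))"
      using Suc less assms
      by (intro bounded_meas_mult bounded_meas_const bounded_meas_sum) auto
    then show ?thesis unfolding Suc by (simp add: field_simps)
  qed auto
qed

lemma bounded_meas_comp_sym: "bounded_meas n (\<lambda>X. comp_sym n X l)"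
  unfolding comp_sym_def by (intro bounded_meas_newton bounded_meas_pow_trace)

lemma bounded_meas_elem_sym: "bounded_meas n (\<lambda>X. elem_sym n X l)"
  unfolding elem_sym_def
  using bounded_meas_diff[OF bounded_meas_const[of n 0] bounded_meas_pow_trace]
  by (intro bounded_meas_newton) simp

definition rot_Dcomp :: "nat \<Rightarrow> nat \<Rightarrow> nat \<Rightarrow> real mat \<Rightarrow> nat \<Rightarrow> real" where
  "rot_Dcomp n i j X l = (\<Sum>q\<le>l. rot_T i j X q * comp_sym n X (l - q))"

definition rot_DDcomp :: "nat \<Rightarrow> nat \<Rightarrow> nat \<Rightarrow> real mat \<Rightarrow> nat \<Rightarrow> real" where
  "rot_DDcomp n i j X l = (\<Sum>q\<le>l. rot_DT i j X q * comp_sym n X (l - q) + rot_T i j X q * rot_Dcomp n i j X (l - q))"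

definition rot_Delem :: "nat \<Rightarrow> nat \<Rightarrow> nat \<Rightarrow> real mat \<Rightarrow> nat \<Rightarrow> real" where
  "rot_Delem n i j X r = - (\<Sum>q\<le>r. rot_T i j X q * elem_sym n X (r - q))"

lemma has_rot_deriv_comp_sym:
  assumes ij: "i < n" "j < n" "i \<noteq> j"
  shows "has_rot_deriv n i j (\<lambda>X. comp_sym n X l) (\<lambda>X. rot_Dcomp n i j X l)"
  unfolding comp_sym_def rot_Dcomp_def
  by (intro has_rot_deriv_newton has_rot_deriv_pow_trace ij) (simp add: rot_T_0[OF _ ij(1,2)])

lemma has_rot_deriv_rot_Dcomp:
  assumes ij: "i < n" "j < n" "i \<noteq> j"
  shows "has_rot_deriv n i j (\<lambda>X. rot_Dcomp n i j X l) (\<lambda>X. rot_DDcomp n i j X l)"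
  unfolding rot_Dcomp_def[of _ _ _ _ l] rot_DDcomp_def
  by (intro has_rot_deriv_sum has_rot_deriv_mult has_rot_deriv_rot_T has_rot_deriv_comp_sym ij)

lemma has_rot_deriv_elem_sym:
  assumes ij: "i < n" "j < n" "i \<noteq> j"
  shows "has_rot_deriv n i j (\<lambda>X. elem_sym n X l) (\<lambda>X. rot_Delem n i j X l)"
proof -
  have "has_rot_deriv n i j (\<lambda>X. - pow_trace n X k) (\<lambda>X. of_nat k * (- rot_T i j X k))" for k
    using has_rot_deriv_cmult[OF has_rot_deriv_pow_trace[OF ij] ij, of "-1" k] by simp
  from has_rot_deriv_newton[OF ij this, of l] show ?thesis
    by (simp add: elem_sym_def rot_Delem_def sum_negf rot_T_0[OF _ ij(1,2)])
qed

section \<open>Sums over all planes\<close>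

lemma sum_swap_triple: "(\<Sum>i\<in>A. \<Sum>j\<in>B. \<Sum>k\<in>C. f i j k) = (\<Sum>k\<in>C. \<Sum>i\<in>A. \<Sum>j\<in>B. f i j k)"
  by (subst sum.swap[of _ C B], subst sum.swap[of _ C A]) simp

text \<open>Products with equal index order sum to \<open>P\<close> at \<open>natdist p q\<close> by
  orthogonality, crossed ones to \<open>P\<close> at \<open>p + q\<close>. Ordered pairs count each
  plane twice, hence the factor 2 here and below.\<close>

lemma sum_rot_T_mult:
  assumes X: "X \<in> SO_mats n"
  shows "(\<Sum>i<n. \<Sum>j<n. rot_T i j X p * rot_T i j X q) = 2 * (pow_trace n X (natdist p q) - pow_trace n X (p + q))"
proof -
  let ?W = "\<lambda>k i j. (X ^\<^sub>m k) $$ (i, j)"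
  have "(\<Sum>i<n. \<Sum>j<n. rot_T i j X p * rot_T i j X q) =
    (\<Sum>i<n. \<Sum>j<n. ?W p i j * ?W q i j) + (\<Sum>i<n. \<Sum>j<n. ?W p j i * ?W q j i)
    - (\<Sum>i<n. \<Sum>j<n. ?W p i j * ?W q j i) - (\<Sum>i<n. \<Sum>j<n. ?W p j i * ?W q i j)"
    unfolding sum.distrib[symmetric] sum_subtractf[symmetric]
    by (intro sum.cong refl) (simp add: rot_T_def algebra_simps)
  also have "(\<Sum>i<n. \<Sum>j<n. ?W p j i * ?W q j i) = (\<Sum>i<n. \<Sum>j<n. ?W p i j * ?W q i j)"
    by (rule sum.swap)
  also have "(\<Sum>i<n. \<Sum>j<n. ?W p j i * ?W q i j) = (\<Sum>i<n. \<Sum>j<n. ?W p i j * ?W q j i)"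
    by (rule sum.swap)
  finally show ?thesis unfolding sum_pow_entries[OF X] sum_pow_entries_swap[OF X] by simp
qed

text \<open>The products of diagonal entries yield \<open>P\<^sub>c\<close> times \<open>P\<close>
  at \<open>k - c\<close>. These are the nonlinear terms that \<open>newton_laplace\<close>
  cancels.\<close>

lemma sum_rot_DT:
  assumes X: "X \<in> SO_mats n"
  shows "(\<Sum>i<n. \<Sum>j<n. rot_DT i j X k) =
    2 * (\<Sum>c<k. pow_trace n X (natdist c (k - c)) - pow_trace n X c * pow_trace n X (k - c))"
proof -
  let ?W = "\<lambda>k i j. (X ^\<^sub>m k) $$ (i, j)"
  have "(\<Sum>i<n. \<Sum>j<n. rot_DT i j X k) = (\<Sum>c<k. \<Sum>i<n. \<Sum>j<n. ?W c i j * ?W (k-c) i j - ?W c i i * ?W (k-c) j j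
     - (?W c j j * ?W (k-c) i i - ?W c j i * ?W (k-c) j i))"
    unfolding rot_DT_def by (rule sum_swap_triple)
  also have "\<dots> = (\<Sum>c<k. 2 * (pow_trace n X (natdist c (k - c)) - pow_trace n X c * pow_trace n X (k - c)))"
  proof (intro sum.cong refl)
    fix c
    have "(\<Sum>i<n. \<Sum>j<n. ?W c i j * ?W (k-c) i j - ?W c i i * ?W (k-c) j j
     - (?W c j j * ?W (k-c) i i - ?W c j i * ?W (k-c) j i)) =
     (\<Sum>i<n. \<Sum>j<n. ?W c i j * ?W (k-c) i j) + (\<Sum>i<n. \<Sum>j<n. ?W c j i * ?W (k-c) j i)
     - (\<Sum>i<n. \<Sum>j<n. ?W c i i * ?W (k-c) j j) - (\<Sum>i<n. \<Sum>j<n. ?W c j j * ?W (k-c) i i)"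
      unfolding sum.distrib[symmetric] sum_subtractf[symmetric]
      by (intro sum.cong refl) simp
    also have "(\<Sum>i<n. \<Sum>j<n. ?W c j i * ?W (k-c) j i) = (\<Sum>i<n. \<Sum>j<n. ?W c i j * ?W (k-c) i j)"
      by (rule sum.swap)
    also have "(\<Sum>i<n. \<Sum>j<n. ?W c j j * ?W (k-c) i i) = (\<Sum>i<n. \<Sum>j<n. ?W c i i * ?W (k-c) j j)"
      by (rule sum.swap)
    also have "(\<Sum>i<n. \<Sum>j<n. ?W c i i * ?W (k-c) j j) = pow_trace n X c * pow_trace n X (k - c)"
      by (simp add: pow_trace_def sum_product)
    finally show "(\<Sum>i<n. \<Sum>j<n. ?W c i j * ?W (k-c) i j - ?W c i i * ?W (k-c) j j
     - (?W c j j * ?W (k-c) i i - ?W c j i * ?W (k-c) j i)) = 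
     2 * (pow_trace n X (natdist c (k - c)) - pow_trace n X c * pow_trace n X (k - c))"
      unfolding sum_pow_entries[OF X] by simp
  qed
  finally show ?thesis by (simp add: sum_distrib_left)
qed

lemma sum_rot_DDcomp:
  assumes X: "X \<in> SO_mats n"
  shows "(\<Sum>i<n. \<Sum>j<n. rot_DDcomp n i j X l) =
    2 * (2 * conv_gap (pow_trace n X) l - (2 * n + (n + 2) * l + l\<^sup>2) * comp_sym n X l)"
proof -
  let ?P = "pow_trace n X"
  have "(\<Sum>i<n. \<Sum>j<n. rot_DDcomp n i j X l) =
    (\<Sum>i<n. \<Sum>j<n. \<Sum>q\<le>l. rot_DT i j X q * comp_sym n X (l - q)) +
    (\<Sum>i<n. \<Sum>j<n. \<Sum>k\<le>l. \<Sum>q\<le>l-k. rot_T i j X k * rot_T i j X q * comp_sym n X (l - k - q))"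
    by (simp add: rot_DDcomp_def rot_Dcomp_def sum.distrib sum_distrib_left mult.assoc)
  also have "(\<Sum>i<n. \<Sum>j<n. \<Sum>q\<le>l. rot_DT i j X q * comp_sym n X (l - q)) =
     (\<Sum>q\<le>l. (\<Sum>i<n. \<Sum>j<n. rot_DT i j X q) * comp_sym n X (l - q))"
    by (subst sum_swap_triple) (simp add: sum_distrib_right)
  also have "\<dots> = 2 * (\<Sum>q\<le>l. (\<Sum>c<q. ?P (natdist c (q - c)) - ?P c * ?P (q - c)) * comp_sym n X (l - q))"
    unfolding sum_rot_DT[OF X] by (simp only: mult.assoc sum_distrib_left[symmetric])
  also have "(\<Sum>i<n. \<Sum>j<n. \<Sum>k\<le>l. \<Sum>q\<le>l-k. rot_T i j X k * rot_T i j X q * comp_sym n X (l - k - q)) =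
     (\<Sum>k\<le>l. \<Sum>q\<le>l-k. (\<Sum>i<n. \<Sum>j<n. rot_T i j X k * rot_T i j X q) * comp_sym n X (l - k - q))"
    unfolding sum_distrib_right by (simp only: sum_swap_triple[of _ "{..l}"] sum_swap_triple[of _ "{..l - _}"])
  also have "\<dots> = 2 * (\<Sum>k\<le>l. \<Sum>q\<le>l-k. (?P (natdist k q) - ?P (k + q)) * comp_sym n X (l - k - q))"
    unfolding sum_rot_T_mult[OF X] by (simp only: mult.assoc sum_distrib_left[symmetric])
  finally show ?thesis
    using newton_laplace[where P = ?P and l = l] pow_trace_0[OF X]
    unfolding comp_sym_def by (simp add: algebra_simps)
qed

lemma sum_rot_Delem_Dcomp:
  assumes X: "X \<in> SO_mats n"
  shows "(\<Sum>i<n. \<Sum>j<n. rot_Delem n i j X r * rot_Dcomp n i j X l) =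
    2 * (conv_sum (pow_trace n X) r l - conv_dist (pow_trace n X) r l)"
proof -
  have "(\<Sum>i<n. \<Sum>j<n. rot_Delem n i j X r * rot_Dcomp n i j X l) =
    - (\<Sum>i<n. \<Sum>j<n. \<Sum>p\<le>r. \<Sum>q\<le>l. rot_T i j X p * rot_T i j X q * elem_sym n X (r - p) * comp_sym n X (l - q))"
    unfolding rot_Delem_def rot_Dcomp_def mult_minus_left sum_product sum_negf by (simp add: mult_ac)
  also have "(\<Sum>i<n. \<Sum>j<n. \<Sum>p\<le>r. \<Sum>q\<le>l. rot_T i j X p * rot_T i j X q * elem_sym n X (r - p) * comp_sym n X (l - q)) =
     (\<Sum>p\<le>r. \<Sum>q\<le>l. (\<Sum>i<n. \<Sum>j<n. rot_T i j X p * rot_T i j X q) * elem_sym n X (r - p) * comp_sym n X (l - q))"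
    unfolding sum_distrib_right by (simp only: sum_swap_triple[of _ "{..r}"] sum_swap_triple[of _ "{..l}"])
  also have "\<dots> = (\<Sum>p\<le>r. \<Sum>q\<le>l. 2 * (pow_trace n X (natdist p q) - pow_trace n X (p + q)) * elem_sym n X (r - p) * comp_sym n X (l - q))"
    unfolding sum_rot_T_mult[OF X] ..
  also have "\<dots> = 2 * (conv_dist (pow_trace n X) r l - conv_sum (pow_trace n X) r l)"
    unfolding conv_dist_def conv_sum_def elem_sym_def comp_sym_def sum_subtractf[symmetric] sum_distrib_left
    by (intro sum.cong refl) (simp add: algebra_simps)
  finally show ?thesis by simp
qed

section \<open>Moments of the Haar measure\<close>

lemma haar_facts:
  assumes "is_Haar_prob_SO n \<mu>"
  shows "prob_space \<mu>" "sets \<mu> = sets (SO_borel n)" "space \<mu> = SO_mats n"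
    "borel_measurable \<mu> = borel_measurable (SO_borel n)"
proof -
  show "prob_space \<mu>" and s: "sets \<mu> = sets (SO_borel n)"
    using assms by (auto simp: is_Haar_prob_SO_def)
  show "space \<mu> = SO_mats n" using sets_eq_imp_space_eq[OF s] by simp
  show "borel_measurable \<mu> = borel_measurable (SO_borel n)"
    by (rule measurable_cong_sets[OF s refl])
qed

lemma integrable_bounded_meas:
  assumes "is_Haar_prob_SO n \<mu>" "bounded_meas n F"
  shows "integrable \<mu> F"
proof -
  note H = haar_facts[OF assms(1)]
  interpret prob_space \<mu> by (rule H)
  from assms(2) obtain C where "\<And>X. X \<in> SO_mats n \<Longrightarrow> \<bar>F X\<bar> \<le> C"
    by (auto simp: bounded_meas_def)
  then show ?thesis
    using assms(2) H by (intro integrable_const_bound[of _ C]) (auto simp: bounded_meas_def)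
qed

lemma integral_SO_cong:
  assumes "is_Haar_prob_SO n \<mu>" "\<And>X. X \<in> SO_mats n \<Longrightarrow> F X = G X"
  shows "integral\<^sup>L \<mu> F = integral\<^sup>L \<mu> G"
  using assms haar_facts(3)[OF assms(1)] by (intro Bochner_Integration.integral_cong) auto

lemma haar_translation:
  fixes F :: "real mat \<Rightarrow> real"
  assumes H: "is_Haar_prob_SO n \<mu>" and Y: "Y \<in> SO_mats n" and F: "F \<in> borel_measurable (SO_borel n)"
  shows "(\<integral>X. F (Y * X) \<partial>\<mu>) = integral\<^sup>L \<mu> F"
proof -
  have "distr \<mu> (SO_borel n) (\<lambda>X. Y * X) = \<mu>" using H Y by (simp add: is_Haar_prob_SO_def)
  then have "integral\<^sup>L \<mu> F = integral\<^sup>L (distr \<mu> (SO_borel n) (\<lambda>X. Y * X)) F" by simp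
  also have "\<dots> = (\<integral>X. F (Y * X) \<partial>\<mu>)"
    using measurable_SO_translation[OF Y] haar_facts(2)[OF H] F
    by (intro integral_distr) (simp_all cong: measurable_cong_sets)
  finally show ?thesis ..
qed

text \<open>Invariance gives \<open>F (R X) - F X\<close> mean 0 for a rotation \<open>R\<close> by
  \<open>u\<close>, so \<open>\<bar>u\<bar>\<close> times the modulus of the mean of
  \<open>F'\<close> is at most \<open>C * u\<^sup>2\<close>. Divide by \<open>u > 0\<close> and let
  \<open>u\<close> tend to 0.\<close>

lemma integral_rot_deriv:
  assumes H: "is_Haar_prob_SO n \<mu>" and ij: "i < n" "j < n" "i \<noteq> j"
    and F: "has_rot_deriv n i j F F'"
  shows "integral\<^sup>L \<mu> F' = 0"
proof -
  note HF = haar_facts[OF H]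
  interpret prob_space \<mu> by (rule HF)
  from F obtain C where C: "C \<ge> 0"
    "\<And>X u. X\<in>SO_mats n \<Longrightarrow> \<bar>u\<bar> \<le> 1 \<Longrightarrow> \<bar>F (givens n i j u * X) - F X - u * F' X\<bar> \<le> C * u\<^sup>2"
    unfolding has_rot_deriv_def by metis
  have bm: "bounded_meas n F" "bounded_meas n F'" using F by (auto simp: has_rot_deriv_def)
  have iF: "integrable \<mu> F" "integrable \<mu> F'" by (intro integrable_bounded_meas[OF H] bm)+
  have "\<bar>integral\<^sup>L \<mu> F'\<bar> \<le> C * u" if u: "0 < u" "u \<le> 1" for u
  proof -
    have Y: "givens n i j u \<in> SO_mats n" by (rule givens_SO[OF ij])
    have bmY: "bounded_meas n (\<lambda>X. F (givens n i j u * X))"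
      using bm(1) SO_mats_mult[OF Y] measurable_compose[OF measurable_SO_translation[OF Y], of F borel]
      unfolding bounded_meas_def by blast
    have iY: "integrable \<mu> (\<lambda>X. F (givens n i j u * X))"
      by (rule integrable_bounded_meas[OF H bmY])
    have "- (u * integral\<^sup>L \<mu> F') = (\<integral>X. F (givens n i j u * X) - F X - u * F' X \<partial>\<mu>)"
      using iF iY haar_translation[OF H Y] bm(1) by (simp add: bounded_meas_def)
    then have "\<bar>u * integral\<^sup>L \<mu> F'\<bar> = \<bar>\<integral>X. F (givens n i j u * X) - F X - u * F' X \<partial>\<mu>\<bar>"
      by (metis abs_minus_cancel)
    also have "\<dots> \<le> (\<integral>X. \<bar>F (givens n i j u * X) - F X - u * F' X\<bar> \<partial>\<mu>)"
      by (rule integral_abs_bound)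
    also have "\<dots> \<le> (\<integral>X. C * u\<^sup>2 \<partial>\<mu>)"
      using iF iY C(2)[of _ u] u HF(3) by (intro integral_mono) auto
    also have "\<dots> = C * u\<^sup>2" by (simp add: prob_space)
    finally show ?thesis using u by (simp add: abs_mult power2_eq_square)
  qed
  then have "\<forall>u\<in>{0<..1}. \<bar>integral\<^sup>L \<mu> F'\<bar> \<le> C * u" by auto
  then have "\<forall>\<^sub>F u in at_right 0. \<bar>integral\<^sup>L \<mu> F'\<bar> \<le> C * u"
    unfolding eventually_at_right_field by (intro exI[of _ 1]) auto
  moreover have "((\<lambda>u. C * u) \<longlongrightarrow> C * 0) (at_right 0)"
    by (intro tendsto_intros)
  ultimately have "\<bar>integral\<^sup>L \<mu> F'\<bar> \<le> C * 0"
    by (intro tendsto_lowerbound[where F = "at_right (0::real)"]) auto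
  then show ?thesis by simp
qed

lemma bounded_meas_convs:
  "bounded_meas n (\<lambda>X. conv_sum (pow_trace n X) r l)"
  "bounded_meas n (\<lambda>X. conv_dist (pow_trace n X) r l)"
  "bounded_meas n (\<lambda>X. conv_gap (pow_trace n X) l)"
proof -
  note b = bounded_meas_pow_trace bounded_meas_comp_sym[unfolded comp_sym_def] bounded_meas_elem_sym[unfolded elem_sym_def]
  show "bounded_meas n (\<lambda>X. conv_sum (pow_trace n X) r l)" "bounded_meas n (\<lambda>X. conv_dist (pow_trace n X) r l)"
    unfolding conv_sum_def conv_dist_def by (intro bounded_meas_sum bounded_meas_mult b)+
  show "bounded_meas n (\<lambda>X. conv_gap (pow_trace n X) l)"
    unfolding conv_gap_def dist_fps_def fps_mult_nth fps_nth_Abs_fps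
    by (intro bounded_meas_sum bounded_meas_mult b)
qed

text \<open>For a Haar measure and up to the sign \<open>(-1)\<^sup>r\<close>, this is the dimension
  of the invariants in the tensor product of the \<open>r\<close>-th exterior and the
  \<open>l\<close>-th symmetric power of the standard representation, which explains the integer
  values found below.\<close>

definition mixed_moment :: "nat \<Rightarrow> real mat measure \<Rightarrow> nat \<Rightarrow> nat \<Rightarrow> real" where
  "mixed_moment n \<mu> r l = (\<integral>X. elem_sym n X r * comp_sym n X l \<partial>\<mu>)"

text \<open>Half the integral of \<open>\<Sum> D (e\<^sub>r D h\<^sub>l)\<close>: the product rule
  separates it into \<open>\<Sum> D e\<^sub>r D h\<^sub>l\<close>, which gives the two convolutions,
  and \<open>e\<^sub>r\<close> times the Laplacian of \<open>h\<^sub>l\<close>.\<close>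

lemma moment_equation:
  assumes H: "is_Haar_prob_SO n \<mu>"
  shows "(\<integral>X. conv_sum (pow_trace n X) r l \<partial>\<mu>) - (\<integral>X. conv_dist (pow_trace n X) r l \<partial>\<mu>)
    + 2 * (\<integral>X. elem_sym n X r * conv_gap (pow_trace n X) l \<partial>\<mu>)
    - (2 * real n + (real n + 2) * real l + (real l)\<^sup>2) * mixed_moment n \<mu> r l = 0"
proof -
  have double_zero: "x = 0" if "0 = 2 * x" for x :: real using that by simp
  define G where "G i j X = rot_Delem n i j X r * rot_Dcomp n i j X l + elem_sym n X r * rot_DDcomp n i j X l" for i j X
  have G: "bounded_meas n (G i j) \<and> integral\<^sup>L \<mu> (G i j) = 0" if ij: "i < n" "j < n" for i j
  proof (cases "i = j")
    case True
    then have "G i j = (\<lambda>X. 0)"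
      by (auto simp: G_def rot_Delem_def rot_Dcomp_def rot_DDcomp_def rot_diag)
    then show ?thesis by auto
  next
    case False
    have "has_rot_deriv n i j (\<lambda>X. elem_sym n X r * rot_Dcomp n i j X l) (G i j)"
      unfolding G_def by (intro has_rot_deriv_mult has_rot_deriv_elem_sym has_rot_deriv_rot_Dcomp ij False)
    then show ?thesis using integral_rot_deriv[OF H ij False] by (auto simp: has_rot_deriv_def)
  qed
  have "0 = (\<integral>X. (\<Sum>i<n. \<Sum>j<n. G i j X) \<partial>\<mu>)"
    using G integrable_bounded_meas[OF H]
    by (subst Bochner_Integration.integral_sum) (auto intro!: sum.neutral simp: Bochner_Integration.integral_sum)
  also have "\<dots> = (\<integral>X. 2 * (conv_sum (pow_trace n X) r l - conv_dist (pow_trace n X) r l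
     + 2 * (elem_sym n X r * conv_gap (pow_trace n X) l)
     - (2 * n + (n + 2) * l + l\<^sup>2) * (elem_sym n X r * comp_sym n X l)) \<partial>\<mu>)"
  proof (rule integral_SO_cong[OF H])
    fix X assume X: "X \<in> SO_mats n"
    have "(\<Sum>i<n. \<Sum>j<n. G i j X) = (\<Sum>i<n. \<Sum>j<n. rot_Delem n i j X r * rot_Dcomp n i j X l)
        + elem_sym n X r * (\<Sum>i<n. \<Sum>j<n. rot_DDcomp n i j X l)"
      by (simp add: G_def sum.distrib sum_distrib_left)
    then show "(\<Sum>i<n. \<Sum>j<n. G i j X) = 2 * (conv_sum (pow_trace n X) r l - conv_dist (pow_trace n X) r l
     + 2 * (elem_sym n X r * conv_gap (pow_trace n X) l)
     - (2 * n + (n + 2) * l + l\<^sup>2) * (elem_sym n X r * comp_sym n X l))"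
      unfolding sum_rot_Delem_Dcomp[OF X] sum_rot_DDcomp[OF X] by (simp add: algebra_simps)
  qed
  also have "\<dots> = 2 * ((\<integral>X. conv_sum (pow_trace n X) r l \<partial>\<mu>) - (\<integral>X. conv_dist (pow_trace n X) r l \<partial>\<mu>)
    + 2 * (\<integral>X. elem_sym n X r * conv_gap (pow_trace n X) l \<partial>\<mu>)
    - (2 * n + (n + 2) * l + l\<^sup>2) * mixed_moment n \<mu> r l)"
    using integrable_bounded_meas[OF H bounded_meas_convs(1)[of n r l]]
      integrable_bounded_meas[OF H bounded_meas_convs(2)[of n r l]]
      integrable_bounded_meas[OF H bounded_meas_mult[OF bounded_meas_elem_sym[of n r] bounded_meas_convs(3)[of n l]]]
      integrable_bounded_meas[OF H bounded_meas_mult[OF bounded_meas_elem_sym[of n r] bounded_meas_comp_sym[of n l]]]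
    by (simp add: mixed_moment_def)
  finally have "0 = 2 * ((\<integral>X. conv_sum (pow_trace n X) r l \<partial>\<mu>) - (\<integral>X. conv_dist (pow_trace n X) r l \<partial>\<mu>)
    + 2 * (\<integral>X. elem_sym n X r * conv_gap (pow_trace n X) l \<partial>\<mu>)
    - (2 * n + (n + 2) * l + l\<^sup>2) * mixed_moment n \<mu> r l)" .
  from double_zero[OF this] show ?thesis by (simp add: algebra_simps)
qed

text \<open>Since \<open>P\<^sub>0 = n\<close> is constant on the group, the pointwise recursions
  have deterministic coefficients and survive integration.\<close>

lemma moment_recursions:
  assumes H: "is_Haar_prob_SO n \<mu>"
  defines "u \<equiv> \<lambda>r l. \<integral>X. conv_dist (pow_trace n X) r l \<partial>\<mu>"
    and "v \<equiv> \<lambda>r l. \<integral>X. conv_sum (pow_trace n X) r l \<partial>\<mu>"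
    and "g \<equiv> \<lambda>r l. \<integral>X. elem_sym n X r * conv_gap (pow_trace n X) l \<partial>\<mu>"
  shows "u 0 l = (real n + l) * mixed_moment n \<mu> 0 l" "u r 0 = (real n - r) * mixed_moment n \<mu> r 0"
    "u (Suc r) (Suc l) = u r l + (real n + l - r) * mixed_moment n \<mu> (Suc r) (Suc l)"
    "v 0 l = (real n + l) * mixed_moment n \<mu> 0 l"
    "v (Suc r) l = v r (Suc l) + (real n + l) * mixed_moment n \<mu> (Suc r) l - (real n - r) * mixed_moment n \<mu> r (Suc l)"
    "g r 0 = real n * mixed_moment n \<mu> r 0" "g r (Suc 0) = (real n + 2) * mixed_moment n \<mu> r (Suc 0)"
    "g r (Suc (Suc l)) = g r l + (real n + 2 * Suc (Suc l)) * mixed_moment n \<mu> r (Suc (Suc l))"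
    "(\<Sum>j\<le>k. mixed_moment n \<mu> j (k - j)) = (if k = 0 then 1 else 0)"
proof -
  interpret prob_space \<mu> by (rule haar_facts[OF H])
  note b = integrable_bounded_meas[OF H bounded_meas_convs(1)] integrable_bounded_meas[OF H bounded_meas_convs(2)]
    integrable_bounded_meas[OF H bounded_meas_mult[OF bounded_meas_elem_sym bounded_meas_convs(3)]]
    integrable_bounded_meas[OF H bounded_meas_mult[OF bounded_meas_elem_sym bounded_meas_comp_sym]]
  have e0: "elem_sym n X 0 = 1" "comp_sym n X 0 = 1" for X by (simp_all add: elem_sym_def comp_sym_def)
  note d = elem_sym_def[symmetric] comp_sym_def[symmetric]
  show "u 0 l = (real n + l) * mixed_moment n \<mu> 0 l" "v 0 l = (real n + l) * mixed_moment n \<mu> 0 l"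
    unfolding u_def v_def mixed_moment_def integral_mult_right_zero[symmetric]
    by (intro integral_SO_cong[OF H], simp add: conv_dist_0_left conv_sum_0_left pow_trace_0 e0 d)+
  show "u r 0 = (real n - r) * mixed_moment n \<mu> r 0"
    unfolding u_def mixed_moment_def integral_mult_right_zero[symmetric]
    by (intro integral_SO_cong[OF H], simp add: conv_dist_0_right pow_trace_0 e0 d)
  have "u (Suc r) (Suc l) = (\<integral>X. conv_dist (pow_trace n X) r l + (real n + l - r) * (elem_sym n X (Suc r) * comp_sym n X (Suc l)) \<partial>\<mu>)"
    unfolding u_def by (intro integral_SO_cong[OF H]) (simp add: conv_dist_Suc_Suc pow_trace_0 d mult.assoc)
  then show "u (Suc r) (Suc l) = u r l + (real n + l - r) * mixed_moment n \<mu> (Suc r) (Suc l)"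
    using b by (simp add: u_def mixed_moment_def)
  have "v (Suc r) l = (\<integral>X. conv_sum (pow_trace n X) r (Suc l) + (real n + l) * (elem_sym n X (Suc r) * comp_sym n X l)
      - (real n - r) * (elem_sym n X r * comp_sym n X (Suc l)) \<partial>\<mu>)"
    unfolding v_def by (intro integral_SO_cong[OF H]) (simp add: conv_sum_Suc_left pow_trace_0 d mult.assoc)
  then show "v (Suc r) l = v r (Suc l) + (real n + l) * mixed_moment n \<mu> (Suc r) l - (real n - r) * mixed_moment n \<mu> r (Suc l)"
    using b by (simp add: v_def mixed_moment_def)
  show "g r 0 = real n * mixed_moment n \<mu> r 0" "g r (Suc 0) = (real n + 2) * mixed_moment n \<mu> r (Suc 0)"
    unfolding g_def mixed_moment_def integral_mult_right_zero[symmetric]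
    by (intro integral_SO_cong[OF H], simp add: conv_gap_rec pow_trace_0 e0 d del: newton.simps)+
  have "g r (Suc (Suc l)) = (\<integral>X. elem_sym n X r * conv_gap (pow_trace n X) l +
      (real n + 2 * Suc (Suc l)) * (elem_sym n X r * comp_sym n X (Suc (Suc l))) \<partial>\<mu>)"
    unfolding g_def by (intro integral_SO_cong[OF H])
      (simp add: conv_gap_rec pow_trace_0 d algebra_simps del: newton.simps)
  then show "g r (Suc (Suc l)) = g r l + (real n + 2 * Suc (Suc l)) * mixed_moment n \<mu> r (Suc (Suc l))"
    using b by (simp add: g_def mixed_moment_def)
  have "(\<Sum>j\<le>k. mixed_moment n \<mu> j (k - j)) = (\<integral>X. (\<Sum>j\<le>k. elem_sym n X j * comp_sym n X (k - j)) \<partial>\<mu>)"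
    unfolding mixed_moment_def using b by (subst Bochner_Integration.integral_sum) auto
  also have "\<dots> = (if k = 0 then 1 else 0)"
    unfolding elem_sym_def comp_sym_def newton_koszul by (simp add: prob_space)
  finally show "(\<Sum>j\<le>k. mixed_moment n \<mu> j (k - j)) = (if k = 0 then 1 else 0)" .
qed

text \<open>Induction on \<open>r\<close> and, inside, on \<open>l\<close> in steps of two, because
  \<open>g\<close> links \<open>l\<close> to \<open>l + 2\<close>. The start at \<open>l = 0\<close>
  comes from \<open>kos\<close>. For \<open>l \<ge> 1\<close> the unknown \<open>c r l\<close> has,
  up to sign, the coefficient \<open>r - l * (n + l - 2)\<close>; for \<open>l \<ge> 2\<close> and
  \<open>r < n\<close> it is nonzero, so \<open>l = 1\<close> is the critical case.\<close>

lemma moment_recursion_solution: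
  fixes c u v g :: "nat \<Rightarrow> nat \<Rightarrow> real" and n :: nat
  assumes eq: "\<And>r l. v r l - u r l + 2 * g r l - (2 * real n + (real n + 2) * real l + (real l)\<^sup>2) * c r l = 0"
    and u: "\<And>l. u 0 l = (real n + l) * c 0 l" "\<And>r. u r 0 = (real n - r) * c r 0"
      "\<And>r l. u (Suc r) (Suc l) = u r l + (real n + l - r) * c (Suc r) (Suc l)"
    and v: "\<And>l. v 0 l = (real n + l) * c 0 l"
      "\<And>r l. v (Suc r) l = v r (Suc l) + (real n + l) * c (Suc r) l - (real n - r) * c r (Suc l)"
    and g: "\<And>r. g r 0 = real n * c r 0" "\<And>r. g r (Suc 0) = (real n + 2) * c r (Suc 0)"
      "\<And>r l. g r (Suc (Suc l)) = g r l + (real n + 2 * Suc (Suc l)) * c r (Suc (Suc l))"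
    and kos: "\<And>k. (\<Sum>j\<le>k. c j (k - j)) = (if k = 0 then 1 else 0)"
    and n: "n \<ge> 3"
  shows "c 0 l = (if even l then 1 else 0)" "c 1 l = (if even l then 0 else -1)"
    "2 \<le> r \<Longrightarrow> r + 2 \<le> n \<Longrightarrow> c r l = 0"
proof -
  have n': "real n \<ge> 3" using n by simp
  have c00: "c 0 0 = 1" using kos[of 0] by simp
  have two_step: "Q l" if "Q 0" "Q (Suc 0)" "\<And>l. Q l \<Longrightarrow> Q (Suc (Suc l))" for Q and l :: nat
    by (induction l rule: induct_nat_012) (use that in auto)
  \<comment> \<open>\<open>g\<close> is carried along because the equation at \<open>l + 2\<close>
    sees the earlier values only through \<open>g 0 l\<close>.\<close>
  have A: "c 0 l = (if even l then 1 else 0) \<and> g 0 l = (if even l then (real l / 2 + 1) * (real n + l) else 0)" for l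
  proof (induction l rule: two_step)
    case 1 then show ?case using c00 g by simp
  next
    case 2
    have "(1 - real n) * c 0 (Suc 0) = 0"
      using eq[of 0 "Suc 0"] u(1)[of "Suc 0"] v(1)[of "Suc 0"] g(2)[of 0] by (simp add: algebra_simps)
    then have "c 0 (Suc 0) = 0" using n' by simp
    then show ?case using g(2)[of 0] by simp
  next
    case (3 l)
    have *: "(real l + 2) * (real n + l) * c 0 (Suc (Suc l)) = 2 * g 0 l"
      using eq[of 0 "Suc (Suc l)"] u(1)[of "Suc (Suc l)"] v(1)[of "Suc (Suc l)"] g(3)[of 0 l]
      by (simp add: algebra_simps power2_eq_square)
    have nz: "(real l + 2) * (real n + l) > 0" using n' by (intro mult_pos_pos) linarith+
    show ?case
    proof (cases "even l")
      case True
      then have "(real l + 2) * (real n + l) * c 0 (Suc (Suc l)) = (real l + 2) * (real n + l) * 1"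
        using * 3 by (simp add: field_simps)
      then have "c 0 (Suc (Suc l)) = 1" using nz n' by (subst (asm) mult_cancel_left) auto
      then show ?thesis using True 3 g(3)[of 0 l] by (simp add: field_simps)
    next
      case False
      then show ?thesis using * 3 g(3)[of 0 l] nz by auto
    qed
  qed
  then have c0: "c 0 l = (if even l then 1 else 0)" for l by blast
  have v1: "v 1 l = (real l + 1) * c 0 (Suc l) + (real n + l) * c 1 l" for l
    using v(2)[of 0 l] v(1)[of "Suc l"] by (simp add: algebra_simps)
  have u1: "u 1 (Suc l) = (real n + l) * (c 0 l + c 1 (Suc l))" for l
    using u(3)[of 0 l] u(1)[of l] by (simp add: algebra_simps)
  have B: "c 1 l = (if even l then 0 else -1) \<and> g 1 l = (if even l then 0 else - ((real l + 1) / 2) * (real n + l + 1))" for l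
  proof (induction l rule: two_step)
    case 1 then show ?case using kos[of 1] c0[of 1] g(1)[of 1] by simp
  next
    case 2
    have "(2 - real n) * c 1 (Suc 0) = (2 - real n) * -1"
      using eq[of 1 "Suc 0"] u1[of 0] v1[of "Suc 0"] g(2)[of 1] c0[of 0] c0[of 2]
      by (simp add: algebra_simps numeral_2_eq_2)
    then have "c 1 (Suc 0) = -1" using n' by (subst (asm) mult_cancel_left) simp
    then show ?case using g(2)[of 1] by simp
  next
    case (3 l)
    have *: "((real l + 2) * (real n + l) - 1) * c 1 (Suc (Suc l)) = 2 * g 1 l + (if even l then 0 else 2 - real n)"
      using eq[of 1 "Suc (Suc l)"] u1[of "Suc l"] v1[of "Suc (Suc l)"] g(3)[of 1 l] c0[of "Suc l"] c0[of "Suc (Suc (Suc l))"]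
      by (simp add: algebra_simps power2_eq_square split: if_splits)
    have "2 * 3 \<le> (real l + 2) * (real n + l)" using n' by (intro mult_mono) linarith+
    then have nz: "(real l + 2) * (real n + l) - 1 > 0" by linarith
    show ?case
    proof (cases "even l")
      case False
      then have "((real l + 2) * (real n + l) - 1) * c 1 (Suc (Suc l)) = ((real l + 2) * (real n + l) - 1) * -1"
        using * 3 by (simp add: field_simps)
      then have "c 1 (Suc (Suc l)) = -1" using nz n' by (subst (asm) mult_cancel_left) auto
      then show ?thesis using False 3 g(3)[of 1 l] by (simp add: field_simps)
    next
      case True
      then show ?thesis using * 3 g(3)[of 1 l] nz by auto
    qed
  qed
  then have c1: "c 1 l = (if even l then 0 else -1)" for l by blast
  \<comment> \<open>The last two clauses say that nothing is carried over from \<open>r\<close> to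
    \<open>Suc r\<close>: the equation for \<open>Suc r\<close> then involves
    \<open>c (Suc r)\<close> alone. They hold at \<open>r = 1\<close> although \<open>c 1\<close> is
    not zero, because \<open>c 0 l + c 1 (Suc l) = 0\<close>.\<close>
  have "(\<forall>j\<in>{2..r}. \<forall>l. c j l = 0) \<and> (\<forall>l. u r l = 0) \<and> (\<forall>l. v r (Suc l) = (real n - r) * c r (Suc l))"
    if "1 \<le> r" "r + 2 \<le> n" for r
    using that
  proof (induction r rule: dec_induct)
    case base
    have "u 1 l = 0" for l
      using u(2)[of 1] u1 c0 c1 by (cases l) auto
    moreover have "v 1 (Suc l) = (real n - 1) * c 1 (Suc l)" for l
      using v1[of "Suc l"] c0 c1 by (auto simp: algebra_simps)
    ultimately show ?case by simp
  next
    case (step r)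
    then have IH: "\<And>j l. j \<in> {2..r} \<Longrightarrow> c j l = 0" "\<And>l. u r l = 0" "\<And>l. v r (Suc l) = (real n - r) * c r (Suc l)"
      and r: "r \<ge> 1" "r + 3 \<le> n" by auto
    have r': "real r + 3 \<le> real n" using r(2) by linarith
    \<comment> \<open>The terms \<open>j = 0\<close> and \<open>j = 1\<close> cancel by parity and
      those up to \<open>r\<close> vanish by induction, so only the starting value
      \<open>c (Suc r) 0\<close> is left.\<close>
    have "(\<Sum>j\<le>Suc r. c j (Suc r - j)) = 0" using kos[of "Suc r"] by simp
    moreover have "(\<Sum>j\<le>Suc r. c j (Suc r - j)) = c 0 (Suc r) + (c 1 r + (\<Sum>j\<in>{2..r}. c j (Suc r - j))) + c (Suc r) 0"
      using r by (simp add: atMost_atLeast0 sum.atLeast_Suc_atMost numeral_2_eq_2)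
    moreover have "(\<Sum>j\<in>{2..r}. c j (Suc r - j)) = 0" using IH by (intro sum.neutral) auto
    ultimately have z0: "c (Suc r) 0 = 0" using c0 c1 by (auto split: if_splits)
    have v': "v (Suc r) l = (real n + l) * c (Suc r) l" for l
      using v(2)[of r l] IH(3)[of l] by simp
    have u': "u (Suc r) l = (real n + l - Suc r) * c (Suc r) l" for l
      using u(2)[of "Suc r"] u(3)[of r] IH(2) by (cases l) (auto simp: algebra_simps)
    have "c (Suc r) l = 0 \<and> g (Suc r) l = 0" for l
    proof (induction l rule: two_step)
      case 1 then show ?case using z0 g(1) by simp
    next
      case 2
      \<comment> \<open>The coefficient would be 0 at \<open>Suc r = n - 1\<close>; this is what
        stops the vanishing result at \<open>n - 2\<close>.\<close>
      have "(real r + 2 - n) * c (Suc r) (Suc 0) = 0"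
        using eq[of "Suc r" "Suc 0"] u'[of "Suc 0"] v'[of "Suc 0"] g(2)[of "Suc r"]
        by (simp add: algebra_simps)
      then have "c (Suc r) (Suc 0) = 0" using r' by simp
      then show ?case using g(2) by simp
    next
      case (3 l)
      have "(real r + 1 - (real l + 2) * (real n + l)) * c (Suc r) (Suc (Suc l)) = 0"
        using eq[of "Suc r" "Suc (Suc l)"] u'[of "Suc (Suc l)"] v'[of "Suc (Suc l)"] g(3)[of "Suc r" l] 3
        by (simp add: algebra_simps power2_eq_square)
      moreover have "1 * real n \<le> (real l + 2) * (real n + l)" by (intro mult_mono) auto
      then have "real r + 1 - (real l + 2) * (real n + l) \<noteq> 0" using r' by linarith
      ultimately have "c (Suc r) (Suc (Suc l)) = 0" by simp
      then show ?case using g(3) 3 by simp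
    qed
    then have z: "c (Suc r) l = 0" for l by blast
    then have "c j l = 0" if "j \<in> {2..Suc r}" for j l
      using IH(1) that by (cases "j = Suc r") auto
    then show ?case using u' v' z by simp
  qed
  then show "c r l = 0" if "2 \<le> r" "r + 2 \<le> n" using that by (meson atLeastAtMost_iff le_trans one_le_numeral order_refl)
  show "c 0 l = (if even l then 1 else 0)" "c 1 l = (if even l then 0 else -1)" by (rule c0 c1)+
qed

lemma mixed_moment_values:
  assumes H: "is_Haar_prob_SO n \<mu>" and n: "n \<ge> 3"
  shows "mixed_moment n \<mu> 0 l = (if even l then 1 else 0)" "mixed_moment n \<mu> 1 l = (if even l then 0 else -1)"
    "2 \<le> r \<Longrightarrow> r + 2 \<le> n \<Longrightarrow> mixed_moment n \<mu> r l = 0"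
proof -
  note sol = moment_recursion_solution[where v = "\<lambda>r l. \<integral>X. conv_sum (pow_trace n X) r l \<partial>\<mu>"
     and u = "\<lambda>r l. \<integral>X. conv_dist (pow_trace n X) r l \<partial>\<mu>"
     and g = "\<lambda>r l. \<integral>X. elem_sym n X r * conv_gap (pow_trace n X) l \<partial>\<mu>" and n = n and c = "mixed_moment n \<mu>"]
  show "mixed_moment n \<mu> 0 l = (if even l then 1 else 0)"
    by (rule sol(1)) (rule moment_equation[OF H] moment_recursions[OF H] n)+
  show "mixed_moment n \<mu> 1 l = (if even l then 0 else -1)"
    by (rule sol(2)) (rule moment_equation[OF H] moment_recursions[OF H] n)+
  show "mixed_moment n \<mu> r l = 0" if "2 \<le> r" "r + 2 \<le> n"
    by (rule sol(3)) (rule moment_equation[OF H] moment_recursions[OF H] n that)+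
qed

section \<open>The spectrum of a special orthogonal matrix\<close>

lemma newton_of_real: "newton (\<lambda>k. of_real (p k) :: complex) l = of_real (newton p l)"
proof (induction l rule: less_induct)
  case (less l)
  then show ?case by (cases l) simp_all
qed

definition mat_trace :: "'a::comm_ring_1 mat \<Rightarrow> 'a" where
  "mat_trace A = (\<Sum>i<dim_row A. A $$ (i, i))"

lemma mat_trace_mult_commute:
  assumes "A \<in> carrier_mat n n" "B \<in> carrier_mat n n"
  shows "mat_trace (A * B) = mat_trace (B * A)"
proof -
  have e: "(A * B) $$ (i, i) = (\<Sum>k<n. A $$ (i, k) * B $$ (k, i))"
    "(B * A) $$ (i, i) = (\<Sum>k<n. B $$ (i, k) * A $$ (k, i))" if "i < n" for i
    using assms that by (auto simp: scalar_prod_def lessThan_atLeast0 intro!: sum.cong)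
  have "mat_trace (A * B) = (\<Sum>i<n. \<Sum>k<n. A $$ (i, k) * B $$ (k, i))"
    unfolding mat_trace_def using assms e by auto
  also have "\<dots> = (\<Sum>k<n. \<Sum>i<n. B $$ (k, i) * A $$ (i, k))"
    by (subst sum.swap) (simp add: mult.commute)
  also have "\<dots> = mat_trace (B * A)"
    unfolding mat_trace_def using assms e by auto
  finally show ?thesis .
qed

lemma upper_triangular_pow:
  fixes B :: "'a::comm_ring_1 mat"
  assumes B: "B \<in> carrier_mat n n" "upper_triangular B" and i: "i < n"
  shows "(B ^\<^sub>m k) $$ (i, i) = (B $$ (i, i)) ^ k \<and> (\<forall>j<i. (B ^\<^sub>m k) $$ (i, j) = 0)"
proof (induction k)
  case 0
  then show ?case using B i by auto
next
  case (Suc k)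
  have e: "(B ^\<^sub>m Suc k) $$ (i, j) = (\<Sum>r<n. (B ^\<^sub>m k) $$ (i, r) * B $$ (r, j))" if "j < n" for j
    using B i that by (auto simp: scalar_prod_def lessThan_atLeast0 intro!: sum.cong)
  have z: "(B ^\<^sub>m k) $$ (i, r) * B $$ (r, j) = 0" if "r < n" "j \<le> i" "r \<noteq> i \<or> j < i" for r j
  proof (cases "r < i")
    case True then show ?thesis using Suc by simp
  next
    case False
    then have "j < r" using that by auto
    then show ?thesis using upper_triangularD[OF B(2), of j r] B(1) that by simp
  qed
  have "(B ^\<^sub>m Suc k) $$ (i, i) = (\<Sum>r<n. if r = i then (B ^\<^sub>m k) $$ (i, i) * B $$ (i, i) else 0)"
    unfolding e[OF i] by (intro sum.cong refl) (use z in auto)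
  also have "\<dots> = (B $$ (i, i)) ^ Suc k" using Suc i by (simp add: mult.commute)
  finally show ?case using e z i by auto
qed

text \<open>Schur triangularisation over the complex numbers: the diagonal of \<open>B\<close> gives
  the traces of powers and, as the adjoint of a real matrix is its transpose, also
  \<open>Lambda_char\<close>. Unimodularity follows from norm preservation on an
  eigenvector.\<close>

lemma SO_spectrum:
  assumes X: "X \<in> SO_mats n"
  obtains es :: "complex list" where
    "length es = n" "\<And>k. complex_of_real (pow_trace n X k) = (\<Sum>e\<leftarrow>es. e ^ k)"
    "\<And>z. Lambda_char X z = (\<Prod>e\<leftarrow>es. 1 - z * e)" "\<And>e. e \<in> set es \<Longrightarrow> cmod e = 1" "prod_list es = 1"
proof -
  note CX = SO_matsD(1)[OF X]
  define A where "A = map_mat complex_of_real X"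
  have A: "A \<in> carrier_mat n n" using CX by (simp add: A_def)
  obtain as where "char_poly A = (\<Prod>a\<leftarrow>as. [:- a, 1:])"
    using char_poly_factorized[OF A] by blast
  then obtain B where B: "B \<in> carrier_mat n n" "upper_triangular B" "similar_mat A B"
    using schur_decomposition_exists[OF A] by blast
  obtain m P Q where w: "{A, B, P, Q} \<subseteq> carrier_mat m m" "P * Q = 1\<^sub>m m" "Q * P = 1\<^sub>m m" "A = P * B * Q"
    using similar_matD[OF B(3)] by blast
  have "m = n" using w(1) A by auto
  note w = w[unfolded this]
  then have PQ: "P \<in> carrier_mat n n" "Q \<in> carrier_mat n n" by auto
  define es where "es = diag_mat B"
  have len: "length es = n" using B(1) by (simp add: es_def diag_mat_def)
  have es_nth: "es = map (\<lambda>i. B $$ (i, i)) [0..<n]" using B(1) by (simp add: es_def diag_mat_def)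
  have sum_es: "(\<Sum>e\<leftarrow>es. f e) = (\<Sum>i<n. f (B $$ (i, i)))" for f :: "complex \<Rightarrow> complex"
    unfolding es_nth by (simp add: interv_sum_list_conv_sum_set_nat lessThan_atLeast0 comp_def)
  have tr: "complex_of_real (pow_trace n X k) = (\<Sum>e\<leftarrow>es. e ^ k)" for k
  proof -
    have "complex_of_real (pow_trace n X k) = mat_trace (A ^\<^sub>m k)"
    proof -
      have "A ^\<^sub>m k = map_mat complex_of_real (X ^\<^sub>m k)"
        unfolding A_def by (rule of_real_hom.mat_hom_pow[OF CX, symmetric])
      then show ?thesis using CX by (simp add: mat_trace_def pow_trace_def)
    qed
    also have "A ^\<^sub>m k = P * (B ^\<^sub>m k * Q)"
    proof -
      have "similar_mat_wit A B P Q" using w by (intro similar_mat_witI[of _ _ n]) auto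
      then have "A ^\<^sub>m k = P * B ^\<^sub>m k * Q" by (rule similar_mat_wit_pow_id)
      also have "\<dots> = P * (B ^\<^sub>m k * Q)" by (rule assoc_mult_mat[of _ n n _ n _ n]) (use PQ B(1) in auto)
      finally show ?thesis .
    qed
    also have "mat_trace (P * (B ^\<^sub>m k * Q)) = mat_trace (B ^\<^sub>m k * Q * P)"
      using PQ B(1) by (intro mat_trace_mult_commute) auto
    also have "B ^\<^sub>m k * Q * P = B ^\<^sub>m k"
      using w(3) PQ B(1) by (simp add: assoc_mult_mat[of _ n n _ n _ n])
    also have "mat_trace (B ^\<^sub>m k) = (\<Sum>e\<leftarrow>es. e ^ k)"
      using upper_triangular_pow[OF B(1,2)] B(1) by (simp add: mat_trace_def sum_es)
    finally show ?thesis .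
  qed
  have ch: "Lambda_char X z = (\<Prod>e\<leftarrow>es. 1 - z * e)" for z
  proof -
    have adj: "mat_adjoint A = transpose_mat A"
    proof (rule eq_matI)
      fix i j assume "i < dim_row (transpose_mat A)" "j < dim_col (transpose_mat A)"
      then show "mat_adjoint A $$ (i, j) = transpose_mat A $$ (i, j)"
        using CX by (simp add: mat_adjoint_def A_def mat_of_rows_def)
    qed (use A in \<open>auto simp: mat_adjoint_def\<close>)
    have "Lambda_char X z = Determinant.det (1\<^sub>m n - z \<cdot>\<^sub>m transpose_mat A)"
      using CX by (simp add: Lambda_char_def adj flip: A_def)
    also have "1\<^sub>m n - z \<cdot>\<^sub>m transpose_mat A = transpose_mat (1\<^sub>m n - z \<cdot>\<^sub>m A)"
      by (rule eq_matI) (use A in auto)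
    also have "Determinant.det \<dots> = Determinant.det (1\<^sub>m n - z \<cdot>\<^sub>m A)"
      by (rule det_transpose[of _ n]) (use A in auto)
    also have "\<dots> = Determinant.det (1\<^sub>m n - z \<cdot>\<^sub>m B)"
    proof (rule det_similar, rule similar_matI[of _ _ P Q n])
      have "P * (1\<^sub>m n - z \<cdot>\<^sub>m B) * Q = (P - z \<cdot>\<^sub>m (P * B)) * Q"
        using PQ B(1) by (subst mult_minus_distrib_mat[of _ n n _ n]) (auto simp: mult_smult_distrib[of _ n n _ n])
      also have "\<dots> = P * Q - z \<cdot>\<^sub>m (P * B * Q)"
        using PQ B(1) by (subst minus_mult_distrib_mat[of _ n n _ _ n]) (auto simp: mult_smult_assoc_mat[of _ n n _ n])
      finally show "1\<^sub>m n - z \<cdot>\<^sub>m A = P * (1\<^sub>m n - z \<cdot>\<^sub>m B) * Q" using w by simp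
    qed (use w(2,3) PQ A B(1) in auto)
    also have "\<dots> = prod_list (diag_mat (1\<^sub>m n - z \<cdot>\<^sub>m B))"
      using B by (intro det_upper_triangular[of _ n]) (auto simp: upper_triangular_def)
    also have "diag_mat (1\<^sub>m n - z \<cdot>\<^sub>m B) = map (\<lambda>e. 1 - z * e) es"
      using B(1) by (simp add: es_nth diag_mat_def)
    finally show ?thesis .
  qed
  have "prod_list es = Determinant.det B" unfolding es_def using det_upper_triangular[OF B(2,1)] by simp
  also have "\<dots> = Determinant.det A" using det_similar[OF B(3)] by simp
  also have "\<dots> = 1" using SO_matsD(4)[OF X] unfolding A_def by (simp add: of_real_hom.hom_det)
  finally have pr: "prod_list es = 1" .
  have "cmod e = 1" if e: "e \<in> set es" for e
  proof -
    have "char_poly A = (\<Prod>a\<leftarrow>es. [:- a, 1:])"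
      using char_poly_similar[OF B(3)] char_poly_upper_triangular[OF B(1,2)] by (simp add: es_def)
    then have "poly (char_poly A) e = 0"
      using e by (simp add: poly_prod_list prod_list_zero_iff image_iff)
    then have "eigenvalue A e" by (simp add: eigenvalue_root_char_poly[OF A])
    then obtain v where v: "v \<in> carrier_vec n" "v \<noteq> 0\<^sub>v n" "A *\<^sub>v v = e \<cdot>\<^sub>v v"
      unfolding eigenvalue_def eigenvector_def using A by auto
    let ?w = "\<lambda>i. vec_index v i"
    have Av: "(\<Sum>j<n. A $$ (i, j) * ?w j) = e * ?w i" if "i < n" for i
    proof -
      have "vec_index (A *\<^sub>v v) i = vec_index (e \<cdot>\<^sub>v v) i" using v by simp
      then show ?thesis using A v(1) that by (simp add: scalar_prod_def lessThan_atLeast0)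
    qed
    have orth: "(\<Sum>i<n. A $$ (i, j) * A $$ (i, k)) = (if j = k then 1 else 0)" if "j < n" "k < n" for j k
    proof -
      have "(transpose_mat X * X) $$ (j, k) = (if j = k then 1 else 0)"
        using SO_matsD(3)[OF X] that by simp
      moreover have "(transpose_mat X * X) $$ (j, k) = (\<Sum>i<n. X $$ (i, j) * X $$ (i, k))"
        using CX that by (auto simp: scalar_prod_def lessThan_atLeast0 intro!: sum.cong)
      ultimately have "complex_of_real (\<Sum>i<n. X $$ (i, j) * X $$ (i, k)) = (if j = k then 1 else 0)" by simp
      then show ?thesis using CX that by (simp add: A_def)
    qed
    have cn: "cnj (A $$ (i, j)) = A $$ (i, j)" if "i < n" "j < n" for i j
      using CX that by (simp add: A_def)
    \<comment> \<open>The squared norm of \<open>A v\<close> computed twice: from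
      \<open>A v = e v\<close>, and from orthogonality of the columns of \<open>A\<close>, whose
      entries are real.\<close>
    have "e * cnj e * (\<Sum>i<n. ?w i * cnj (?w i)) = (\<Sum>i<n. (e * ?w i) * cnj (e * ?w i))"
      by (simp add: sum_distrib_left algebra_simps)
    also have "\<dots> = (\<Sum>i<n. (\<Sum>j<n. A $$ (i, j) * ?w j) * (\<Sum>k<n. A $$ (i, k) * cnj (?w k)))"
      by (intro sum.cong refl) (auto simp: Av[symmetric] cn intro!: sum.cong)
    also have "\<dots> = (\<Sum>i<n. \<Sum>j<n. \<Sum>k<n. A $$ (i, j) * A $$ (i, k) * (?w j * cnj (?w k)))"
      by (simp add: sum_product mult_ac)
    also have "\<dots> = (\<Sum>j<n. \<Sum>k<n. (\<Sum>i<n. A $$ (i, j) * A $$ (i, k)) * (?w j * cnj (?w k)))"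
      unfolding sum_distrib_right by (subst sum.swap, rule sum.cong[OF refl], rule sum.swap)
    also have "\<dots> = (\<Sum>j<n. ?w j * cnj (?w j))"
      by (simp add: orth if_distrib[of "\<lambda>x. x * _"] cong: if_cong)
    finally have eq: "e * cnj e * (\<Sum>i<n. ?w i * cnj (?w i)) = (\<Sum>i<n. ?w i * cnj (?w i))" .
    have "(\<Sum>i<n. ?w i * cnj (?w i)) = of_real (\<Sum>i<n. (cmod (?w i))\<^sup>2)"
      by (simp add: complex_norm_square del: of_real_power)
    moreover have "(\<Sum>i<n. (cmod (?w i))\<^sup>2) \<noteq> 0"
    proof
      assume "(\<Sum>i<n. (cmod (?w i))\<^sup>2) = 0"
      then have "\<forall>i<n. ?w i = 0" by (subst (asm) sum_nonneg_eq_0_iff) auto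
      then have "v = 0\<^sub>v n" using v(1) by (intro eq_vecI) auto
      then show False using v(2) by simp
    qed
    ultimately have "(\<Sum>i<n. ?w i * cnj (?w i)) \<noteq> 0" by (simp only: of_real_eq_0_iff not_False_eq_True)
    then have "e * cnj e = 1" using eq by (simp only: mult_cancel_right1 mult_cancel_right2) simp
    then have "(cmod e)\<^sup>2 = 1" by (metis complex_norm_square of_real_eq_1_iff)
    then show ?thesis using power2_eq_iff_nonneg[of "cmod e" 1] by simp
  qed
  then show thesis using that[OF len tr ch] pr by blast
qed

text \<open>For \<open>F = \<Prod> (1 - e z)\<close>, the logarithmic derivative turns each factor
  into a geometric series, so \<open>S F = n F - z F'\<close> with \<open>n\<close> factors.
  Coefficientwise this is Newton's recursion for the negated power sums.\<close>

lemma coeff_prod_list_newton: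
  fixes es :: "complex list"
  shows "coeff (\<Prod>e\<leftarrow>es. [:1, - e:]) l = newton (\<lambda>k. - (\<Sum>e\<leftarrow>es. e ^ k)) l"
proof -
  define F where "F es = fps_of_poly (\<Prod>e\<leftarrow>es. [:1, - e:])" for es :: "complex list"
  define S where "S es = Abs_fps (\<lambda>k. \<Sum>e\<leftarrow>es. e ^ k)" for es :: "complex list"
  have lin: "fps_of_poly [:1, - e:] = 1 - fps_const e * fps_X" for e :: complex
    by (rule fps_ext) (simp add: coeff_pCons fps_of_poly_nth split: nat.splits)
  have SF: "S es * F es = fps_const (of_nat (length es)) * F es - fps_X * fps_deriv (F es)" for es
  proof (induction es)
    case Nil
    have "S [] = 0" by (rule fps_ext) (simp add: S_def)
    then show ?case by (simp add: F_def)
  next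
    case (Cons e es)
    define G where "G = Abs_fps (\<lambda>k. e ^ k)"
    have G: "G * (1 - fps_const e * fps_X) = 1"
    proof -
      have "G * (1 - fps_const e * fps_X) = G - fps_const e * (fps_X * G)"
        by (simp add: algebra_simps)
      also have "\<dots> = 1"
      proof (rule fps_ext)
        fix k show "fps_nth (G - fps_const e * (fps_X * G)) k = fps_nth 1 k"
          by (cases k) (simp_all add: G_def)
      qed
      finally show ?thesis .
    qed
    have S: "S (e # es) = G + S es" by (rule fps_ext) (simp add: S_def G_def)
    have F: "F (e # es) = (1 - fps_const e * fps_X) * F es" by (simp add: F_def fps_of_poly_mult lin)
    have "S (e # es) * F (e # es) = G * (1 - fps_const e * fps_X) * F es + (1 - fps_const e * fps_X) * (S es * F es)"
      unfolding S F by (simp add: algebra_simps)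
    also have "\<dots> = F es + (1 - fps_const e * fps_X) * (fps_const (of_nat (length es)) * F es - fps_X * fps_deriv (F es))"
      unfolding G Cons by simp
    also have "\<dots> = fps_const (of_nat (length (e # es))) * F (e # es) - fps_X * fps_deriv (F (e # es))"
      unfolding F by (simp add: algebra_simps flip: fps_const_add)
    finally show ?case .
  qed
  show ?thesis
  proof (rule newton_unique)
    have "coeff (\<Prod>e\<leftarrow>es. [:1, - e:]) 0 = poly (\<Prod>e\<leftarrow>es. [:1, - e:]) 0" by (simp add: poly_0_coeff_0)
    also have "\<dots> = 1" by (induction es) simp_all
    finally show "coeff (\<Prod>e\<leftarrow>es. [:1, - e:]) 0 = 1" .
    fix l
    have "fps_nth (S es * F es) l = of_nat (length es) * fps_nth (F es) l - fps_nth (fps_X * fps_deriv (F es)) l"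
      unfolding SF by simp
    moreover have "fps_nth (fps_X * fps_deriv (F es)) l = of_nat l * fps_nth (F es) l" by (cases l) simp_all
    moreover have "fps_nth (S es * F es) l = (\<Sum>k\<le>l. (\<Sum>e\<leftarrow>es. e ^ k) * coeff (\<Prod>e\<leftarrow>es. [:1, - e:]) (l - k))"
      by (simp add: S_def F_def fps_mult_nth atLeast0AtMost)
    ultimately show "(\<Sum>k\<le>l. - (\<Sum>e\<leftarrow>es. e ^ k) * coeff (\<Prod>e\<leftarrow>es. [:1, - e:]) (l - k)) =
      (- (\<Sum>e\<leftarrow>es. e ^ 0) + of_nat l) * coeff (\<Prod>e\<leftarrow>es. [:1, - e:]) l"
      by (simp add: F_def sum_negf sum_list_triv algebra_simps)
  qed
qed

context
  fixes n :: nat and X :: "real mat" and es :: "complex list"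
  assumes X: "X \<in> SO_mats n"
    and es: "length es = n" "\<And>k. complex_of_real (pow_trace n X k) = (\<Sum>e\<leftarrow>es. e ^ k)"
      "\<And>e. e \<in> set es \<Longrightarrow> cmod e = 1" "prod_list es = 1"
begin

lemma coeff_es: "coeff (\<Prod>e\<leftarrow>es. [:1, - e:]) r = of_real (elem_sym n X r)"
  unfolding coeff_prod_list_newton elem_sym_def newton_of_real[symmetric] using es(2) by simp

lemma elem_sym_eq_0: "r > n \<Longrightarrow> elem_sym n X r = 0"
proof -
  assume "r > n"
  have "degree (\<Prod>e\<leftarrow>es. [:1, - e:]) \<le> length es"
  proof (induction es)
    case (Cons e es)
    have "degree ([:1, - e:] * (\<Prod>e\<leftarrow>es. [:1, - e:])) \<le> degree [:1, - e:] + degree (\<Prod>e\<leftarrow>es. [:1, - e:])"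
      by (rule degree_mult_le)
    then show ?case using Cons by (auto split: if_splits)
  qed simp
  then have "coeff (\<Prod>e\<leftarrow>es. [:1, - e:]) r = 0" using \<open>r > n\<close> es(1) by (intro coeff_eq_0) simp
  then show ?thesis using coeff_es[of r] by simp
qed

text \<open>For unimodular \<open>e\<close>, \<open>x - e = - e (1 - cnj e * x)\<close>. So the
  reversed polynomial has the conjugate coefficients times \<open>(-1)\<^sup>n\<close> and the
  determinant, which is the sign \<open>- 1\<close> here; the coefficients themselves are
  real.\<close>

lemma elem_sym_reflect:
  assumes "odd n" "r \<le> n"
  shows "elem_sym n X (n - r) = - elem_sym n X r"
proof -
  define p where "p = (\<Prod>e\<leftarrow>es. [:1, - e:])"
  define q where "q = (\<Prod>e\<leftarrow>es. [:- e, 1:])"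
  \<comment> \<open>Sublists of the spectrum need not be closed under conjugation, so the induction
    has to keep \<open>cnj\<close> and the product of the entries.\<close>
  have "coeff (\<Prod>e\<leftarrow>xs. [:- e, 1:]) j = (-1) ^ length xs * prod_list xs * cnj (coeff (\<Prod>e\<leftarrow>xs. [:1, - e:]) j)"
    if "\<And>e. e \<in> set xs \<Longrightarrow> cmod e = 1" for xs :: "complex list" and j
    using that
  proof (induction xs arbitrary: j)
    case (Cons e xs)
    have e: "e * cnj e = 1" using Cons.prems[of e] by (simp add: complex_norm_square[symmetric])
    have IH: "coeff (\<Prod>e\<leftarrow>xs. [:- e, 1:]) j = (-1) ^ length xs * prod_list xs * cnj (coeff (\<Prod>e\<leftarrow>xs. [:1, - e:]) j)" for j
      using Cons by simp
    show ?case
    proof (cases j)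
      case 0
      then show ?thesis by (simp add: IH)
    next
      case (Suc i)
      have "e * cnj e * z = z" for z using e by simp
      from this[symmetric, of "(-1) ^ length xs * prod_list xs * cnj (coeff (\<Prod>e\<leftarrow>xs. [:1, - e:]) i)"]
      show ?thesis using Suc by (simp add: IH algebra_simps)
    qed
  qed (auto simp: coeff_1)
  from this[of es] have "coeff q j = - cnj (coeff p j)" for j
    using es assms(1) by (simp add: q_def p_def)
  then have q: "coeff q j = - of_real (elem_sym n X j)" for j
    using coeff_es by (simp add: p_def)
  have deg: "degree (\<Prod>e\<leftarrow>xs. [:- e, 1:]) = length xs" and ne: "(\<Prod>e\<leftarrow>xs. [:- e, 1:]) \<noteq> 0" for xs :: "complex list"
    by (induction xs) (auto simp: degree_mult_eq simp del: mult_pCons_left)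
  have lin: "reflect_poly [:- e, 1:] = [:1, - e:]" for e :: complex
    by (rule poly_eqI) (simp add: coeff_reflect_poly coeff_pCons split: nat.splits)
  have "reflect_poly (\<Prod>e\<leftarrow>xs. [:- e, 1:]) = (\<Prod>e\<leftarrow>xs. [:1, - e:])" for xs :: "complex list"
    by (induction xs) (auto simp: reflect_poly_mult lin simp del: mult_pCons_left)
  then have "coeff p r = coeff q (n - r)"
    using assms(2) deg[of es] es(1) coeff_reflect_poly[of q r] by (simp add: p_def q_def)
  then show ?thesis using q[of "n - r"] coeff_es[of r] by (simp add: p_def)
qed

text \<open>The reflection makes the sum of all \<open>e\<^sub>r\<close> equal to its own negative,
  and this sum is the characteristic product at 1.\<close>

lemma one_in_spectrum:
  assumes "odd n"
  shows "1 \<in> set es"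
proof -
  define p where "p = (\<Prod>e\<leftarrow>es. [:1, - e:])"
  have "degree p \<le> n"
    using elem_sym_eq_0 coeff_es by (intro degree_le) (auto simp: p_def)
  then have "poly p 1 = (\<Sum>r\<le>n. coeff p r)"
    by (subst poly_altdef) (auto intro!: sum.mono_neutral_left intro: le_degree)
  also have "\<dots> = of_real (\<Sum>r\<le>n. elem_sym n X r)" by (simp add: coeff_es p_def)
  also have "(\<Sum>r\<le>n. elem_sym n X r) = (\<Sum>r\<le>n. elem_sym n X (n - r))"
    by (rule sum.nat_diff_reindex[of _ "Suc n", simplified lessThan_Suc_atMost, symmetric, simplified])
  then have "(\<Sum>r\<le>n. elem_sym n X r) = 0"
    using elem_sym_reflect[OF assms] by (simp add: sum_negf)
  finally have "poly p 1 = 0" by simp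
  then show ?thesis by (auto simp: p_def poly_prod_list prod_list_zero_iff)
qed

end

section \<open>Expectations of the resolvent trace\<close>

lemma SO_spectrum_indexed:
  assumes X: "X \<in> SO_mats n" and n: "odd n"
  obtains ev :: "nat \<Rightarrow> complex" and m where
    "\<And>k. complex_of_real (pow_trace n X k) = (\<Sum>i<n. ev i ^ k)"
    "\<And>z. Lambda_char X z = (\<Prod>i<n. 1 - z * ev i)" "\<And>i. i < n \<Longrightarrow> cmod (ev i) = 1"
    "m < n" "ev m = 1"
proof -
  obtain es :: "complex list" where es: "length es = n" "\<And>k. complex_of_real (pow_trace n X k) = (\<Sum>e\<leftarrow>es. e ^ k)"
    "\<And>z. Lambda_char X z = (\<Prod>e\<leftarrow>es. 1 - z * e)" "\<And>e. e \<in> set es \<Longrightarrow> cmod e = 1" "prod_list es = 1"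
    by (rule SO_spectrum[OF X]) (rule that)
  have "1 \<in> set es" by (rule one_in_spectrum[OF X es(1,2,4,5) n])
  then obtain m where "m < n" "es ! m = 1" using es(1) by (auto simp: in_set_conv_nth)
  moreover have "(\<Sum>e\<leftarrow>es. e ^ k) = (\<Sum>i<n. es ! i ^ k)" for k
    using es(1) by (simp add: sum_list_sum_nth lessThan_atLeast0)
  moreover have "(\<Prod>e\<leftarrow>es. 1 - z * e) = (\<Prod>i<n. 1 - z * es ! i)" for z
    using es(1) by (simp add: prod.list_conv_set_nth lessThan_atLeast0)
  ultimately show thesis using es by (intro that[of "\<lambda>i. es ! i" m]) auto
qed

lemma SO_elem_sym:
  assumes X: "X \<in> SO_mats n"
  shows "r > n \<Longrightarrow> elem_sym n X r = 0"
    and "odd n \<Longrightarrow> r \<le> n \<Longrightarrow> elem_sym n X (n - r) = - elem_sym n X r"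
proof -
  obtain es :: "complex list" where es: "length es = n" "\<And>k. complex_of_real (pow_trace n X k) = (\<Sum>e\<leftarrow>es. e ^ k)"
    "\<And>z. Lambda_char X z = (\<Prod>e\<leftarrow>es. 1 - z * e)" "\<And>e. e \<in> set es \<Longrightarrow> cmod e = 1" "prod_list es = 1"
    by (rule SO_spectrum[OF X]) (rule that)
  show "r > n \<Longrightarrow> elem_sym n X r = 0" by (rule elem_sym_eq_0[OF X es(1,2,4,5)])
  show "odd n \<Longrightarrow> r \<le> n \<Longrightarrow> elem_sym n X (n - r) = - elem_sym n X r"
    by (rule elem_sym_reflect[OF X es(1,2,4,5)])
qed

text \<open>In the Newton formula for \<open>P\<^sub>k\<close> only \<open>r = 1, n - 1, n\<close>
  meet a nonzero moment with nonzero weight. \<open>r = 1\<close> produces the mean 1 at even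
  \<open>k\<close>, the top pair that at odd \<open>k \<ge> n\<close>.\<close>

lemma integral_pow_trace:
  assumes H: "is_Haar_prob_SO n \<mu>" and n: "odd n" "n \<ge> 3" and k: "k > 0"
  shows "(\<integral>X. pow_trace n X k \<partial>\<mu>) = (if odd k \<and> k < n then 0 else 1)"
proof -
  have int: "integrable \<mu> (\<lambda>X. elem_sym n X r * comp_sym n X l)" for r l
    by (intro integrable_bounded_meas[OF H] bounded_meas_mult bounded_meas_elem_sym bounded_meas_comp_sym)
  have "(\<integral>X. pow_trace n X k \<partial>\<mu>) = (\<integral>X. - (\<Sum>r\<le>k. of_nat r * (elem_sym n X r * comp_sym n X (k - r))) \<partial>\<mu>)"
    unfolding elem_sym_def comp_sym_def
    by (intro integral_SO_cong[OF H]) (subst power_sum_newton[OF k], simp add: mult.assoc)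
  also have "\<dots> = - (\<Sum>r\<le>k. of_nat r * mixed_moment n \<mu> r (k - r))"
    using int by (simp add: mixed_moment_def Bochner_Integration.integral_sum)
  finally have E: "(\<integral>X. pow_trace n X k \<partial>\<mu>) = - (\<Sum>r\<le>k. of_nat r * mixed_moment n \<mu> r (k - r))" .
  note v = mixed_moment_values[OF H n(2)]
  have refl_mom: "mixed_moment n \<mu> (n - r) l = - mixed_moment n \<mu> r l" if "r \<le> n" for r l
  proof -
    have "mixed_moment n \<mu> (n - r) l = (\<integral>X. - (elem_sym n X r * comp_sym n X l) \<partial>\<mu>)"
      unfolding mixed_moment_def using SO_elem_sym(2)[OF _ n(1) that] by (intro integral_SO_cong[OF H]) simp
    then show ?thesis by (simp add: mixed_moment_def)
  qed
  have vn: "mixed_moment n \<mu> n l = (if even l then -1 else 0)" for l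
    using refl_mom[of 0 l] v(1)[of l] by simp
  have vn1: "mixed_moment n \<mu> (n - 1) l = (if even l then 0 else 1)" for l
    using refl_mom[of 1 l] v(2)[of l] n by simp
  have v0: "mixed_moment n \<mu> r l = 0" if "r > n" for r l
  proof -
    have "mixed_moment n \<mu> r l = (\<integral>X. 0 \<partial>\<mu>)"
      unfolding mixed_moment_def using SO_elem_sym(1)[OF _ that] by (intro integral_SO_cong[OF H]) simp
    then show ?thesis by simp
  qed
  have summand: "of_nat r * mixed_moment n \<mu> r (k - r) =
      (if r = 1 then (if even (k - 1) then 0 else -1) else 0) +
      ((if r = n - 1 then (real n - 1) * (if even (k - (n - 1)) then 0 else 1) else 0) +
       (if r = n then real n * (if even (k - n) then -1 else 0) else 0))" for r
  proof -
    consider "r = 0" | "r = 1" | "2 \<le> r" "r + 2 \<le> n" | "r = n - 1" | "r = n" | "r > n" by linarith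
    then show ?thesis
    proof cases
      case 3 then show ?thesis using v(3)[OF 3] by auto
    next
      case 4 then show ?thesis using vn1 n(2) by (auto simp: of_nat_diff)
    next
      case 6 then show ?thesis using v0 n(2) by auto
    qed (use v vn n(2) in auto)
  qed
  have "(\<Sum>r\<le>k. of_nat r * mixed_moment n \<mu> r (k - r)) =
     (if 1 \<le> k then (if even (k - 1) then 0 else -1) else 0) +
     ((if n - 1 \<le> k then (real n - 1) * (if even (k - (n - 1)) then 0 else 1) else 0) +
      (if n \<le> k then real n * (if even (k - n) then -1 else 0) else 0))"
    unfolding summand sum.distrib by (simp add: sum.delta')
  also have "\<dots> = - (if odd k \<and> k < n then 0 else 1)"
  proof (cases "even k")
    case True
    have "even (k - (n - 1))" using n True by (simp add: even_diff_nat)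
    moreover have "n \<le> k \<Longrightarrow> odd (k - n)" using n True by (simp add: even_diff_nat)
    ultimately show ?thesis using True k by auto
  next
    case False
    \<comment> \<open>An odd \<open>k\<close> never equals the even number \<open>n - 1\<close>, so
      the top two terms enter together and add up to \<open>(n - 1) - n = - 1\<close>.\<close>
    have "even (n - 1)" using n(1) by simp
    then have "k \<noteq> n - 1" using False by blast
    then have "n - 1 \<le> k \<Longrightarrow> n \<le> k" by linarith
    moreover have "n \<le> k \<Longrightarrow> even (k - n)" using n False by (simp add: even_diff_nat)
    moreover have "n \<le> k \<Longrightarrow> odd (k - (n - 1))" using n False by (simp add: even_diff_nat)
    ultimately show ?thesis using False k by auto
  qed
  finally show ?thesis unfolding E by simp
qed

lemma abs_pow_trace_le:
  assumes "X \<in> SO_mats n" shows "\<bar>pow_trace n X k\<bar> \<le> n"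
proof -
  have "\<bar>pow_trace n X k\<bar> \<le> (\<Sum>i<n. \<bar>(X ^\<^sub>m k) $$ (i, i)\<bar>)"
    unfolding pow_trace_def by (rule sum_abs)
  also have "\<dots> \<le> (\<Sum>i<n. 1)"
    using SO_mats_entry_bound[OF SO_mats_pow[OF assms]] by (intro sum_mono) auto
  finally show ?thesis by simp
qed

text \<open>If all means were 1, the integral would be \<open>W\<close>; the corrections are
  \<open>P\<^sub>0 = n\<close> and the zero means at odd \<open>k < n\<close>. The bound
  \<open>n\<close> on the traces justifies integration term by term.\<close>

lemma integral_trace_series:
  assumes H: "is_Haar_prob_SO n \<mu>" and n: "odd n" "n \<ge> 3"
    and w: "\<And>k. w k \<ge> 0" "w sums W"
  shows "integrable \<mu> (\<lambda>X. \<Sum>k. w k * pow_trace n X k)"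
    "(\<integral>X. (\<Sum>k. w k * pow_trace n X k) \<partial>\<mu>) = W + (real n - 1) * w 0 - (\<Sum>j<n div 2. w (2 * j + 1))"
proof -
  interpret prob_space \<mu> by (rule haar_facts[OF H])
  have i: "integrable \<mu> (\<lambda>X. w k * pow_trace n X k)" for k
    by (intro integrable_bounded_meas[OF H] bounded_meas_mult bounded_meas_const bounded_meas_pow_trace)
  have b: "norm (w k * pow_trace n X k) \<le> w k * n" if "X \<in> SO_mats n" for X k
    using abs_pow_trace_le[OF that, of k] w(1)[of k] by (simp add: abs_mult mult_left_mono)
  have sw: "summable (\<lambda>k. w k * real n)" using sums_summable[OF w(2)] by (rule summable_mult2)
  have 1: "AE X in \<mu>. summable (\<lambda>k. norm (w k * pow_trace n X k))"
    using haar_facts(3)[OF H] b by (intro AE_I2 summable_comparison_test'[OF sw, of 0]) auto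
  have 2: "summable (\<lambda>k. \<integral>X. norm (w k * pow_trace n X k) \<partial>\<mu>)"
  proof (rule summable_comparison_test'[OF sw, of 0])
    fix k
    have "(\<integral>X. norm (w k * pow_trace n X k) \<partial>\<mu>) \<le> (\<integral>X. w k * n \<partial>\<mu>)"
      using haar_facts(3)[OF H] b i by (intro integral_mono) auto
    then show "norm (\<integral>X. norm (w k * pow_trace n X k) \<partial>\<mu>) \<le> w k * n"
      by (simp add: prob_space)
  qed
  show "integrable \<mu> (\<lambda>X. \<Sum>k. w k * pow_trace n X k)" by (rule integrable_suminf[OF i 1 2])
  define S where "S = (\<lambda>j. 2 * j + 1) ` {..<n div 2}"
  have S: "k \<in> S \<longleftrightarrow> odd k \<and> k < n" for k
  proof
    assume "odd k \<and> k < n"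
    then have "k = 2 * (k div 2) + 1" "k div 2 < n div 2" using n(1) by (auto elim!: oddE)
    then show "k \<in> S" unfolding S_def by blast
  qed (use n(1) in \<open>auto simp: S_def elim!: oddE\<close>)
  have fS: "finite S" by (simp add: S_def)
  have M: "(\<integral>X. w k * pow_trace n X k \<partial>\<mu>) = w k + (if k = 0 then (real n - 1) * w k else 0) - (if k \<in> S then w k else 0)" for k
  proof (cases "k = 0")
    case True
    have "(\<integral>X. w k * pow_trace n X k \<partial>\<mu>) = (\<integral>X. w k * n \<partial>\<mu>)"
      using True by (intro integral_SO_cong[OF H]) (simp add: pow_trace_0)
    then show ?thesis using True S by (simp add: prob_space algebra_simps)
  next
    case False
    then show ?thesis using integral_pow_trace[OF H n, of k] S by auto
  qed
  have a: "(\<lambda>k. \<integral>X. w k * pow_trace n X k \<partial>\<mu>) sums (W + (real n - 1) * w 0 - (\<Sum>k\<in>S. w k))"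
    unfolding M by (intro sums_add sums_diff w sums_single sums_If_finite_set fS)
  have b: "(\<lambda>k. \<integral>X. w k * pow_trace n X k \<partial>\<mu>) sums (\<integral>X. (\<Sum>k. w k * pow_trace n X k) \<partial>\<mu>)"
    by (rule sums_integral[OF i 1 2])
  have "(\<Sum>k\<in>S. w k) = (\<Sum>j<n div 2. w (2 * j + 1))"
    unfolding S_def by (subst sum.reindex) (auto simp: inj_on_def)
  then show "(\<integral>X. (\<Sum>k. w k * pow_trace n X k) \<partial>\<mu>) = W + (real n - 1) * w 0 - (\<Sum>j<n div 2. w (2 * j + 1))"
    using sums_unique2[OF b a] by simp
qed

section \<open>Poisson kernels at the eigenvalues\<close>

lemma one_minus_square_divide:
  fixes s :: real
  assumes "s \<noteq> 1"
  shows "(1 - s\<^sup>2) / (1 - s)\<^sup>2 = (1 + s) / (1 - s)"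
proof -
  have "1 - s\<^sup>2 = (1 - s) * (1 + s)" by (simp add: power2_eq_square algebra_simps)
  then show ?thesis using assms by (simp add: power2_eq_square)
qed

text \<open>By the first identity, \<open>2 * Re (s * l / (1 - s * l)\<^sup>2)\<close> is
  \<open>s\<close> times the derivative of \<open>p\<close> in \<open>s\<close>. So
  \<open>p\<^sup>2\<close> is linear in \<open>p\<close> and its derivative, and its sum over the
  spectrum is linear in the traces. The upper bound is the value at \<open>l = 1\<close>.\<close>

lemma poisson_kernel:
  fixes l :: complex and s :: real
  assumes l: "cmod l = 1" and s: "0 < s" "s < 1"
  defines "p \<equiv> (1 - s\<^sup>2) / (cmod (1 - s * l))\<^sup>2"
  shows "2 * Re (1 / (1 - s * l)) - 1 = p"
    "p\<^sup>2 = (1 + s\<^sup>2) / (1 - s\<^sup>2) * p + 2 * Re (s * l / (1 - s * l)\<^sup>2)"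
    "0 \<le> p" "p \<le> (1 + s) / (1 - s)"
proof -
  define x y where "x = Re l" and "y = Im l"
  have xy: "x\<^sup>2 + y\<^sup>2 = 1" using l cmod_power2[of l] by (simp add: x_def y_def)
  define D where "D = 1 - 2 * s * x + s\<^sup>2"
  have D: "(cmod (1 - s * l))\<^sup>2 = D"
  proof -
    have "(cmod (1 - s * l))\<^sup>2 = (1 - s * x)\<^sup>2 + (s * y)\<^sup>2" by (simp add: cmod_power2 x_def y_def)
    also have "\<dots> = 1 - 2 * s * x + s\<^sup>2 * (x\<^sup>2 + y\<^sup>2)" by (simp add: power2_eq_square algebra_simps)
    finally show ?thesis unfolding xy D_def by simp
  qed
  have x: "x \<le> 1" using complex_Re_le_cmod[of l] l by (simp add: x_def)
  have "s * x \<le> s * 1" using x s by (intro mult_left_mono) auto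
  then have D1: "D \<ge> (1 - s)\<^sup>2" by (simp add: D_def power2_eq_square algebra_simps)
  moreover have "(1 - s)\<^sup>2 > 0" using s by simp
  ultimately have D0: "D > 0" by linarith
  have nz: "1 - s * l \<noteq> 0" using D D0 by auto
  have s2: "1 - s\<^sup>2 > 0" using s by (simp add: power_less_one_iff)
  have cD: "(1 - s * l) * cnj (1 - s * l) = of_real D"
    using complex_norm_square[of "1 - s * l"] D by simp
  have inv: "1 / (1 - s * l) = cnj (1 - s * l) / of_real D"
    using cD nz D0 by (simp add: field_simps)
  have "Re (1 / (1 - s * l)) = (1 - s * x) / D"
    unfolding inv by (simp add: x_def)
  then show p1: "2 * Re (1 / (1 - s * l)) - 1 = p"
    unfolding p_def D using D0 by (simp add: D_def field_simps)
  have lc: "l * cnj l = 1" using complex_norm_square[of l] l by simp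
  have "s * l / (1 - s * l)\<^sup>2 = s * l * (1 / (1 - s * l))\<^sup>2" by (simp add: power_divide)
  also have "\<dots> = s * l * (cnj (1 - s * l))\<^sup>2 / of_real (D\<^sup>2)" unfolding inv by (simp add: power_divide)
  also have "s * l * (cnj (1 - s * l))\<^sup>2 = s * l - 2 * of_real (s\<^sup>2) * (l * cnj l) + of_real (s^3) * cnj l * (l * cnj l)"
    by (simp add: power2_eq_square power3_eq_cube algebra_simps)
  also have "Re (\<dots> / of_real (D\<^sup>2)) = (s * x - 2 * s\<^sup>2 + s^3 * x) / D\<^sup>2"
    unfolding lc Re_divide_of_real by (simp add: x_def)
  finally have R2: "Re (s * l / (1 - s * l)\<^sup>2) = (s * x - 2 * s\<^sup>2 + s^3 * x) / D\<^sup>2" .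
  have "(1 - s\<^sup>2)\<^sup>2 = (1 + s\<^sup>2) * D + 2 * (s * x - 2 * s\<^sup>2 + s^3 * x)"
    by (simp add: D_def power2_eq_square power3_eq_cube algebra_simps)
  then have "(1 - s\<^sup>2)\<^sup>2 / D\<^sup>2 = (1 + s\<^sup>2) / D + 2 * ((s * x - 2 * s\<^sup>2 + s^3 * x) / D\<^sup>2)"
    using D0 by (simp add: add_divide_distrib power2_eq_square)
  then show "p\<^sup>2 = (1 + s\<^sup>2) / (1 - s\<^sup>2) * p + 2 * Re (s * l / (1 - s * l)\<^sup>2)"
    unfolding R2 p_def D using s2 by (simp add: power_divide)
  show "0 \<le> p" unfolding p_def using s2 by simp
  have "p \<le> (1 - s\<^sup>2) / (1 - s)\<^sup>2" unfolding p_def D using s2 D1 D0 s by (intro divide_left_mono) auto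
  also have "\<dots> = (1 + s) / (1 - s)" using s by (simp add: one_minus_square_divide)
  finally show "p \<le> (1 + s) / (1 - s)" .
qed

text \<open>For \<open>0 < s < 1\<close> the trace of the resolvent, the inverse of
  \<open>1 - s X\<close>, in a form that can be integrated term by term;
  \<open>trace_gen_deriv\<close> is \<open>s\<close> times its derivative in
  \<open>s\<close>.\<close>

definition trace_gen :: "nat \<Rightarrow> real \<Rightarrow> real mat \<Rightarrow> real" where
  "trace_gen n s X = (\<Sum>k. s ^ k * pow_trace n X k)"

definition trace_gen_deriv :: "nat \<Rightarrow> real \<Rightarrow> real mat \<Rightarrow> real" where
  "trace_gen_deriv n s X = (\<Sum>k. (real k * s ^ k) * pow_trace n X k)"

lemma sums_of_nat_power:
  fixes z :: "'a :: {real_normed_field, banach}"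
  assumes "norm z < 1"
  shows "(\<lambda>k. of_nat k * z ^ k) sums (z / (1 - z)\<^sup>2)"
proof -
  have "(\<lambda>k. z * (of_nat (Suc k) * z ^ k)) sums (z * (1 / (1 - z)\<^sup>2))"
    by (intro sums_mult geometric_deriv_sums assms)
  then have "(\<lambda>k. of_nat (Suc k) * z ^ Suc k) sums (z / (1 - z)\<^sup>2)"
    by (simp add: mult_ac)
  then show ?thesis using sums_Suc_iff[of "\<lambda>k. of_nat k * z ^ k" "z / (1 - z)\<^sup>2"] by simp
qed

text \<open>\<open>S\<close> and \<open>V\<close> are the sums of \<open>p\<close> and
  \<open>p\<^sup>2\<close> over the spectrum with one eigenvalue 1 left out. The subtracted terms
  are its kernel \<open>(1 + s) / (1 - s)\<close> and the square of that.\<close>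

lemma SO_poisson:
  assumes X: "X \<in> SO_mats n" and n: "odd n" and s: "0 < s" "s < 1"
  defines "S \<equiv> 2 * trace_gen n s X - real n - (1 + s) / (1 - s)"
    and "V \<equiv> (1 + s\<^sup>2) / (1 - s\<^sup>2) * (2 * trace_gen n s X - real n) + 2 * trace_gen_deriv n s X - ((1 + s) / (1 - s))\<^sup>2"
  shows "0 \<le> S" "S \<le> (n - 1) * ((1 + s) / (1 - s))" "S\<^sup>2 \<le> (n - 1) * V"
    "Lambda_logderiv X (of_real s) = - of_real ((trace_gen n s X - n) / s)"
proof -
  obtain l :: "nat \<Rightarrow> complex" and m where
    tr: "\<And>k. complex_of_real (pow_trace n X k) = (\<Sum>i<n. l i ^ k)" and
    ch: "\<And>z. Lambda_char X z = (\<Prod>i<n. 1 - z * l i)" and l: "\<And>i. i < n \<Longrightarrow> cmod (l i) = 1" and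
    m: "m < n" "l m = 1"
    by (rule SO_spectrum_indexed[OF X n]) (rule that)
  define p where "p i = (1 - s\<^sup>2) / (cmod (1 - s * l i))\<^sup>2" for i
  note P = poisson_kernel[OF l s, folded p_def]
  have nl: "norm (s * l i) < 1" if "i < n" for i using l[OF that] s by (simp add: norm_mult)
  have "(\<lambda>k. \<Sum>i<n. (s * l i) ^ k) sums (\<Sum>i<n. 1 / (1 - s * l i))"
    by (intro sums_sum geometric_sums nl) auto
  also have "(\<lambda>k. \<Sum>i<n. (s * l i) ^ k) = (\<lambda>k. of_real (s ^ k * pow_trace n X k))"
    by (rule ext) (simp add: tr power_mult_distrib sum_distrib_left)
  finally have g1: "(\<lambda>k. complex_of_real (s ^ k * pow_trace n X k)) sums (\<Sum>i<n. 1 / (1 - s * l i))" .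
  have "(\<lambda>k. \<Sum>i<n. of_nat k * (s * l i) ^ k) sums (\<Sum>i<n. s * l i / (1 - s * l i)\<^sup>2)"
    by (intro sums_sum sums_of_nat_power nl) auto
  also have "(\<lambda>k. \<Sum>i<n. of_nat k * (s * l i) ^ k) = (\<lambda>k. of_real ((real k * s ^ k) * pow_trace n X k))"
    by (rule ext) (simp add: tr power_mult_distrib sum_distrib_left mult.assoc)
  finally have g2: "(\<lambda>k. complex_of_real ((real k * s ^ k) * pow_trace n X k)) sums (\<Sum>i<n. s * l i / (1 - s * l i)\<^sup>2)" .
  have r1: "trace_gen n s X = Re (\<Sum>i<n. 1 / (1 - s * l i))"
    unfolding trace_gen_def using sums_Re[OF g1] by (simp add: sums_iff)
  have r2: "trace_gen_deriv n s X = Re (\<Sum>i<n. s * l i / (1 - s * l i)\<^sup>2)"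
    unfolding trace_gen_deriv_def using sums_Re[OF g2] by (simp add: sums_iff)
  have i1: "Im (\<Sum>i<n. 1 / (1 - s * l i)) = 0"
    using sums_Im[OF g1] by (simp add: sums_iff)
  have c1: "complex_of_real (trace_gen n s X) = (\<Sum>i<n. 1 / (1 - s * l i))"
    by (rule complex_eqI) (simp_all only: r1 i1 Re_complex_of_real Im_complex_of_real)
  have sp: "(\<Sum>i<n. p i) = 2 * trace_gen n s X - real n"
  proof -
    have "(\<Sum>i<n. p i) = (\<Sum>i<n. 2 * Re (1 / (1 - s * l i)) - 1)"
      by (intro sum.cong refl) (simp add: P(1))
    then show ?thesis by (simp add: r1 sum_subtractf sum_distrib_left)
  qed
  have sp2: "(\<Sum>i<n. (p i)\<^sup>2) = (1 + s\<^sup>2) / (1 - s\<^sup>2) * (2 * trace_gen n s X - real n) + 2 * trace_gen_deriv n s X"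
  proof -
    have "(\<Sum>i<n. (p i)\<^sup>2) = (\<Sum>i<n. (1 + s\<^sup>2) / (1 - s\<^sup>2) * p i + 2 * Re (s * l i / (1 - s * l i)\<^sup>2))"
      by (intro sum.cong refl P(2)) auto
    then show ?thesis unfolding sp[symmetric] r2 by (simp only: sum.distrib sum_distrib_left[symmetric] Re_sum)
  qed
  have pm: "p m = (1 + s) / (1 - s)"
  proof -
    have "1 - s * l m = of_real (1 - s)" by (simp add: m(2))
    then have "cmod (1 - s * l m) = 1 - s" using s by (simp only: norm_of_real)
    then show ?thesis unfolding p_def using s by (simp add: one_minus_square_divide)
  qed
  define J where "J = {..<n} - {m}"
  have cJ: "card J = n - 1" using m by (simp add: J_def)
  have rn: "real (n - 1) = real n - 1" using m by (simp add: of_nat_diff)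
  have S: "S = (\<Sum>i\<in>J. p i)"
    unfolding S_def sp[symmetric] pm[symmetric] J_def using m by (simp add: sum_diff1)
  have V: "V = (\<Sum>i\<in>J. (p i)\<^sup>2)"
    unfolding V_def sp2[symmetric] pm[symmetric] J_def using m by (simp add: sum_diff1)
  show "0 \<le> S" unfolding S using P(3) by (intro sum_nonneg) (auto simp: J_def)
  show "S \<le> (n - 1) * ((1 + s) / (1 - s))"
    unfolding S using P(4) cJ rn by (intro order_trans[OF sum_bounded_above[of J p "(1 + s) / (1 - s)"]]) (auto simp: J_def)
  have "S\<^sup>2 \<le> (\<Sum>i\<in>J. 1\<^sup>2) * (\<Sum>i\<in>J. (p i)\<^sup>2)"
    unfolding S using Cauchy_Schwarz_ineq_sum[of "\<lambda>_. 1" p J] by simp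
  then show "S\<^sup>2 \<le> (n - 1) * V" unfolding V using cJ by simp
  have nz: "1 - s * l i \<noteq> 0" if "i < n" for i using nl[OF that] by auto
  have "((\<lambda>z. \<Prod>i<n. 1 - z * l i) has_field_derivative
      (\<Prod>i<n. 1 - of_real s * l i) * (\<Sum>i<n. - l i / (1 - of_real s * l i))) (at (of_real s))"
    by (rule has_field_derivative_prod') (use nz in \<open>auto intro!: derivative_eq_intros\<close>)
  then have d: "deriv (Lambda_char X) (of_real s) = (\<Prod>i<n. 1 - of_real s * l i) * (\<Sum>i<n. - l i / (1 - of_real s * l i))"
    unfolding ch[abs_def] by (rule DERIV_imp_deriv)
  have "Lambda_logderiv X (of_real s) = (\<Sum>i<n. - l i / (1 - of_real s * l i))"
    unfolding Lambda_logderiv_def d ch using nz by simp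
  also have "\<dots> = (\<Sum>i<n. - ((1 / (1 - s * l i) - 1) / s))"
  proof (intro sum.cong refl)
    fix i assume "i \<in> {..<n}"
    then show "- l i / (1 - of_real s * l i) = - ((1 / (1 - s * l i) - 1) / s)"
      using nz[of i] s by (simp add: field_simps)
  qed
  also have "\<dots> = - ((complex_of_real (trace_gen n s X) - n) / s)"
    unfolding c1 by (simp add: sum_negf sum_subtractf flip: sum_divide_distrib)
  finally show "Lambda_logderiv X (of_real s) = - of_real ((trace_gen n s X - n) / s)" by simp
qed

text \<open>The singular parts of the means cancel against the subtracted kernel of the eigenvalue
  1. What remains are sums over the odd exponents below \<open>n\<close>, with summands that tend to
  0 as \<open>s\<close> tends to 1.\<close>

lemma integral_trace_gen:
  assumes H: "is_Haar_prob_SO n \<mu>" and n: "odd n" "n \<ge> 3" and s: "0 < s" "s < 1"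
  defines "N \<equiv> n div 2"
  shows "integrable \<mu> (trace_gen n s)" "integrable \<mu> (trace_gen_deriv n s)"
    "(\<integral>X. (2 * trace_gen n s X - real n - (1 + s) / (1 - s)) \<partial>\<mu>) = 2 * (\<Sum>j<N. 1 - s ^ (2 * j + 1))"
    "(\<integral>X. ((1 + s\<^sup>2) / (1 - s\<^sup>2) * (2 * trace_gen n s X - real n) + 2 * trace_gen_deriv n s X - ((1 + s) / (1 - s))\<^sup>2) \<partial>\<mu>)
      = 2 * (\<Sum>j<N. (1 + s\<^sup>2) / (1 - s\<^sup>2) - ((1 + s\<^sup>2) / (1 - s\<^sup>2) + real (2 * j + 1)) * s ^ (2 * j + 1))"
proof -
  interpret prob_space \<mu> by (rule haar_facts[OF H])
  have nN: "real n = 2 * real N + 1" using n(1) by (auto simp: N_def elim!: oddE)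
  have w1: "(\<lambda>k. s ^ k) sums (1 / (1 - s))" using s by (intro geometric_sums) auto
  have w2: "(\<lambda>k. real k * s ^ k) sums (s / (1 - s)\<^sup>2)" using s by (intro sums_of_nat_power) auto
  have i: "integrable \<mu> (trace_gen n s)" "integrable \<mu> (trace_gen_deriv n s)"
    unfolding trace_gen_def[abs_def] trace_gen_deriv_def[abs_def]
    using integral_trace_series(1)[OF H n _ w1] integral_trace_series(1)[OF H n _ w2] s by simp_all
  show "integrable \<mu> (trace_gen n s)" "integrable \<mu> (trace_gen_deriv n s)" by (rule i)+
  have e1: "(\<integral>X. trace_gen n s X \<partial>\<mu>) = 1 / (1 - s) + (real n - 1) - (\<Sum>j<N. s ^ (2 * j + 1))"
    unfolding trace_gen_def N_def using integral_trace_series(2)[OF H n _ w1] s by simp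
  have e2: "(\<integral>X. trace_gen_deriv n s X \<partial>\<mu>) = s / (1 - s)\<^sup>2 - (\<Sum>j<N. real (2 * j + 1) * s ^ (2 * j + 1))"
    unfolding trace_gen_deriv_def N_def using integral_trace_series(2)[OF H n _ w2] s by simp
  have f: "2 / (1 - s) - 1 = (1 + s) / (1 - s)" using s by (simp add: field_simps)
  show "(\<integral>X. (2 * trace_gen n s X - real n - (1 + s) / (1 - s)) \<partial>\<mu>) = 2 * (\<Sum>j<N. 1 - s ^ (2 * j + 1))"
    using i f by (simp add: e1 prob_space sum_subtractf nN algebra_simps)
  define c where "c = (1 + s\<^sup>2) / (1 - s\<^sup>2)"
  have s2: "1 - s\<^sup>2 \<noteq> 0" using s by (simp add: power2_eq_1_iff)
  \<comment> \<open>The identity for \<open>p\<^sup>2\<close> at the eigenvalue 1.\<close>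
  have g: "c * (2 / (1 - s) - 1) + 2 * (s / (1 - s)\<^sup>2) = ((1 + s) / (1 - s))\<^sup>2"
  proof -
    have "1 - s\<^sup>2 = (1 - s) * (1 + s)" by (simp add: power2_eq_square algebra_simps)
    then have "c * (2 / (1 - s) - 1) = (1 + s\<^sup>2) / (1 - s)\<^sup>2"
      unfolding f c_def using s by (simp add: power2_eq_square)
    then show ?thesis by (simp add: power_divide power2_eq_square flip: add_divide_distrib) (simp add: algebra_simps)
  qed
  have "(\<integral>X. (c * (2 * trace_gen n s X - real n) + 2 * trace_gen_deriv n s X - ((1 + s) / (1 - s))\<^sup>2) \<partial>\<mu>) =
     c * (2 * (\<integral>X. trace_gen n s X \<partial>\<mu>) - n) + 2 * (\<integral>X. trace_gen_deriv n s X \<partial>\<mu>) - ((1 + s) / (1 - s))\<^sup>2"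
    using i by (simp add: prob_space)
  also have "\<dots> = c * (real n - 1) - 2 * (c * (\<Sum>j<N. s ^ (2 * j + 1)) + (\<Sum>j<N. real (2 * j + 1) * s ^ (2 * j + 1)))"
    unfolding e1 e2 g[symmetric] by (simp add: algebra_simps)
  also have "\<dots> = 2 * (\<Sum>j<N. c - (c + real (2 * j + 1)) * s ^ (2 * j + 1))"
    by (simp add: nN sum_subtractf sum_distrib_left sum.distrib algebra_simps)
  finally show "(\<integral>X. ((1 + s\<^sup>2) / (1 - s\<^sup>2) * (2 * trace_gen n s X - real n) + 2 * trace_gen_deriv n s X - ((1 + s) / (1 - s))\<^sup>2) \<partial>\<mu>)
      = 2 * (\<Sum>j<N. (1 + s\<^sup>2) / (1 - s\<^sup>2) - ((1 + s\<^sup>2) / (1 - s\<^sup>2) + real (2 * j + 1)) * s ^ (2 * j + 1))"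
    by (simp add: c_def)
qed

section \<open>Asymptotic expansion\<close>

lemma powr_taylor:
  fixes K c x :: real
  assumes n: "n > 0" and c: "0 < c" and x: "0 < x"
  shows "\<exists>t. min c x \<le> t \<and> t \<le> max c x \<and>
    x powr K = (\<Sum>m<n. (\<Prod>i<m. K - real i) * c powr (K - real m) / fact m * (x - c) ^ m)
      + (\<Prod>i<n. K - real i) * t powr (K - real n) / fact n * (x - c) ^ n"
proof (cases "x = c")
  case True
  have "(\<Sum>m<n. (\<Prod>i<m. K - real i) * c powr (K - real m) / fact m * (x - c) ^ m) =
    (\<Sum>m<n. if m = 0 then c powr K else 0)"
    using True by (intro sum.cong) auto
  then show ?thesis using True n by (intro exI[of _ c]) simp
next
  case False
  define diff where "diff m t = (\<Prod>i<m. K - real i) * t powr (K - real m)" for m t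
  have "\<forall>m t. m < n \<and> min c x \<le> t \<and> t \<le> max c x \<longrightarrow> DERIV (diff m) t :> diff (Suc m) t"
  proof (intro allI impI)
    fix m t assume "m < n \<and> min c x \<le> t \<and> t \<le> max c x"
    then have t: "t > 0" using c x by auto
    have "DERIV (\<lambda>t. (\<Prod>i<m. K - real i) * t powr (K - real m)) t :>
        (\<Prod>i<m. K - real i) * ((K - real m) * t powr (K - real m - 1))"
      by (intro DERIV_cmult has_real_derivative_powr t)
    also have "K - real m - 1 = K - real (Suc m)" by simp
    finally show "DERIV (diff m) t :> diff (Suc m) t"
      by (simp add: diff_def[abs_def] mult.assoc)
  qed
  moreover have "diff 0 = (\<lambda>t. t powr K)" by (rule ext) (simp add: diff_def)
  ultimately obtain t where t: "if x < c then x < t \<and> t < c else c < t \<and> t < x"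
    "x powr K = (\<Sum>m<n. diff m c / fact m * (x - c) ^ m) + diff n t / fact n * (x - c) ^ n"
    using Taylor[OF n, of diff "\<lambda>t. t powr K" "min c x" "max c x" c x] False by auto
  then show ?thesis by (intro exI[of _ t]) (auto simp: diff_def split: if_splits)
qed

lemma powr_le_near_one:
  fixes t p :: real
  assumes "1/2 \<le> t" "t \<le> 2"
  shows "t powr p \<le> 2 powr \<bar>p\<bar>"
proof -
  have t: "t > 0" using assms by simp
  have "ln t \<le> ln 2" using assms t by simp
  moreover have "- ln 2 \<le> ln t" using assms t ln_le_cancel_iff[of "1/2" t] by (simp add: ln_div)
  ultimately have "\<bar>ln t\<bar> \<le> ln 2" by linarith
  then have "p * ln t \<le> \<bar>p\<bar> * ln 2"
    by (metis abs_ge_self abs_ge_zero abs_mult mult_left_mono order_trans)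
  then show ?thesis using t by (simp add: powr_def)
qed

lemma powr_expand_at_1:
  fixes K d :: real
  assumes d: "\<bar>d\<bar> \<le> 1/2"
  shows "\<bar>(1 + d) powr K - (1 + K * d + K * (K - 1) / 2 * d\<^sup>2)\<bar>
      \<le> \<bar>K * (K - 1) * (K - 2)\<bar> * 2 powr \<bar>K - 3\<bar> * \<bar>d\<bar> ^ 3"
    and "\<bar>(1 + d) powr K - 1\<bar> \<le> \<bar>K\<bar> * 2 powr \<bar>K - 1\<bar> * \<bar>d\<bar>"
proof -
  have d': "1 + d > 0" using d by linarith
  obtain t where t: "min 1 (1 + d) \<le> t" "t \<le> max 1 (1 + d)" and
    e: "(1 + d) powr K = (\<Sum>m<3. (\<Prod>i<m. K - real i) * 1 powr (K - real m) / fact m * (1 + d - 1) ^ m)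
      + (\<Prod>i<3. K - real i) * t powr (K - real 3) / fact 3 * (1 + d - 1) ^ 3"
    using powr_taylor[of 3 1 "1 + d" K] d' by auto
  have t2: "1/2 \<le> t" "t \<le> 2" using t d by (auto simp: min_def max_def split: if_splits)
  have "(1 + d) powr K - (1 + K * d + K * (K - 1) / 2 * d\<^sup>2) = (K * (K - 1) * (K - 2)) * t powr (K - 3) * d ^ 3 / 6"
    unfolding e by (simp add: numeral_3_eq_3 numeral_2_eq_2 fact_numeral algebra_simps)
  also have "\<bar>\<dots>\<bar> = \<bar>K * (K - 1) * (K - 2)\<bar> * t powr (K - 3) * \<bar>d\<bar> ^ 3 / 6"
    by (simp add: abs_mult power_abs)
  also have "\<dots> \<le> \<bar>K * (K - 1) * (K - 2)\<bar> * t powr (K - 3) * \<bar>d\<bar> ^ 3"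
    by simp
  also have "\<dots> \<le> \<bar>K * (K - 1) * (K - 2)\<bar> * 2 powr \<bar>K - 3\<bar> * \<bar>d\<bar> ^ 3"
    by (intro mult_right_mono mult_left_mono powr_le_near_one t2) auto
  finally show "\<bar>(1 + d) powr K - (1 + K * d + K * (K - 1) / 2 * d\<^sup>2)\<bar>
      \<le> \<bar>K * (K - 1) * (K - 2)\<bar> * 2 powr \<bar>K - 3\<bar> * \<bar>d\<bar> ^ 3" .
next
  have d': "1 + d > 0" using d by linarith
  obtain t where t: "min 1 (1 + d) \<le> t" "t \<le> max 1 (1 + d)" and
    e: "(1 + d) powr K = (\<Sum>m<1. (\<Prod>i<m. K - real i) * 1 powr (K - real m) / fact m * (1 + d - 1) ^ m)
      + (\<Prod>i<1. K - real i) * t powr (K - real 1) / fact 1 * (1 + d - 1) ^ 1"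
    using powr_taylor[of 1 1 "1 + d" K] d' by auto
  have t2: "1/2 \<le> t" "t \<le> 2" using t d by (auto simp: min_def max_def split: if_splits)
  have "(1 + d) powr K - 1 = K * t powr (K - 1) * d" unfolding e by simp
  also have "\<bar>\<dots>\<bar> = \<bar>K\<bar> * t powr (K - 1) * \<bar>d\<bar>" by (simp add: abs_mult)
  also have "\<dots> \<le> \<bar>K\<bar> * 2 powr \<bar>K - 1\<bar> * \<bar>d\<bar>"
    by (intro mult_right_mono mult_left_mono powr_le_near_one t2) auto
  finally show "\<bar>(1 + d) powr K - 1\<bar> \<le> \<bar>K\<bar> * 2 powr \<bar>K - 1\<bar> * \<bar>d\<bar>" .
qed

text \<open>Here \<open>y\<close> may be large, so the intermediate point ranges up to
  \<open>2 + M\<close>. Its power \<open>K - 2\<close> grows with \<open>M\<close> if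
  \<open>K \<ge> 2\<close> and is largest at \<open>1/2\<close> otherwise;
  \<open>max (K - 2) 0\<close> merges the cases.\<close>

lemma powr_expand_increment:
  fixes K f y M :: real
  assumes f: "1/2 \<le> f" "f \<le> 2" and y: "0 \<le> y" "y \<le> M"
  shows "\<bar>(f + y) powr K - f powr K - K * f powr (K - 1) * y\<bar>
      \<le> \<bar>K * (K - 1)\<bar> * (2 powr \<bar>K - 2\<bar> * (2 + M) powr max (K - 2) 0) * y\<^sup>2"
proof -
  obtain t where t: "min f (f + y) \<le> t" "t \<le> max f (f + y)" and
    e: "(f + y) powr K = (\<Sum>m<2. (\<Prod>i<m. K - real i) * f powr (K - real m) / fact m * (f + y - f) ^ m)
      + (\<Prod>i<2. K - real i) * t powr (K - real 2) / fact 2 * (f + y - f) ^ 2"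
    using powr_taylor[of 2 f "f + y" K] f y by auto
  have t2: "1/2 \<le> t" "t \<le> 2 + M" using t f y by (auto simp: min_def max_def split: if_splits)
  have M: "2 + M \<ge> 1" using y by linarith
  have tp: "t powr (K - 2) \<le> 2 powr \<bar>K - 2\<bar> * (2 + M) powr max (K - 2) 0"
  proof (cases "K \<ge> 2")
    case True
    have "t powr (K - 2) \<le> (2 + M) powr (K - 2)" using True t2 by (intro powr_mono2) auto
    also have "\<dots> \<le> 2 powr \<bar>K - 2\<bar> * (2 + M) powr (K - 2)"
      using ge_one_powr_ge_zero[of 2 "\<bar>K - 2\<bar>"] by (simp add: mult_le_cancel_right1)
    finally show ?thesis using True by simp
  next
    case False
    have "t powr (K - 2) \<le> (1/2) powr (K - 2)" using False t2 by (intro powr_mono2') auto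
    also have "\<dots> = 2 powr \<bar>K - 2\<bar>" using False by (simp add: powr_divide powr_minus_divide[symmetric] flip: powr_minus)
    finally show ?thesis using False M by simp
  qed
  have "(f + y) powr K - f powr K - K * f powr (K - 1) * y = K * (K - 1) * t powr (K - 2) * y\<^sup>2 / 2"
    unfolding e by (simp add: numeral_2_eq_2)
  also have "\<bar>\<dots>\<bar> \<le> \<bar>K * (K - 1)\<bar> * t powr (K - 2) * y\<^sup>2"
    by (simp add: abs_mult)
  also have "\<dots> \<le> \<bar>K * (K - 1)\<bar> * (2 powr \<bar>K - 2\<bar> * (2 + M) powr max (K - 2) 0) * y\<^sup>2"
    by (intro mult_right_mono mult_left_mono tp) auto
  finally show ?thesis .
qed

section \<open>Elementary estimates of exponentials\<close>

lemma exp_minus_le: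
  fixes x :: real
  assumes "x \<ge> 0"
  shows "exp (- x) \<le> 1 - x + x\<^sup>2"
proof -
  have "(1 + x) * (1 - x + x\<^sup>2) = 1 + x ^ 3" by (simp add: power2_eq_square power3_eq_cube algebra_simps)
  then have "1 \<le> (1 + x) * (1 - x + x\<^sup>2)" using assms by simp
  then have "1 / (1 + x) \<le> 1 - x + x\<^sup>2" using assms by (simp add: field_simps)
  moreover have "exp (- x) \<le> 1 / (1 + x)"
    using assms exp_ge_add_one_self[of x] by (simp add: exp_minus divide_simps)
  ultimately show ?thesis by linarith
qed

text \<open>\<open>c\<close> is the hyperbolic cotangent of \<open>al\<close>, about
  \<open>1 / al\<close>, and \<open>s ^ k\<close> is about \<open>1 - k * al\<close>. The terms of
  order 1, \<open>c * k * al\<close> and \<open>k\<close>, cancel, and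
  \<open>c * al \<le> 1 + al\<close> controls the rest.\<close>

lemma exp_sq_ratio_bound:
  fixes al :: real
  assumes al: "0 < al" and k: "k \<ge> 1"
  defines "s \<equiv> exp (- al)"
  defines "c \<equiv> (1 + s\<^sup>2) / (1 - s\<^sup>2)"
  shows "c - (c + real k) * s ^ k \<le> 2 * (real k)\<^sup>2 * al"
proof -
  have s: "0 < s" "s < 1" using al by (auto simp: s_def)
  then have s2: "1 - s\<^sup>2 > 0" by (simp add: power_less_one_iff)
  have "s\<^sup>2 * (1 + 2 * al) \<le> s\<^sup>2 * exp (2 * al)"
    by (intro mult_left_mono) (use exp_ge_add_one_self[of "2 * al"] in auto)
  also have "\<dots> = 1" unfolding s_def by (simp flip: exp_double exp_add)
  finally have "al * (1 + s\<^sup>2) \<le> (1 + al) * (1 - s\<^sup>2)" by (simp add: algebra_simps)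
  then have ca: "c * al \<le> 1 + al" unfolding c_def using s2 by (simp add: field_simps)
  have c0: "c \<ge> 0" unfolding c_def using s2 by simp
  have sk: "s ^ k \<ge> 1 - real k * al"
    using exp_ge_add_one_self[of "- (real k * al)"] by (simp add: s_def flip: exp_of_nat_mult)
  have "c - (c + real k) * s ^ k \<le> c - (c + real k) * (1 - real k * al)"
    using mult_left_mono[OF sk, of "c + real k"] c0 by simp
  also have "\<dots> = real k * (c * al) - real k + (real k)\<^sup>2 * al"
    by (simp add: power2_eq_square algebra_simps)
  also have "\<dots> \<le> real k * (1 + al) - real k + (real k)\<^sup>2 * al"
    using ca by (intro add_mono diff_mono mult_left_mono) auto
  also have "\<dots> = real k * al + (real k)\<^sup>2 * al" by (simp add: algebra_simps)
  also have "real k * al \<le> (real k)\<^sup>2 * al"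
    using k al by (intro mult_right_mono) (auto simp: power2_eq_square)
  finally show ?thesis by (simp add: mult_ac)
qed

lemma sum_odds: "(\<Sum>j<N. real (2 * j + 1)) = (real N)\<^sup>2"
  by (induction N) (auto simp: power2_eq_square algebra_simps)

lemma sum_odds_sq_le: "(\<Sum>j<N. (real (2 * j + 1))\<^sup>2) \<le> 4 * real N ^ 3"
proof -
  have "(\<Sum>j<N. (real (2 * j + 1))\<^sup>2) \<le> (\<Sum>j<N. (2 * real N)\<^sup>2)"
    by (intro sum_mono power_mono) auto
  also have "\<dots> = 4 * real N ^ 3" by (simp add: power2_eq_square power3_eq_cube)
  finally show ?thesis .
qed

text \<open>The coefficients come from the generating function of the Bernoulli numbers. Clearing
  the denominator leaves an error of at most \<open>x ^ 4 / 2\<close> over a denominator of at least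
  \<open>x / 2\<close>.\<close>

lemma bernoulli_ratio_expand:
  fixes x :: real
  assumes x: "0 < x" "x \<le> 1"
  shows "\<bar>x / (1 - exp (- x)) - (1 + x / 2 + x\<^sup>2 / 12)\<bar> \<le> x ^ 3"
proof -
  obtain t where t: "\<bar>t\<bar> \<le> \<bar>- x\<bar>" "exp (- x) = (\<Sum>m<4. (- x) ^ m / fact m) + exp t / fact 4 * (- x) ^ 4"
    using Maclaurin_exp_le[of "- x" 4] by blast
  define r where "r = exp t / 24 * x ^ 4"
  have "exp t \<le> exp 1" using t x by simp
  then have et: "exp t \<le> 3" using exp_le by linarith
  then have "exp t * x ^ 4 \<le> 3 * x ^ 4" by (rule mult_right_mono) simp
  then have r: "0 \<le> r" "r \<le> x ^ 4 / 8" unfolding r_def by auto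
  have e: "1 - exp (- x) = x - x\<^sup>2 / 2 + x ^ 3 / 6 - r"
    unfolding t(2) r_def by (simp add: eval_nat_numeral fact_numeral algebra_simps)
  define q where "q = 1 + x / 2 + x\<^sup>2 / 12"
  have x2: "x\<^sup>2 \<le> 1" using x by (simp add: power_le_one)
  have q: "0 \<le> q" "q \<le> 2" using x x2 by (auto simp: q_def)
  have "exp (- x) \<le> 1 - x + x\<^sup>2 / 2"
  proof -
    have "x ^ 4 \<le> x ^ 3" using x by (intro power_decreasing) auto
    moreover have "0 \<le> x ^ 3" using x by simp
    ultimately show ?thesis using e r by linarith
  qed
  moreover have "x\<^sup>2 \<le> x" using x by (simp add: power2_eq_square mult_le_cancel_left1)
  ultimately have den: "1 - exp (- x) \<ge> x / 2" by linarith
  have "x - q * (1 - exp (- x)) = - (x ^ 4 / 24 + x ^ 5 / 72) + q * r"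
    unfolding e q_def by (simp add: eval_nat_numeral algebra_simps)
  moreover have "q * r \<le> 2 * (x ^ 4 / 8)" by (rule mult_mono) (use q r in auto)
  moreover have "0 \<le> q * r" using q r by simp
  moreover have "0 \<le> x ^ 5" "x ^ 5 \<le> x ^ 4" using x by (auto intro!: power_decreasing)
  ultimately have num: "\<bar>x - q * (1 - exp (- x))\<bar> \<le> x ^ 4 / 2" by linarith
  have "x / (1 - exp (- x)) - q = (x - q * (1 - exp (- x))) / (1 - exp (- x))"
    using den x by (simp add: field_simps)
  also have "\<bar>\<dots>\<bar> = \<bar>x - q * (1 - exp (- x))\<bar> / (1 - exp (- x))"
    using den x by simp
  also have "\<dots> \<le> (x ^ 4 / 2) / (x / 2)"
    using num den x by (intro frac_le) auto
  also have "\<dots> = x ^ 3" using x by (simp add: eval_nat_numeral)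
  finally show ?thesis by (simp add: q_def)
qed

lemma base_expand:
  fixes a al :: real
  assumes al: "0 < al" "al \<le> a" and a: "a \<le> 1"
  shows "\<bar>(al / (1 - exp (- al)) - a * exp al) - 1 - (al / 2 - a) - (al\<^sup>2 / 12 - a * al)\<bar> \<le> 2 * a ^ 3"
proof -
  have b: "\<bar>al / (1 - exp (- al)) - (1 + al / 2 + al\<^sup>2 / 12)\<bar> \<le> al ^ 3"
    using bernoulli_ratio_expand al a by simp
  have "al ^ 3 \<le> a ^ 3" using al by (intro power_mono) auto
  moreover have "exp al - 1 - al \<le> al\<^sup>2" using exp_bound[of al] al a by simp
  then have "a * (exp al - 1 - al) \<le> a * al\<^sup>2" using al by (intro mult_left_mono) auto
  moreover have "0 \<le> exp al - 1 - al" using exp_ge_add_one_self[of al] by linarith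
  then have "0 \<le> a * (exp al - 1 - al)" using al by (intro mult_nonneg_nonneg) auto
  ultimately have c: "0 \<le> a * (exp al - 1 - al)" "a * (exp al - 1 - al) \<le> a * al\<^sup>2" "al ^ 3 \<le> a ^ 3"
    by blast+
  have "a * al\<^sup>2 \<le> a * a\<^sup>2" using al by (intro mult_left_mono power_mono) auto
  then have d: "a * al\<^sup>2 \<le> a ^ 3" by (simp add: eval_nat_numeral)
  have "(al / (1 - exp (- al)) - a * exp al) - 1 - (al / 2 - a) - (al\<^sup>2 / 12 - a * al) =
     (al / (1 - exp (- al)) - (1 + al / 2 + al\<^sup>2 / 12)) - a * (exp al - 1 - al)"
    by (simp add: algebra_simps)
  then show ?thesis using b c d by linarith
qed

text \<open>\<open>F0\<close> and \<open>F1\<close> stand for the powers \<open>K\<close> and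
  \<open>K - 1\<close> of \<open>f0 = 1 + d\<close>, and \<open>E\<close> for the mean of
  \<open>Y\<close>. The constants: \<open>64\<close> is the cube in
  \<open>\<bar>d\<bar> \<le> 4 * a\<close>, \<open>6\<close> adds the errors of \<open>d\<close> and
  \<open>E\<close>, \<open>12\<close> bounds \<open>(d - d1) * (d + d1)\<close>, \<open>8\<close> is
  \<open>\<bar>d\<bar> \<le> 4 * a\<close> times
  \<open>\<bar>E\<bar> \<le> 2 * a\<^sup>2\<close>.\<close>

lemma combine_expansion:
  fixes K a al d d1 d2 F0 F1 E C1 C2 :: real
  assumes al: "0 < al" "al \<le> a" and a: "a \<le> 1/16"
    and d1: "d1 = al / 2 - a" and d2: "d2 = al\<^sup>2 / 12 - a * al"
    and d: "\<bar>d - d1 - d2\<bar> \<le> 2 * a ^ 3"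
    and F0: "\<bar>F0 - (1 + K * d + K * (K - 1) / 2 * d\<^sup>2)\<bar> \<le> C1 * \<bar>d\<bar> ^ 3"
    and F1: "\<bar>F1 - 1\<bar> \<le> C2 * \<bar>d\<bar>" and E: "\<bar>E - a\<^sup>2\<bar> \<le> 4 * a ^ 3" and C: "C1 \<ge> 0" "C2 \<ge> 0"
  shows "\<bar>F0 + K * F1 * E - (1 + K * (d1 + d2) + K * (K - 1) / 2 * d1\<^sup>2 + K * a\<^sup>2)\<bar>
    \<le> (64 * C1 + 6 * \<bar>K\<bar> + 12 * \<bar>K * (K - 1) / 2\<bar> + 8 * \<bar>K\<bar> * C2) * a ^ 3"
    and "\<bar>d\<bar> \<le> 4 * a"
proof -
  have a0: "0 < a" using al by simp
  have a2: "a\<^sup>2 \<le> a / 16" using a a0 by (simp add: power2_eq_square)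
  have a3: "a ^ 3 \<le> a\<^sup>2 / 16" "0 \<le> a ^ 3" using a a0 by (simp_all add: power2_eq_square power3_eq_cube)
  have b1: "\<bar>d1\<bar> \<le> a" unfolding d1 using al by linarith
  have "al\<^sup>2 \<le> a\<^sup>2" "a * al \<le> a\<^sup>2" "0 \<le> a * al" "0 \<le> al\<^sup>2"
    using al a0 by (auto simp: power2_eq_square intro!: mult_mono)
  then have b2: "\<bar>d2\<bar> \<le> a\<^sup>2 + a\<^sup>2 / 12" unfolding d2 by linarith
  have dd1: "\<bar>d - d1\<bar> \<le> 2 * a\<^sup>2" using d b2 a3 by linarith
  show dle: "\<bar>d\<bar> \<le> 4 * a" using dd1 b1 a2 a0 by linarith
  have q: "\<bar>d\<^sup>2 - d1\<^sup>2\<bar> \<le> 12 * a ^ 3"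
  proof -
    have "d\<^sup>2 - d1\<^sup>2 = (d - d1) * (d + d1)" by (simp add: power2_eq_square algebra_simps)
    moreover have "\<bar>(d - d1) * (d + d1)\<bar> \<le> (2 * a\<^sup>2) * (6 * a)"
      unfolding abs_mult using dd1 dle b1 a0 by (intro mult_mono) auto
    ultimately show ?thesis by (simp add: power2_eq_square power3_eq_cube)
  qed
  have E2: "\<bar>E\<bar> \<le> 2 * a\<^sup>2" using E a3 by linarith
  have t1: "\<bar>F0 - (1 + K * d + K * (K - 1) / 2 * d\<^sup>2)\<bar> \<le> 64 * C1 * a ^ 3"
  proof -
    have "C1 * \<bar>d\<bar> ^ 3 \<le> C1 * (4 * a) ^ 3" using dle C by (intro mult_left_mono power_mono) auto
    then show ?thesis using F0 by (simp add: power_mult_distrib)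
  qed
  have t2: "\<bar>K * (d - d1 - d2)\<bar> \<le> \<bar>K\<bar> * (2 * a ^ 3)" unfolding abs_mult using d by (intro mult_left_mono) auto
  have t3: "\<bar>K * (K - 1) / 2 * (d\<^sup>2 - d1\<^sup>2)\<bar> \<le> \<bar>K * (K - 1) / 2\<bar> * (12 * a ^ 3)"
    unfolding abs_mult[of "K * (K - 1) / 2"] using q by (intro mult_left_mono) auto
  have t4: "\<bar>K * ((F1 - 1) * E)\<bar> \<le> \<bar>K\<bar> * (C2 * (4 * a) * (2 * a\<^sup>2))"
  proof -
    have "\<bar>F1 - 1\<bar> \<le> C2 * (4 * a)" using F1 dle C mult_left_mono[OF dle, of C2] by linarith
    then show ?thesis unfolding abs_mult using E2 C a0 by (intro mult_left_mono mult_mono) auto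
  qed
  have t5: "\<bar>K * (E - a\<^sup>2)\<bar> \<le> \<bar>K\<bar> * (4 * a ^ 3)" unfolding abs_mult using E by (intro mult_left_mono) auto
  \<comment> \<open>The variable \<open>k\<close> shields \<open>K * (K - 1) / 2\<close> from being
    multiplied out.\<close>
  have split: "F0 + K * F1 * E - (1 + K * (d1 + d2) + k * d1\<^sup>2 + K * a\<^sup>2) =
     (F0 - (1 + K * d + k * d\<^sup>2)) + K * (d - d1 - d2) + k * (d\<^sup>2 - d1\<^sup>2)
     + K * ((F1 - 1) * E) + K * (E - a\<^sup>2)" for k
    by (simp add: algebra_simps)
  have "F0 + K * F1 * E - (1 + K * (d1 + d2) + K * (K - 1) / 2 * d1\<^sup>2 + K * a\<^sup>2) =
     (F0 - (1 + K * d + K * (K - 1) / 2 * d\<^sup>2)) + K * (d - d1 - d2) + K * (K - 1) / 2 * (d\<^sup>2 - d1\<^sup>2)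
     + K * ((F1 - 1) * E) + K * (E - a\<^sup>2)"
    by (rule split)
  also have "\<bar>\<dots>\<bar> \<le> 64 * C1 * a ^ 3 + \<bar>K\<bar> * (2 * a ^ 3) + \<bar>K * (K - 1) / 2\<bar> * (12 * a ^ 3)
     + \<bar>K\<bar> * (C2 * (4 * a) * (2 * a\<^sup>2)) + \<bar>K\<bar> * (4 * a ^ 3)"
    by (intro order_trans[OF abs_triangle_ineq] add_mono t1 t2 t3 t4 t5)
  also have "\<dots> = (64 * C1 + 6 * \<bar>K\<bar> + 12 * \<bar>K * (K - 1) / 2\<bar> + 8 * \<bar>K\<bar> * C2) * a ^ 3"
    by (simp add: power2_eq_square power3_eq_cube algebra_simps)
  finally show "\<bar>F0 + K * F1 * E - (1 + K * (d1 + d2) + K * (K - 1) / 2 * d1\<^sup>2 + K * a\<^sup>2)\<bar>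
    \<le> (64 * C1 + 6 * \<bar>K\<bar> + 12 * \<bar>K * (K - 1) / 2\<bar> + 8 * \<bar>K\<bar> * C2) * a ^ 3" .
qed

section \<open>The expansion for fixed \<open>N\<close>, with explicit constants\<close>

locale haar_expansion =
  fixes N :: nat and \<mu> :: "real mat measure" and a :: real
  assumes H: "is_Haar_prob_SO (2 * N + 1) \<mu>" and N: "N \<ge> 1" and a: "0 < a" "a \<le> 1/16"
begin

definition "al = a / real N"
definition "s = exp (- al)"
text \<open>The base of the power at \<open>S X = 0\<close>: the eigenvalue 1 contributes
  \<open>al / (1 - s)\<close>, and each of the other \<open>2 N\<close> contributes
  \<open>- al / (2 * s)\<close> besides its kernel, in total \<open>- a * exp al\<close>.\<close>

definition "f0 = al / (1 - s) - a * exp al"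
definition "S X = 2 * trace_gen (2 * N + 1) s X - real (2 * N + 1) - (1 + s) / (1 - s)"
definition "V X = (1 + s\<^sup>2) / (1 - s\<^sup>2) * (2 * trace_gen (2 * N + 1) s X - real (2 * N + 1))
   + 2 * trace_gen_deriv (2 * N + 1) s X - ((1 + s) / (1 - s))\<^sup>2"
definition "Y X = al / (2 * s) * S X"

sublocale prob_space \<mu> by (rule haar_facts[OF H])

lemma al: "0 < al" "al \<le> a" "al \<le> 1/16" "al * real N = a"
proof -
  show "0 < al" "al * real N = a" using N a by (auto simp: al_def)
  show "al \<le> a" using N a by (simp add: al_def divide_le_eq mult_le_cancel_left1)
  then show "al \<le> 1/16" using a by simp
qed

lemma s: "0 < s" "s < 1" "1 / s = exp al" "exp al \<le> 1 + 2 * al" "al / (1 - s) \<le> 2" "1 / s \<le> 2"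
proof -
  show "0 < s" "s < 1" using al by (auto simp: s_def)
  show "1 / s = exp al" by (simp add: s_def exp_minus field_simps)
  have al2: "al\<^sup>2 \<le> al / 16" using al by (simp add: power2_eq_square)
  then have "exp al \<le> 1 + al + al" using exp_bound[of al] al by simp
  then show e: "exp al \<le> 1 + 2 * al" by simp
  show "1 / s \<le> 2" using e al unfolding \<open>1 / s = exp al\<close> by linarith
  have "1 - s \<ge> al / 2" using exp_minus_le[of al] al al2 by (simp add: s_def)
  then show "al / (1 - s) \<le> 2" using al \<open>s < 1\<close> by (simp add: divide_le_eq)
qed

lemma n: "odd (2 * N + 1)" "2 * N + 1 \<ge> 3" using N by auto

lemma S_bounds:
  assumes "X \<in> SO_mats (2 * N + 1)"
  shows "0 \<le> S X" "S X \<le> 2 * real N * ((1 + s) / (1 - s))" "(S X)\<^sup>2 \<le> 2 * real N * V X"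
    "Lambda_logderiv X (of_real s) = - of_real ((trace_gen (2 * N + 1) s X - real (2 * N + 1)) / s)"
  using SO_poisson[OF assms n(1) s(1,2)] by (simp_all add: S_def V_def)

lemma base_eq:
  assumes "X \<in> SO_mats (2 * N + 1)"
  shows "complex_of_real (- al) * Lambda_logderiv X (of_real s) = of_real (f0 + Y X)"
proof -
  have "f0 + Y X = al / s * (trace_gen (2 * N + 1) s X - real (2 * N + 1))"
  proof -
    have "(1 + s) / (1 - s) = 1 + 2 * s / (1 - s)" using s(2) by (simp add: field_simps)
    then have "al / (2 * s) * ((1 + s) / (1 - s)) = al / (2 * s) + al / (1 - s)"
      using s(1) by (simp add: algebra_simps)
    moreover have "a * exp al = al / s * real N" using al(4) s(3) by (metis mult.commute mult.left_commute mult_1 times_divide_eq_right)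
    ultimately show ?thesis using s(1) unfolding f0_def Y_def S_def
      by (simp add: algebra_simps)
  qed
  then show ?thesis unfolding S_bounds(4)[OF assms] by simp
qed

lemma Y_bounds:
  assumes X: "X \<in> SO_mats (2 * N + 1)"
  shows "0 \<le> Y X" "Y X \<le> 6 * real N" "(Y X)\<^sup>2 \<le> 2 * al\<^sup>2 * real N * V X"
proof -
  note SB = S_bounds[OF X]
  show "0 \<le> Y X" using SB(1) al s by (simp add: Y_def)
  have "Y X \<le> al / (2 * s) * (2 * real N * ((1 + s) / (1 - s)))"
    unfolding Y_def using SB(2) al s by (intro mult_left_mono) auto
  also have "\<dots> = real N * (al / (1 - s)) * (1 / s + 1)" using s(1,2) by (simp add: field_simps)
  also have "\<dots> \<le> real N * 2 * (2 + 1)" using s al by (intro mult_mono add_mono) auto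
  finally show "Y X \<le> 6 * real N" by simp
  have V: "0 \<le> 2 * real N * V X" using SB(3) zero_le_power2[of "S X"] by linarith
  have "(Y X)\<^sup>2 = al\<^sup>2 / 4 * (1 / s)\<^sup>2 * (S X)\<^sup>2" by (simp add: Y_def power_mult_distrib power_divide)
  also have "\<dots> \<le> al\<^sup>2 / 4 * 2\<^sup>2 * (2 * real N * V X)"
    using s V SB(3) by (intro mult_mono power_mono mult_nonneg_nonneg) auto
  finally show "(Y X)\<^sup>2 \<le> 2 * al\<^sup>2 * real N * V X" by simp
qed

lemma integrable_SV: "integrable \<mu> S" "integrable \<mu> V" "integrable \<mu> Y"
  unfolding S_def[abs_def] V_def[abs_def] Y_def[abs_def]
  using integral_trace_gen(1,2)[OF H n s(1,2)] by auto

text \<open>Linearising \<open>1 - s ^ (2 * j + 1)\<close> turns the sum into \<open>al\<close>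
  times the sum of the first \<open>N\<close> odd numbers, which is \<open>N\<^sup>2\<close>. The
  mean is then close to \<open>(al * N)\<^sup>2 = a\<^sup>2\<close>.\<close>

lemma integral_Y: "\<bar>(\<integral>X. Y X \<partial>\<mu>) - a\<^sup>2\<bar> \<le> 4 * a ^ 3"
proof -
  define T where "T = (\<Sum>j<N. 1 - s ^ (2 * j + 1))"
  have "(\<integral>X. S X \<partial>\<mu>) = 2 * T"
    using integral_trace_gen(3)[OF H n s(1,2)] by (simp add: S_def T_def)
  then have EY: "(\<integral>X. Y X \<partial>\<mu>) = al * T * exp al"
    unfolding Y_def using s(3)[symmetric] by simp
  have sp: "s ^ k = exp (- (real k * al))" for k by (simp add: s_def flip: exp_of_nat_mult)
  have "T \<le> (\<Sum>j<N. real (2 * j + 1) * al)"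
    unfolding T_def sp using exp_ge_add_one_self[of "- (real k * al)" for k]
    by (intro sum_mono) (smt (verit))
  also have "\<dots> = (real N)\<^sup>2 * al" by (simp only: sum_distrib_right[symmetric] sum_odds)
  finally have T1: "T \<le> (real N)\<^sup>2 * al" .
  have "(\<Sum>j<N. real (2 * j + 1) * al - (real (2 * j + 1))\<^sup>2 * al\<^sup>2) \<le> T"
    unfolding T_def sp
  proof (intro sum_mono)
    fix j
    show "real (2 * j + 1) * al - (real (2 * j + 1))\<^sup>2 * al\<^sup>2 \<le> 1 - exp (- (real (2 * j + 1) * al))"
      using exp_minus_le[of "real (2 * j + 1) * al"] al by (simp only: power_mult_distrib) simp
  qed
  also have "(\<Sum>j<N. real (2 * j + 1) * al - (real (2 * j + 1))\<^sup>2 * al\<^sup>2) =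
      (real N)\<^sup>2 * al - (\<Sum>j<N. (real (2 * j + 1))\<^sup>2) * al\<^sup>2"
    by (simp only: sum_subtractf sum_distrib_right[symmetric] sum_odds)
  finally have T2: "(real N)\<^sup>2 * al - 4 * real N ^ 3 * al\<^sup>2 \<le> T"
    using mult_right_mono[OF sum_odds_sq_le[of N], of "al\<^sup>2"] by simp
  have T0: "0 \<le> T" unfolding T_def using s power_le_one[of s] by (intro sum_nonneg) (simp only: diff_ge_0_iff_ge)
  have "al * ((real N)\<^sup>2 * al) = (al * real N)\<^sup>2" "al * (4 * real N ^ 3 * al\<^sup>2) = 4 * (al * real N) ^ 3"
    by (simp_all add: power2_eq_square power3_eq_cube)
  then have aN: "al * ((real N)\<^sup>2 * al) = a\<^sup>2" "al * (4 * real N ^ 3 * al\<^sup>2) = 4 * a ^ 3"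
    by (simp_all only: al(4))
  have "al * T \<le> a\<^sup>2" using mult_left_mono[OF T1, of al] al aN by simp
  then have "al * T * exp al \<le> a\<^sup>2 * (1 + 2 * al)"
    using s(4) T0 al by (intro mult_mono) auto
  also have "\<dots> = a\<^sup>2 + 2 * (a\<^sup>2 * al)" by (simp add: algebra_simps)
  also have "a\<^sup>2 * al \<le> a\<^sup>2 * a" using al by (intro mult_left_mono) auto
  finally have u: "al * T * exp al \<le> a\<^sup>2 + 2 * a ^ 3" by (simp add: power2_eq_square power3_eq_cube)
  have "a\<^sup>2 - 4 * a ^ 3 \<le> al * T" using mult_left_mono[OF T2, of al] al aN by (simp add: right_diff_distrib)
  also have "al * T * 1 \<le> al * T * exp al" using T0 al by (intro mult_left_mono) auto
  then have "al * T \<le> al * T * exp al" by simp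
  finally have l: "a\<^sup>2 - 4 * a ^ 3 \<le> al * T * exp al" .
  have "0 \<le> a ^ 3" using a by simp
  then show ?thesis unfolding EY using u l by linarith
qed

text \<open>With \<open>Y_bounds\<close> this bounds the second moment of \<open>Y\<close> by
  \<open>2 * al\<^sup>2 * N * 16 * N ^ 3 * al = 32 * N * a ^ 3\<close>.\<close>

lemma integral_V: "(\<integral>X. V X \<partial>\<mu>) \<le> 16 * real N ^ 3 * al"
proof -
  have "(\<integral>X. V X \<partial>\<mu>) = 2 * (\<Sum>j<N. (1 + s\<^sup>2) / (1 - s\<^sup>2) - ((1 + s\<^sup>2) / (1 - s\<^sup>2) + real (2 * j + 1)) * s ^ (2 * j + 1))"
    using integral_trace_gen(4)[OF H n s(1,2)] by (simp add: V_def)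
  also have "\<dots> \<le> 2 * (\<Sum>j<N. 2 * (real (2 * j + 1))\<^sup>2 * al)"
    unfolding s_def by (intro mult_left_mono sum_mono exp_sq_ratio_bound al) auto
  also have "\<dots> = 4 * ((\<Sum>j<N. (real (2 * j + 1))\<^sup>2) * al)"
    by (simp only: sum_distrib_left[symmetric] sum_distrib_right[symmetric])
  also have "\<dots> \<le> 4 * (4 * real N ^ 3 * al)"
    using sum_odds_sq_le[of N] al by (intro mult_left_mono mult_right_mono) auto
  finally show ?thesis by simp
qed

text \<open>The remainder is at most \<open>B\<close> times the second moment of \<open>Y\<close>,
  hence at most \<open>32 * B * N * a ^ 3\<close>. Since \<open>2 + 6 N \<le> 8 N\<close> and
  \<open>K - 2 \<le> m - 1\<close>, \<open>B\<close> grows at most like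
  \<open>N ^ (m - 1)\<close>.\<close>

lemma integral_powr_expand:
  fixes K :: real and m :: nat
  assumes f: "1/2 \<le> f0" "f0 \<le> 2" and K: "K > 0" "K \<le> real m + 1" and m: "m \<ge> 1"
  shows "\<bar>(\<integral>X. (f0 + Y X) powr K \<partial>\<mu>) - (f0 powr K + K * f0 powr (K - 1) * (\<integral>X. Y X \<partial>\<mu>))\<bar>
    \<le> (\<bar>K * (K - 1)\<bar> * (2 powr \<bar>K - 2\<bar> * 8 powr max (K - 2) 0) * 32) * (real N ^ m * a ^ 3)"
proof -
  define B where "B = \<bar>K * (K - 1)\<bar> * (2 powr \<bar>K - 2\<bar> * (2 + 6 * real N) powr max (K - 2) 0)"
  have B0: "B \<ge> 0" by (simp add: B_def)
  define D where "D X = (f0 + Y X) powr K - f0 powr K - K * f0 powr (K - 1) * Y X" for X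
  have SO: "X \<in> SO_mats (2 * N + 1)" if "X \<in> space \<mu>" for X using that haar_facts(3)[OF H] by simp
  have Db: "\<bar>D X\<bar> \<le> B * (2 * al\<^sup>2 * real N) * V X" if "X \<in> space \<mu>" for X
  proof -
    note YB = Y_bounds[OF SO[OF that]]
    have "\<bar>D X\<bar> \<le> B * (Y X)\<^sup>2"
      unfolding D_def B_def by (rule powr_expand_increment[OF f YB(1,2)])
    also have "\<dots> \<le> B * (2 * al\<^sup>2 * real N * V X)" using YB(3) B0 by (rule mult_left_mono)
    finally show ?thesis by (simp add: mult.assoc)
  qed
  have iP: "integrable \<mu> (\<lambda>X. (f0 + Y X) powr K)"
  proof (rule integrable_const_bound[of _ "(2 + 6 * real N) powr K"])
    show "AE X in \<mu>. norm ((f0 + Y X) powr K) \<le> (2 + 6 * real N) powr K"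
    proof (rule AE_I2)
      fix X assume "X \<in> space \<mu>"
      note YB = Y_bounds[OF SO[OF this]]
      show "norm ((f0 + Y X) powr K) \<le> (2 + 6 * real N) powr K"
        using YB f K by (auto intro!: powr_mono2)
    qed
    show "(\<lambda>X. (f0 + Y X) powr K) \<in> borel_measurable \<mu>"
      using borel_measurable_integrable[OF integrable_SV(3)] by measurable
  qed
  have iD: "integrable \<mu> D" unfolding D_def[abs_def] using iP integrable_SV(3) by auto
  have ED: "(\<integral>X. D X \<partial>\<mu>) = (\<integral>X. (f0 + Y X) powr K \<partial>\<mu>) - (f0 powr K + K * f0 powr (K - 1) * (\<integral>X. Y X \<partial>\<mu>))"
    unfolding D_def using iP integrable_SV(3) by (simp add: prob_space)
  have "\<bar>\<integral>X. D X \<partial>\<mu>\<bar> \<le> (\<integral>X. \<bar>D X\<bar> \<partial>\<mu>)" by (rule integral_abs_bound)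
  also have "\<dots> \<le> (\<integral>X. B * (2 * al\<^sup>2 * real N) * V X \<partial>\<mu>)"
    using iD integrable_SV(2) Db by (intro integral_mono) auto
  also have "\<dots> = B * (2 * al\<^sup>2 * real N) * (\<integral>X. V X \<partial>\<mu>)" by simp
  also have "\<dots> \<le> B * (2 * al\<^sup>2 * real N) * (16 * real N ^ 3 * al)"
    using integral_V B0 by (intro mult_left_mono) auto
  also have "\<dots> = B * 32 * (real N * (al * real N) ^ 3)"
    by (simp add: power2_eq_square power3_eq_cube)
  also have "\<dots> = B * 32 * (real N * a ^ 3)" by (simp only: al(4))
  also have "B * 32 * (real N * a ^ 3) \<le>
      (\<bar>K * (K - 1)\<bar> * (2 powr \<bar>K - 2\<bar> * (8 powr max (K - 2) 0 * real N ^ (m - 1)))) * 32 * (real N * a ^ 3)"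
  proof -
    have "(2 + 6 * real N) powr max (K - 2) 0 \<le> (8 * real N) powr max (K - 2) 0"
      using N by (intro powr_mono2) auto
    also have "\<dots> = 8 powr max (K - 2) 0 * real N powr max (K - 2) 0" by (simp add: powr_mult)
    also have "real N powr max (K - 2) 0 \<le> real N powr real (m - 1)"
      using N K m by (intro powr_mono) (auto simp: of_nat_diff)
    also have "\<dots> = real N ^ (m - 1)" using N by (simp add: powr_realpow)
    finally have "(2 + 6 * real N) powr max (K - 2) 0 \<le> 8 powr max (K - 2) 0 * real N ^ (m - 1)" by simp
    then show ?thesis unfolding B_def using a by (intro mult_right_mono mult_left_mono) auto
  qed
  also have "\<dots> = (\<bar>K * (K - 1)\<bar> * (2 powr \<bar>K - 2\<bar> * 8 powr max (K - 2) 0) * 32) * (real N ^ m * a ^ 3)"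
    using m by (cases m) (simp_all add: mult_ac)
  finally show ?thesis unfolding ED .
qed

lemma powr_moment_bound:
  fixes K :: real and m :: nat
  assumes K: "K > 0" "K \<le> real m + 1" and m: "m \<ge> 1"
  shows "cmod ((\<integral>X. (complex_of_real (- a / real N) * Lambda_logderiv X (complex_of_real (exp (- (a / real N)))))
                 powr complex_of_real K \<partial>\<mu>)
            - complex_of_real
                (1 - K * a + K * a / (2 * real N) + K * (K + 1) / 2 * a\<^sup>2
                 - K * (K + 1) * a\<^sup>2 / (2 * real N)
                 + a\<^sup>2 / (real N)\<^sup>2 * K * ((3 * K - 1) / 24)))
      \<le> (\<bar>K * (K - 1)\<bar> * (2 powr \<bar>K - 2\<bar> * 8 powr max (K - 2) 0) * 32
         + (64 * (\<bar>K * (K - 1) * (K - 2)\<bar> * 2 powr \<bar>K - 3\<bar>) + 6 * \<bar>K\<bar> + 12 * \<bar>K * (K - 1) / 2\<bar>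
            + 8 * \<bar>K\<bar> * (\<bar>K - 1\<bar> * 2 powr \<bar>K - 2\<bar>))) * (real N ^ m * a ^ 3)"
    (is "cmod (?I - complex_of_real ?T) \<le> (?C3 + ?C4) * _")
proof -
  define d1 d2 where "d1 = al / 2 - a" and "d2 = al\<^sup>2 / 12 - a * al"
  define d where "d = f0 - 1"
  have d: "\<bar>d - d1 - d2\<bar> \<le> 2 * a ^ 3"
    using base_expand[of al a] al a by (simp add: d_def d1_def d2_def f0_def s_def)
  note pre = al(1,2) a(2) d1_def d2_def d
  \<comment> \<open>The bound on \<open>d\<close> follows from \<open>pre\<close> alone but sits in
    a lemma about \<open>F0\<close>, \<open>F1\<close> and \<open>E\<close>. Trivial values are
    inserted for them, as the true estimates already presuppose
    \<open>\<bar>d\<bar> \<le> 1/2\<close>.\<close>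
  have d4: "\<bar>d\<bar> \<le> 4 * a"
  proof -
    have *: "\<bar>(1 + 0 * d + 0 * (0 - 1) / 2 * d\<^sup>2) - (1 + 0 * d + 0 * (0 - 1) / 2 * d\<^sup>2)\<bar> \<le> 0 * \<bar>d\<bar> ^ 3"
      "\<bar>1 - 1\<bar> \<le> 0 * \<bar>d\<bar>" "\<bar>a\<^sup>2 - a\<^sup>2\<bar> \<le> 4 * a ^ 3" using a by auto
    show ?thesis by (rule combine_expansion(2)[OF pre *]) auto
  qed
  then have dh: "\<bar>d\<bar> \<le> 1/2" using a by linarith
  then have f: "1/2 \<le> f0" "f0 \<le> 2" unfolding d_def by linarith+
  have f0: "f0 = 1 + d" by (simp add: d_def)
  define E where "E = (\<integral>X. Y X \<partial>\<mu>)"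
  define G where "G = (\<integral>X. (f0 + Y X) powr K \<partial>\<mu>)"
  have F0: "\<bar>f0 powr K - (1 + K * d + K * (K - 1) / 2 * d\<^sup>2)\<bar> \<le> \<bar>K * (K - 1) * (K - 2)\<bar> * 2 powr \<bar>K - 3\<bar> * \<bar>d\<bar> ^ 3"
    unfolding f0 by (rule powr_expand_at_1(1)[OF dh])
  have F1: "\<bar>f0 powr (K - 1) - 1\<bar> \<le> \<bar>K - 1\<bar> * 2 powr \<bar>K - 2\<bar> * \<bar>d\<bar>"
    using powr_expand_at_1(2)[OF dh, of "K - 1"] unfolding f0 by simp
  have c: "\<bar>f0 powr K + K * f0 powr (K - 1) * E - (1 + K * (d1 + d2) + K * (K - 1) / 2 * d1\<^sup>2 + K * a\<^sup>2)\<bar> \<le> ?C4 * a ^ 3"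
    by (rule combine_expansion(1)[OF pre F0 F1 integral_Y[folded E_def]]) auto
  have tri: "\<bar>x - z\<bar> \<le> \<bar>x - y\<bar> + b" if "\<bar>y - z\<bar> \<le> b" for x y z b :: real
    using that by linarith
  have aN: "a / real N = al" by (simp add: al_def)
  \<comment> \<open>The mean of \<open>Y\<close> supplies \<open>K * a\<^sup>2\<close>, which raises
    \<open>K * (K - 1) / 2\<close> to \<open>K * (K + 1) / 2\<close>. The coefficient of
    \<open>al\<^sup>2\<close> is \<open>K / 12 + K * (K - 1) / 8\<close>.\<close>
  have T: "?T = 1 + K * (d1 + d2) + K * (K - 1) / 2 * d1\<^sup>2 + K * a\<^sup>2"
  proof -
    have "K * a / (2 * real N) = K * al / 2" "K * (K + 1) * a\<^sup>2 / (2 * real N) = K * (K + 1) * a * al / 2"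
      "a\<^sup>2 / (real N)\<^sup>2 = al\<^sup>2"
      by (simp_all add: al_def power2_eq_square)
    then have "?T = 1 - K * a + K * al / 2 + K * (K + 1) / 2 * a\<^sup>2 - K * (K + 1) * a * al / 2 + al\<^sup>2 * K * ((3 * K - 1) / 24)"
      by simp
    also have "\<dots> = 1 + K * (d1 + d2) + K * (K - 1) / 2 * d1\<^sup>2 + K * a\<^sup>2"
      unfolding d1_def d2_def by (simp add: power2_eq_square field_simps)
    finally show ?thesis .
  qed
  have "?I = (\<integral>X. complex_of_real ((f0 + Y X) powr K) \<partial>\<mu>)"
  proof (rule Bochner_Integration.integral_cong[OF refl])
    fix X assume "X \<in> space \<mu>"
    then have X: "X \<in> SO_mats (2 * N + 1)" using haar_facts(3)[OF H] by simp
    have "complex_of_real (- a / real N) * Lambda_logderiv X (complex_of_real (exp (- (a / real N)))) = of_real (f0 + Y X)"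
      using base_eq[OF X] by (simp add: aN s_def)
    \<comment> \<open>On a nonnegative real base the complex power agrees with the real one, so no
      branch is involved.\<close>
    moreover have "f0 + Y X \<ge> 0" using f Y_bounds(1)[OF X] by linarith
    ultimately show "(complex_of_real (- a / real N) * Lambda_logderiv X (complex_of_real (exp (- (a / real N)))))
                 powr complex_of_real K = complex_of_real ((f0 + Y X) powr K)"
      by (simp only: powr_of_real)
  qed
  also have "\<dots> = complex_of_real G" unfolding G_def by (rule integral_complex_of_real)
  finally have "cmod (?I - complex_of_real ?T) = \<bar>G - ?T\<bar>"
    by (simp only: of_real_diff[symmetric] norm_of_real)
  also have "\<dots> \<le> \<bar>G - (f0 powr K + K * f0 powr (K - 1) * E)\<bar> + ?C4 * a ^ 3"
    unfolding T by (rule tri[OF c])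
  also have "\<dots> \<le> ?C3 * (real N ^ m * a ^ 3) + ?C4 * (real N ^ m * a ^ 3)"
  proof (rule add_mono)
    show "\<bar>G - (f0 powr K + K * f0 powr (K - 1) * E)\<bar> \<le> ?C3 * (real N ^ m * a ^ 3)"
      unfolding G_def E_def by (rule integral_powr_expand[OF f K m])
    have "1 * a ^ 3 \<le> real N ^ m * a ^ 3" using N a by (intro mult_right_mono one_le_power) auto
    then show "?C4 * a ^ 3 \<le> ?C4 * (real N ^ m * a ^ 3)" by (intro mult_left_mono) auto
  qed
  finally show ?thesis by (simp only: distrib_right)
qed

end

theorem theorem3:
  fixes K :: real and m :: nat and haar :: "nat \<Rightarrow> real mat measure"
  assumes "K > 0"
    and "odd m" and "m \<ge> 3" and "int m \<ge> \<lfloor>K\<rfloor>"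
    and "\<And>N. is_Haar_prob_SO (2 * N + 1) (haar N)"
  shows "\<exists>C::real. \<forall>a :: nat \<Rightarrow> real.
    (\<forall>N. a N > 0) \<longrightarrow> a \<in> o(\<lambda>N. 1 / real N ^ (m + 2)) \<longrightarrow>
    (\<forall>\<^sub>F N in sequentially.
      cmod ((\<integral>X. (complex_of_real (- a N / real N) *
                  Lambda_logderiv X (complex_of_real (exp (- (a N / real N)))))
                 powr complex_of_real K \<partial>haar N)
            - complex_of_real
                (1 - K * a N + K * a N / (2 * real N) + K * (K + 1) / 2 * (a N)\<^sup>2
                 - K * (K + 1) * (a N)\<^sup>2 / (2 * real N)
                 + (a N)\<^sup>2 / (real N)\<^sup>2 * K * ((3 * K - 1) / 24)))
      \<le> C * (real N ^ m * a N ^ 3))"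
proof -
  have K: "K \<le> real m + 1" using assms(4) by linarith
  show ?thesis
  \<comment> \<open>The witness is instantiated by the bound shown below; it depends on
    \<open>K\<close> alone and is fixed before \<open>a\<close>.\<close>
  proof (intro exI allI impI)
    fix a :: "nat \<Rightarrow> real"
    assume pos: "\<forall>N. a N > 0" and o: "a \<in> o(\<lambda>N. 1 / real N ^ (m + 2))"
    \<comment> \<open>The factor \<open>1/16\<close> is the threshold of
      \<open>haar_expansion\<close>, chosen small enough for
      \<open>\<bar>d\<bar> \<le> 4 * a \<le> 1/2\<close>; for \<open>N \<ge> 1\<close> the little-o
      bound puts \<open>a N\<close> below it.\<close>
    have "\<forall>\<^sub>F N in sequentially. norm (a N) \<le> 1/16 * norm (1 / real N ^ (m + 2))"
      by (rule landau_o.smallD[OF o]) simp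
    then show "\<forall>\<^sub>F N in sequentially.
      cmod ((\<integral>X. (complex_of_real (- a N / real N) *
                  Lambda_logderiv X (complex_of_real (exp (- (a N / real N)))))
                 powr complex_of_real K \<partial>haar N)
            - complex_of_real
                (1 - K * a N + K * a N / (2 * real N) + K * (K + 1) / 2 * (a N)\<^sup>2
                 - K * (K + 1) * (a N)\<^sup>2 / (2 * real N)
                 + (a N)\<^sup>2 / (real N)\<^sup>2 * K * ((3 * K - 1) / 24)))
      \<le> (\<bar>K * (K - 1)\<bar> * (2 powr \<bar>K - 2\<bar> * 8 powr max (K - 2) 0) * 32
         + (64 * (\<bar>K * (K - 1) * (K - 2)\<bar> * 2 powr \<bar>K - 3\<bar>) + 6 * \<bar>K\<bar> + 12 * \<bar>K * (K - 1) / 2\<bar>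
            + 8 * \<bar>K\<bar> * (\<bar>K - 1\<bar> * 2 powr \<bar>K - 2\<bar>))) * (real N ^ m * a N ^ 3)"
      using eventually_ge_at_top[of 1]
    proof eventually_elim
      case (elim N)
      have "1 / real N ^ (m + 2) \<le> 1" using elim(2) one_le_power[of "real N" "m + 2"] by (simp del: power_add power_Suc add: divide_le_eq_1)
      then have "a N \<le> 1/16" using elim(1) pos[rule_format, of N]
        by (simp only: real_norm_def abs_of_pos abs_of_nonneg zero_le_divide_1_iff zero_le_power of_nat_0_le_iff)
      then interpret haar_expansion N "haar N" "a N"
        using assms(5) elim(2) pos by unfold_locales auto
      show ?case by (rule powr_moment_bound) (use assms(1,3) K in auto)
    qed
  qed
qed

end
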